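(* Let $V$ be the solution of the convertible bond problem (P) described in the context, under the standing assumptions stated there, let $\Gamma=\partial\{V>\gamma x\}\cap D_T$ be its free boundary, and let $X^*=(K/\gamma,t^* )$ be the point at which $\Gamma$ hits the fixed boundary. Then $\Gamma$ is uniformly parabolically tangential to the fixed boundary at $X^*$: there exist a modulus of continuity $\omega$ (with $\omega(0^+)=0$) and $r_0>0$, depending only on the data $K,\gamma,T,\sigma,r,q,c$, such that $$\Gamma\cap Q_{r_0}(X^* )\subset\left\{(x,t):\ t-t^*\le-\frac{|x-K/\gamma|^2}{\omega(|x-K/\gamma|)}\right\}.$$
   Context: Constants: $K>0$ (call price and face value), $\gamma>0$ (conversion factor), $T>0$ (maturity), $\sigma>0$ (volatility), $r>0$ (interest rate), $q>0$ (dividend rate), $c\ge 0$ (coupon rate). Put $D_T=(0,K/\gamma)\times(0,T)$ and $$\mathcal{L}=-\partial_t-\tfrac12\sigma^2x^2\partial_{xx}-(r-q)x\,\partial_x+r.$$ Problem (P): find $V$ with $\gamma x\le V\le K$ in $D_T$ such that $$\mathcal{L}V=c\ \text{ in } D_T\cap\{\gamma x<V<K\},\qquad \mathcal{L}V\ge c\ \text{ in } D_T,$$ $$V(K/\gamma,t)=K\ \ (0\le t\le T),\qquad V(x,T)=K\ \ (0\le x\le K/\gamma).$$ A solution $V$ belongs to $W^{2,p}_{x,\mathrm{loc}}\cap W^{1,p}_{t,\mathrm{loc}}(D_T)$ for $1<p<\infty$ (i.e. $V,V_x,V_{xx},V_t\in L^p_{\mathrm{loc}}(D_T)$), the (in)equalities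 hold almost everywhere, and the boundary values are attained continuously. In particular there is a smooth fit along the free boundary. No boundary value is prescribed on $\{x=0\}$. Standing assumptions: $c<rK$ and $c<qK$. Only solutions with $\lim_{x\to0}x^2V_{xx}(x,t)=\lim_{x\to0}xV_x(x,t)=0$ are considered (in this class the solution is unique). The conversion (exercise) region $\Lambda=\{(x,t)\in D_T: V(x,t)=\gamma x\}$ is nonempty. It is known that there is $t^*<T$ such that $\Gamma$ hits the fixed boundary ($\{x=0\}$, $\{x=K/\gamma\}$, $\{t=T\}$) at $(K/\gamma,t^* )$ and at no other point; this defines $t^*$ and $X^*$. Notation: for $X=(x,t)$ and $\rho>0$, $Q_\rho(X)=\{y\in\mathbb{R}:|y-x|<\rho\}\times(t-\rho^2,t+\rho^2)$. A modulus of continuity is a nondecreasing function $\omega:(0,\infty)\to(0,\infty)$ with $\lim_{s\to0^+}\omega(s)=0$. *)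

theory Defs
  imports "HOL-Analysis.Analysis"
begin

section \<open>Weak derivatives in the \<open>(x, t)\<close>-plane\<close>

text \<open>
  Points of the plane are pairs \<open>(x, t)\<close>. The family \<open>D\<close> below consists of the partial
  derivatives \<open>\<partial>\<^sub>x\<^sup>i \<partial>\<^sub>t\<^sup>j \<phi>\<close>; their existence and continuity for all \<open>i, j\<close> is smoothness of \<open>\<phi>\<close>.
\<close>

definition smooth_plane :: "(real \<times> real \<Rightarrow> real) \<Rightarrow> bool" where
  "smooth_plane \<phi> \<longleftrightarrow>
     (\<exists>D :: nat \<Rightarrow> nat \<Rightarrow> real \<times> real \<Rightarrow> real.
        D 0 0 = \<phi> \<and>
        (\<forall>i j. continuous_on UNIV (D i j)) \<and>
        (\<forall>i j x t. ((\<lambda>y. D i j (y, t)) has_real_derivative D (Suc i) j (x, t)) (at x)) \<and>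
        (\<forall>i j x t. ((\<lambda>s. D i j (x, s)) has_real_derivative D i (Suc j) (x, t)) (at t)))"

definition test_function :: "(real \<times> real) set \<Rightarrow> (real \<times> real \<Rightarrow> real) \<Rightarrow> bool" where
  "test_function U \<phi> \<longleftrightarrow>
     smooth_plane \<phi> \<and> (\<exists>C. compact C \<and> C \<subseteq> U \<and> (\<forall>z. z \<notin> C \<longrightarrow> \<phi> z = 0))"

definition partial_x :: "(real \<times> real \<Rightarrow> real) \<Rightarrow> real \<times> real \<Rightarrow> real" where
  "partial_x \<phi> = (\<lambda>(x, t). deriv (\<lambda>y. \<phi> (y, t)) x)"

definition partial_t :: "(real \<times> real \<Rightarrow> real) \<Rightarrow> real \<times> real \<Rightarrow> real" where
  "partial_t \<phi> = (\<lambda>(x, t). deriv (\<lambda>s. \<phi> (x, s)) t)"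

definition Lp_loc :: "real \<Rightarrow> (real \<times> real) set \<Rightarrow> (real \<times> real \<Rightarrow> real) \<Rightarrow> bool" where
  "Lp_loc p U f \<longleftrightarrow>
     f \<in> borel_measurable (lebesgue_on U) \<and>
     (\<forall>C. compact C \<and> C \<subseteq> U \<longrightarrow> integrable (lebesgue_on C) (\<lambda>z. \<bar>f z\<bar> powr p))"

text \<open>
  The following two notions are used only for \<open>f\<close> and \<open>g\<close> that are locally integrable on \<open>U\<close>, so
  that both integrals exist.
\<close>

definition weak_partial_x ::
    "(real \<times> real) set \<Rightarrow> (real \<times> real \<Rightarrow> real) \<Rightarrow> (real \<times> real \<Rightarrow> real) \<Rightarrow> bool" where
  "weak_partial_x U f g \<longleftrightarrow>
     (\<forall>\<phi>. test_function U \<phi> \<longrightarrow>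
        (LINT z|lebesgue_on U. f z * partial_x \<phi> z) = - (LINT z|lebesgue_on U. g z * \<phi> z))"

definition weak_partial_t ::
    "(real \<times> real) set \<Rightarrow> (real \<times> real \<Rightarrow> real) \<Rightarrow> (real \<times> real \<Rightarrow> real) \<Rightarrow> bool" where
  "weak_partial_t U f g \<longleftrightarrow>
     (\<forall>\<phi>. test_function U \<phi> \<longrightarrow>
        (LINT z|lebesgue_on U. f z * partial_t \<phi> z) = - (LINT z|lebesgue_on U. g z * \<phi> z))"

text \<open>
  \<open>V\<close> belongs to \<open>W\<^sup>2\<^sup>,\<^sup>p\<close> in \<open>x\<close> and \<open>W\<^sup>1\<^sup>,\<^sup>p\<close> in \<open>t\<close>, locally in \<open>U\<close> and for every \<open>1 < p < \<infinity>\<close>, with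
  weak derivatives \<open>Vx\<close>, \<open>Vxx\<close>, \<open>Vt\<close>.
\<close>

definition W21_loc ::
    "(real \<times> real) set \<Rightarrow> (real \<times> real \<Rightarrow> real) \<Rightarrow> (real \<times> real \<Rightarrow> real) \<Rightarrow>
     (real \<times> real \<Rightarrow> real) \<Rightarrow> (real \<times> real \<Rightarrow> real) \<Rightarrow> bool" where
  "W21_loc U V Vx Vxx Vt \<longleftrightarrow>
     weak_partial_x U V Vx \<and> weak_partial_x U Vx Vxx \<and> weak_partial_t U V Vt \<and>
     (\<forall>p>1. Lp_loc p U V \<and> Lp_loc p U Vx \<and> Lp_loc p U Vxx \<and> Lp_loc p U Vt)"


section \<open>The convertible bond problem\<close>

definition bond_domain :: "real \<Rightarrow> real \<Rightarrow> real \<Rightarrow> (real \<times> real) set" where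
  "bond_domain K \<gamma> T = {0<..<K/\<gamma>} \<times> {0<..<T}"

text \<open>The part of the boundary where data are prescribed.\<close>

definition bond_data_boundary :: "real \<Rightarrow> real \<Rightarrow> real \<Rightarrow> (real \<times> real) set" where
  "bond_data_boundary K \<gamma> T = ({K/\<gamma>} \<times> {0..T}) \<union> ({0..K/\<gamma>} \<times> {T})"

definition bond_fixed_boundary :: "real \<Rightarrow> real \<Rightarrow> real \<Rightarrow> (real \<times> real) set" where
  "bond_fixed_boundary K \<gamma> T =
     ({0} \<times> {0..T}) \<union> ({K/\<gamma>} \<times> {0..T}) \<union> ({0..K/\<gamma>} \<times> {T})"

text \<open>\<open>\<L>V = -V\<^sub>t - \<sigma>\<^sup>2x\<^sup>2V\<^sub>x\<^sub>x/2 - (r-q)xV\<^sub>x + rV\<close>\<close>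

definition bond_operator ::
    "real \<Rightarrow> real \<Rightarrow> real \<Rightarrow> (real \<times> real \<Rightarrow> real) \<Rightarrow> (real \<times> real \<Rightarrow> real) \<Rightarrow>
     (real \<times> real \<Rightarrow> real) \<Rightarrow> (real \<times> real \<Rightarrow> real) \<Rightarrow> real \<times> real \<Rightarrow> real" where
  "bond_operator \<sigma> r q V Vx Vxx Vt =
     (\<lambda>(x, t). - Vt (x, t) - 1/2 * \<sigma>\<^sup>2 * x\<^sup>2 * Vxx (x, t) - (r - q) * x * Vx (x, t) + r * V (x, t))"

text \<open>
  Functions in the local Sobolev class have a continuous representative, and \<open>V\<close> is that
  representative. Continuity up to the data boundary expresses that the boundary values are attained
  continuously. The values of \<open>V\<close> elsewhere, in particular at \<open>(0, t)\<close> with \<open>t < T\<close>, are irrelevant.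
\<close>

definition bond_solution ::
    "real \<Rightarrow> real \<Rightarrow> real \<Rightarrow> real \<Rightarrow> real \<Rightarrow> real \<Rightarrow> real \<Rightarrow> (real \<times> real \<Rightarrow> real) \<Rightarrow> bool" where
  "bond_solution K \<gamma> T \<sigma> r q c V \<longleftrightarrow>
     continuous_on (bond_domain K \<gamma> T \<union> bond_data_boundary K \<gamma> T) V \<and>
     (\<forall>x t. (x, t) \<in> bond_domain K \<gamma> T \<longrightarrow> \<gamma> * x \<le> V (x, t) \<and> V (x, t) \<le> K) \<and>
     (\<forall>t\<in>{0..T}. V (K/\<gamma>, t) = K) \<and>
     (\<forall>x\<in>{0..K/\<gamma>}. V (x, T) = K) \<and>
     (\<exists>Vx Vxx Vt.
        W21_loc (bond_domain K \<gamma> T) V Vx Vxx Vt \<and>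
        (AE z in lebesgue. z \<in> bond_domain K \<gamma> T \<and> \<gamma> * fst z < V z \<and> V z < K \<longrightarrow>
           bond_operator \<sigma> r q V Vx Vxx Vt z = c) \<and>
        (AE z in lebesgue. z \<in> bond_domain K \<gamma> T \<longrightarrow>
           bond_operator \<sigma> r q V Vx Vxx Vt z \<ge> c))"

text \<open>
  \<open>x\<^sup>2 V\<^sub>x\<^sub>x(x, t) \<rightarrow> 0\<close> and \<open>x V\<^sub>x(x, t) \<rightarrow> 0\<close> as \<open>x \<rightarrow> 0\<close>, for every \<open>t\<close>. These are pointwise statements,
  so the derivatives are the classical ones: a solution is smooth in \<open>x\<close> near \<open>x = 0\<close>, where the
  obstacle \<open>\<gamma>x\<close> is not active.
\<close>

definition regular_at_zero :: "real \<Rightarrow> (real \<times> real \<Rightarrow> real) \<Rightarrow> bool" where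
  "regular_at_zero T V \<longleftrightarrow>
     (\<forall>t\<in>{0<..<T}. \<exists>v1 v2.
        (\<forall>\<^sub>F x in at_right 0. ((\<lambda>y. V (y, t)) has_real_derivative v1 x) (at x) \<and>
                             (v1 has_real_derivative v2 x) (at x)) \<and>
        ((\<lambda>x. x\<^sup>2 * v2 x) \<longlongrightarrow> 0) (at_right 0) \<and>
        ((\<lambda>x. x * v1 x) \<longlongrightarrow> 0) (at_right 0))"

definition conversion_region ::
    "real \<Rightarrow> real \<Rightarrow> real \<Rightarrow> (real \<times> real \<Rightarrow> real) \<Rightarrow> (real \<times> real) set" where
  "conversion_region K \<gamma> T V = {(x, t). (x, t) \<in> bond_domain K \<gamma> T \<and> V (x, t) = \<gamma> * x}"

definition free_boundary ::
    "real \<Rightarrow> real \<Rightarrow> real \<Rightarrow> (real \<times> real \<Rightarrow> real) \<Rightarrow> (real \<times> real) set" where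
  "free_boundary K \<gamma> T V =
     frontier {(x, t). (x, t) \<in> bond_domain K \<gamma> T \<and> V (x, t) > \<gamma> * x} \<inter> bond_domain K \<gamma> T"

text \<open>
  The free boundary lies in the open domain; it hits the fixed boundary at the points of the latter
  that belong to its closure.
\<close>

definition hits_only_at ::
    "real \<Rightarrow> real \<Rightarrow> real \<Rightarrow> (real \<times> real \<Rightarrow> real) \<Rightarrow> real \<times> real \<Rightarrow> bool" where
  "hits_only_at K \<gamma> T V X \<longleftrightarrow>
     closure (free_boundary K \<gamma> T V) \<inter> bond_fixed_boundary K \<gamma> T = {X}"


section \<open>Parabolic tangency\<close>

definition parabolic_cylinder :: "real \<Rightarrow> real \<times> real \<Rightarrow> (real \<times> real) set" where
  "parabolic_cylinder \<rho> X = {y. \<bar>y - fst X\<bar> < \<rho>} \<times> {snd X - \<rho>\<^sup>2 <..< snd X + \<rho>\<^sup>2}"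

text \<open>Only the values on \<open>(0, \<infinity>)\<close> matter.\<close>

definition modulus_of_continuity :: "(real \<Rightarrow> real) \<Rightarrow> bool" where
  "modulus_of_continuity \<omega> \<longleftrightarrow>
     (\<forall>s>0. \<omega> s > 0) \<and> mono_on {0<..} \<omega> \<and> (\<omega> \<longlongrightarrow> 0) (at_right 0)"

end

theory Submission
  imports Defs
begin

text \<open>
  Write \<open>X = K/\<gamma>\<close>, \<open>u = V - \<gamma>x\<close> and \<open>d = X - x\<close>; everything is obtained by comparison with explicit
  barriers, with constants depending only on the data, and \<open>\<omega>\<close> comes out linear.

  Multiplicative mollification commutes with \<open>\<L>\<close>, so \<open>V\<close> is a locally uniform limit of classical
  supersolutions (and \<open>- V\<close> too where \<open>\<gamma>x < V < K\<close>), which is enough to compare \<open>V\<close> with smooth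
  barriers and with its own shifts and dilations. Comparing \<open>V(\<lambda>x, t)\<close> with \<open>\<lambda>(V(x, t - h) + rKh)\<close> shows
  that \<open>V/x\<close> is nonincreasing in \<open>x\<close> and that \<open>V\<^sub>t \<le> rK\<close>. The first fact and the uniqueness of the hitting
  point give \<open>u > 0\<close> for \<open>t > t\<^sup>*\<close>; a barrier near \<open>x = X\<close> improves the second one to \<open>V\<^sub>t \<le> C d\<close> for \<open>t\<close>
  up to a fixed time after \<open>t\<^sup>*\<close>. In \<open>t > t\<^sup>*\<close> the equation then bounds \<open>u\<^sub>x\<^sub>x\<close> below by
  \<open>2 \<alpha> - C d\<close> with \<open>\<alpha> = (qK - c)/(\<sigma>\<^sup>2X\<^sup>2)\<close>, and since \<open>u \<ge> 0\<close> vanishes at \<open>d = 0\<close>, \<open>u \<ge> \<alpha> d\<^sup>2 - \<beta> d\<^sup>3\<close> at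
  time \<open>t\<^sup>*\<close>. Going back in time, \<open>u\<close> cannot vanish before \<open>C d (t\<^sup>* - t)\<close> has consumed this amount, that is,
  before \<open>t\<^sup>* - t \<ge> \<alpha> d/(2C)\<close>.

  The inequality \<open>\<L>V \<ge> c\<close> alone would also admit concave kinks at the level \<open>K\<close>. They are excluded by
  the Sobolev regularity, and \<open>K - V\<close> then satisfies a strong maximum principle.
\<close>

section \<open>Smooth bump functions\<close>

text \<open>What decides tangency is the factor d in the bound on the time derivative. With V_t
  \<le> rK alone the amount alpha d^2 would be consumed only after a time of order d^2, which still
  allows the free boundary to follow a parabola; the factor d, gained from the constant value K on
  the side x = K/\<gamma>, turns this into a time of order d. The amount is positive because the
  obstacle is a strict supersolution there: \<open>\<L>\<close> maps \<gamma>x to q\<gamma>x, which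
  tends to qK > c.

  The difficulty is that the equation is available only strictly between \<gamma>x and K, so V < K
  must be known for a time after \<open>tstar\<close> that depends on the data alone. A slice on
  which V = K forbids contact near x = K/\<gamma> for a fixed time before it, and the strong maximum
  principle turns a single interior point with V = K into a whole slice. As the free boundary
  reaches x = K/\<gamma> at \<open>tstar\<close>, no such point occurs within that fixed time after
  it.\<close>

fun times_differentiable :: "nat \<Rightarrow> (real \<Rightarrow> real) \<Rightarrow> bool" where
  "times_differentiable 0 f \<longleftrightarrow> True"
| "times_differentiable (Suc n) f \<longleftrightarrow>
     (\<exists>f'. (\<forall>x. (f has_real_derivative f' x) (at x)) \<and> times_differentiable n f')"

definition smooth_real :: "(real \<Rightarrow> real) \<Rightarrow> bool" where
  "smooth_real f \<longleftrightarrow> (\<forall>n. times_differentiable n f)"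

lemma times_differentiable_SucD: "times_differentiable (Suc n) f \<Longrightarrow> times_differentiable n f"
proof (induction n arbitrary: f)
  case (Suc n)
  then obtain f' where "\<forall>x. (f has_real_derivative f' x) (at x)" "times_differentiable (Suc n) f'"
    by (metis times_differentiable.simps(2))
  with Suc.IH[of f'] show ?case by auto
qed simp

lemma times_differentiable_const: "times_differentiable n (\<lambda>x. a)"
proof (induction n arbitrary: a)
  case (Suc n)
  have "\<forall>x. ((\<lambda>x. a) has_real_derivative 0) (at x)" by simp
  with Suc[of 0] show ?case by (metis times_differentiable.simps(2))
qed simp

lemma times_differentiable_id: "times_differentiable n (\<lambda>x. x)"
proof (cases n)
  case (Suc m)
  have "\<forall>x::real. ((\<lambda>x. x) has_real_derivative 1) (at x)" by simp
  with times_differentiable_const[of m 1] Suc show ?thesis by (metis times_differentiable.simps(2))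
qed simp

lemma times_differentiable_add:
  "times_differentiable n f \<Longrightarrow> times_differentiable n g \<Longrightarrow> times_differentiable n (\<lambda>x. f x + g x)"
proof (induction n arbitrary: f g)
  case (Suc n)
  obtain f' g' where
      f': "\<And>x. (f has_real_derivative f' x) (at x)" "times_differentiable n f'"
    and g': "\<And>x. (g has_real_derivative g' x) (at x)" "times_differentiable n g'"
    using Suc.prems by auto
  have "\<forall>x. ((\<lambda>x. f x + g x) has_real_derivative f' x + g' x) (at x)"
    by (auto intro!: derivative_eq_intros f' g')
  with Suc.IH[OF f'(2) g'(2)] show ?case
    unfolding times_differentiable.simps by (intro exI[of _ "\<lambda>x. f' x + g' x"]) simp
qed simp

lemma times_differentiable_mult:
  "times_differentiable n f \<Longrightarrow> times_differentiable n g \<Longrightarrow> times_differentiable n (\<lambda>x. f x * g x)"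
proof (induction n arbitrary: f g)
  case (Suc n)
  obtain f' g' where
      f': "\<And>x. (f has_real_derivative f' x) (at x)" "times_differentiable n f'"
    and g': "\<And>x. (g has_real_derivative g' x) (at x)" "times_differentiable n g'"
    using Suc.prems by auto
  have "\<forall>x. ((\<lambda>x. f x * g x) has_real_derivative f' x * g x + f x * g' x) (at x)"
    by (auto intro!: derivative_eq_intros f' g')
  moreover have "times_differentiable n (\<lambda>x. f' x * g x + f x * g' x)"
    by (intro times_differentiable_add Suc.IH f' g' times_differentiable_SucD[OF Suc.prems(1)]
          times_differentiable_SucD[OF Suc.prems(2)])
  ultimately show ?case
    unfolding times_differentiable.simps by (intro exI[of _ "\<lambda>x. f' x * g x + f x * g' x"]) simp
qed simp

lemma times_differentiable_compose:
  "times_differentiable n f \<Longrightarrow> times_differentiable n g \<Longrightarrow> times_differentiable n (\<lambda>x. f (g x))"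
proof (induction n arbitrary: f g)
  case (Suc n)
  obtain f' g' where
      f': "\<And>x. (f has_real_derivative f' x) (at x)" "times_differentiable n f'"
    and g': "\<And>x. (g has_real_derivative g' x) (at x)" "times_differentiable n g'"
    using Suc.prems by auto
  have "\<forall>x. ((\<lambda>x. f (g x)) has_real_derivative f' (g x) * g' x) (at x)"
    using DERIV_chain2 f' g' by blast
  moreover have "times_differentiable n (\<lambda>x. f' (g x) * g' x)"
    by (rule times_differentiable_mult[OF Suc.IH[OF f'(2)]])
      (use Suc.prems g' times_differentiable_SucD in \<open>blast+\<close>)
  ultimately show ?case
    unfolding times_differentiable.simps by (intro exI[of _ "\<lambda>x. f' (g x) * g' x"]) simp
qed simp

named_theorems smooth_intros

lemma smooth_const [smooth_intros]: "smooth_real (\<lambda>x. a)"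
  by (simp add: smooth_real_def times_differentiable_const)

lemma smooth_id [smooth_intros]: "smooth_real (\<lambda>x. x)"
  by (simp add: smooth_real_def times_differentiable_id)

lemma smooth_add [smooth_intros]:
  "smooth_real f \<Longrightarrow> smooth_real g \<Longrightarrow> smooth_real (\<lambda>x. f x + g x)"
  by (simp add: smooth_real_def times_differentiable_add)

lemma smooth_mult [smooth_intros]:
  "smooth_real f \<Longrightarrow> smooth_real g \<Longrightarrow> smooth_real (\<lambda>x. f x * g x)"
  by (simp add: smooth_real_def times_differentiable_mult)

lemma smooth_compose: "smooth_real f \<Longrightarrow> smooth_real g \<Longrightarrow> smooth_real (\<lambda>x. f (g x))"
  by (simp add: smooth_real_def times_differentiable_compose)

lemma smooth_diff [smooth_intros]:
  assumes "smooth_real f" "smooth_real g" shows "smooth_real (\<lambda>x. f x - g x)"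
  using smooth_add[OF assms(1) smooth_mult[OF smooth_const[of "-1"] assms(2)]] by simp

lemma smooth_divide_const [smooth_intros]:
  assumes "smooth_real f" shows "smooth_real (\<lambda>x. f x / a)"
  using smooth_mult[OF smooth_const[of "1/a"] assms] by simp

lemma smooth_power [smooth_intros]:
  "smooth_real f \<Longrightarrow> smooth_real (\<lambda>x. f x ^ n)"
  by (induction n) (auto intro: smooth_intros)

lemma smooth_DERIV: "smooth_real f \<Longrightarrow> (f has_real_derivative deriv f x) (at x)"
  unfolding smooth_real_def
  by (metis DERIV_imp_deriv times_differentiable.simps(2))

lemma smooth_deriv [smooth_intros]: "smooth_real f \<Longrightarrow> smooth_real (deriv f)"
  unfolding smooth_real_def
proof
  fix n assume "\<forall>n. times_differentiable n f"
  then have "times_differentiable (Suc n) f" by blast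
  then obtain f' where f': "\<forall>x. (f has_real_derivative f' x) (at x)" "times_differentiable n f'"
    by auto
  then have "deriv f = f'" by (auto intro: DERIV_imp_deriv)
  with f' show "times_differentiable n (deriv f)" by simp
qed

lemma smooth_continuous_on: "smooth_real f \<Longrightarrow> continuous_on S f"
  by (meson DERIV_isCont continuous_at_imp_continuous_on smooth_DERIV)

text \<open>Only products of a function of x and a function of t serve as test functions below; for
  these the family demanded by \<open>smooth_plane\<close> consists of products of iterated
  one-variable derivatives.\<close>

lemma smooth_plane_product:
  assumes "smooth_real f" "smooth_real g"
  shows "smooth_plane (\<lambda>(x, t). f x * g t)"
proof -
  define F where "F i = (deriv ^^ i) f" for i
  define G where "G i = (deriv ^^ i) g" for i
  have F: "smooth_real (F i)" for i unfolding F_def by (induction i) (auto intro: assms smooth_intros)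
  have G: "smooth_real (G i)" for i unfolding G_def by (induction i) (auto intro: assms smooth_intros)
  have dF: "(F i has_real_derivative F (Suc i) x) (at x)" for i x
    using smooth_DERIV[OF F[of i], of x] by (simp add: F_def)
  have dG: "(G i has_real_derivative G (Suc i) x) (at x)" for i x
    using smooth_DERIV[OF G[of i], of x] by (simp add: G_def)
  show ?thesis unfolding smooth_plane_def
  proof (intro exI[of _ "\<lambda>i j (x, t). F i x * G j t"] conjI allI)
    show "(\<lambda>(x, t). F 0 x * G 0 t) = (\<lambda>(x, t). f x * g t)" by (simp add: F_def G_def)
    show "continuous_on UNIV (\<lambda>(x, t). F i x * G j t)" for i j
      unfolding case_prod_beta
      by (intro continuous_intros continuous_on_compose2[OF smooth_continuous_on[OF F, of UNIV]]
            continuous_on_compose2[OF smooth_continuous_on[OF G, of UNIV]]) auto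
    show "((\<lambda>y. case (y, t) of (x, t) \<Rightarrow> F i x * G j t) has_real_derivative
          (case (x, t) of (x, t) \<Rightarrow> F (Suc i) x * G j t)) (at x)" for i j x t
      by (auto intro!: derivative_eq_intros dF)
    show "((\<lambda>s. case (x, s) of (x, t) \<Rightarrow> F i x * G j t) has_real_derivative
          (case (x, t) of (x, t) \<Rightarrow> F i x * G (Suc j) t)) (at t)" for i j x t
      by (auto intro!: derivative_eq_intros dG)
  qed
qed

section \<open>The flat exponential and the standard bump\<close>

text \<open>For \<open>p = 1\<close> this is the classical flat function exp(-1/x). Admitting a
  polynomial in 1/x closes the family under differentiation, p becoming y^2 (p - p') in the variable
  y = 1/x, so that smoothness is a plain induction over the order.\<close>

definition flat_exp :: "real poly \<Rightarrow> real \<Rightarrow> real" where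
  "flat_exp p x = (if x > 0 then poly p (1/x) * exp (- 1/x) else 0)"

text \<open>After y = 1/x this is the decay of a polynomial against exp(-y). The extra division by x
  makes the expression the difference quotient of \<open>flat_exp p\<close> at 0 from the
  right.\<close>

lemma flat_exp_limit: "((\<lambda>x. poly p (1/x) * exp (- 1/x) / x) \<longlongrightarrow> 0) (at_right (0::real))"
proof -
  have "((\<lambda>y. poly ([:0,1:] * p) y * exp (- y)) \<longlongrightarrow> 0) at_top"
  proof -
    have "((\<lambda>y. (\<Sum>i\<le>degree q. coeff q i * (y ^ i / exp y))) \<longlongrightarrow> (\<Sum>i\<le>degree q. coeff q i * 0)) at_top"
      for q :: "real poly"
      by (intro tendsto_sum tendsto_mult tendsto_const tendsto_power_div_exp_0)
    then have "((\<lambda>y. poly q y * exp (- y)) \<longlongrightarrow> 0) at_top" for q :: "real poly"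
      by (simp add: poly_altdef exp_minus sum_divide_distrib sum_distrib_right field_simps)
    then show ?thesis .
  qed
  then have "((\<lambda>x::real. poly ([:0,1:] * p) (inverse x) * exp (- (inverse x))) \<longlongrightarrow> 0) (at_right 0)"
    by (rule filterlim_compose[OF _ filterlim_inverse_at_top_right])
  then show ?thesis by (simp add: field_simps)
qed

lemma flat_exp_DERIV:
  "(flat_exp p has_real_derivative flat_exp ([:0,0,1:] * (p - pderiv p)) x) (at x)"
proof -
  consider "x > 0" | "x < 0" | "x = 0" by linarith
  then show ?thesis
  proof cases
    case 1
    have "((\<lambda>x. poly p (1/x) * exp (- 1/x)) has_real_derivative
            flat_exp ([:0,0,1:] * (p - pderiv p)) x) (at x)"
      using 1 by (auto intro!: derivative_eq_intros simp: flat_exp_def field_simps power2_eq_square)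
    then show ?thesis
      by (rule has_field_derivative_transform_within_open[where S = "{0<..}"])
         (use 1 in \<open>auto simp: flat_exp_def\<close>)
  next
    case 2
    have "((\<lambda>x. 0) has_real_derivative flat_exp ([:0,0,1:] * (p - pderiv p)) x) (at x)"
      using 2 by (simp add: flat_exp_def)
    then show ?thesis
      by (rule has_field_derivative_transform_within_open[where S = "{..<0}"])
         (use 2 in \<open>auto simp: flat_exp_def\<close>)
  next
    case 3
    have "((\<lambda>y. flat_exp p y / y) \<longlongrightarrow> 0) (at_right 0)"
      by (rule tendsto_cong[THEN iffD1, OF _ flat_exp_limit[of p]])
         (auto simp: eventually_at_filter flat_exp_def)
    moreover have "((\<lambda>y. flat_exp p y / y) \<longlongrightarrow> 0) (at_left 0)"
      by (rule tendsto_cong[THEN iffD1, OF _ tendsto_const[of 0]])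
         (auto simp: eventually_at_filter flat_exp_def)
    ultimately have "((\<lambda>y. flat_exp p y / y) \<longlongrightarrow> 0) (at 0)"
      by (simp add: filterlim_split_at)
    then show ?thesis using 3
      by (simp add: has_field_derivative_iff flat_exp_def)
  qed
qed

lemma smooth_flat_exp [smooth_intros]: "smooth_real (flat_exp p)"
proof -
  have "times_differentiable n (flat_exp p)" for n
    by (induction n arbitrary: p) (use flat_exp_DERIV in \<open>auto intro: exI\<close>)
  then show ?thesis by (simp add: smooth_real_def)
qed

text \<open>The standard mollifier profile exp(-1/(1 - x^2)), not normalised.\<close>

definition bump :: "real \<Rightarrow> real" where
  "bump x = flat_exp 1 (1 - x\<^sup>2)"

text \<open>Since \<open>bump' x = - x * bump_weight x\<close>, the derivative of an average with weight \<open>bump_weight\<close> in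
  the scale of averaging is an average of a pure second derivative.\<close>

definition bump_weight :: "real \<Rightarrow> real" where
  "bump_weight x = 2 * flat_exp [:0, 0, 1:] (1 - x\<^sup>2)"

lemma smooth_bump: "smooth_real bump"
  unfolding bump_def[abs_def] by (intro smooth_compose[OF smooth_flat_exp] smooth_intros)

lemma smooth_bump_weight: "smooth_real bump_weight"
  unfolding bump_weight_def[abs_def]
  by (intro smooth_mult smooth_const smooth_compose[OF smooth_flat_exp] smooth_intros)

lemma bump_DERIV: "(bump has_real_derivative - x * bump_weight x) (at x)"
proof -
  have "(flat_exp 1 has_real_derivative flat_exp [:0,0,1:] (1 - x\<^sup>2)) (at (1 - x\<^sup>2))"
    using flat_exp_DERIV[of 1 "1 - x\<^sup>2"] by simp
  then have "((\<lambda>x. flat_exp 1 (1 - x\<^sup>2)) has_real_derivative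
      flat_exp [:0,0,1:] (1 - x\<^sup>2) * (- (2 * x))) (at x)"
    by (rule DERIV_chain2) (auto intro!: derivative_eq_intros)
  then show ?thesis unfolding bump_def[abs_def] bump_weight_def by (simp add: mult_ac)
qed

lemma bump_nonneg: "0 \<le> bump x" and bump_weight_nonneg: "0 \<le> bump_weight x"
  by (auto simp: bump_def bump_weight_def flat_exp_def)

lemma bump_pos: "\<bar>x\<bar> < 1 \<Longrightarrow> 0 < bump x" and bump_weight_pos: "\<bar>x\<bar> < 1 \<Longrightarrow> 0 < bump_weight x"
  using abs_square_less_1[of x] by (auto simp: bump_def bump_weight_def flat_exp_def)

lemma bump_zero: "1 \<le> \<bar>x\<bar> \<Longrightarrow> bump x = 0" and bump_weight_zero: "1 \<le> \<bar>x\<bar> \<Longrightarrow> bump_weight x = 0"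
  using abs_square_less_1[of x] by (auto simp: bump_def bump_weight_def flat_exp_def)

section \<open>Sobolev functions and product test functions\<close>

definition bump_on :: "real \<Rightarrow> real \<Rightarrow> (real \<Rightarrow> real) \<Rightarrow> bool" where
  "bump_on a b A \<longleftrightarrow> smooth_real A \<and> (\<forall>x. x \<notin> {a..b} \<longrightarrow> A x = 0)"

lemma bump_on_deriv:
  assumes "bump_on a b A" and d: "\<And>x. (A has_real_derivative A' x) (at x)"
  shows "bump_on a b A'"
  unfolding bump_on_def
proof (intro conjI allI impI)
  have "deriv A = A'" using d by (auto intro: DERIV_imp_deriv)
  then show "smooth_real A'" using assms(1) smooth_deriv unfolding bump_on_def by metis
  fix x assume x: "x \<notin> {a..b}"
  have "((\<lambda>x. 0) has_real_derivative A' x) (at x)"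
    by (rule has_field_derivative_transform_within_open[OF d, where S = "- {a..b}"])
       (use x assms(1) in \<open>auto simp: bump_on_def\<close>)
  then show "A' x = 0" using DERIV_unique DERIV_const by blast
qed

lemma bump_on_mult: "bump_on a b A \<Longrightarrow> smooth_real f \<Longrightarrow> bump_on a b (\<lambda>x. f x * A x)"
  by (auto simp: bump_on_def intro: smooth_intros)

lemma bump_on_zero: "bump_on a b A \<Longrightarrow> x \<notin> {a..b} \<Longrightarrow> A x = 0"
  by (simp add: bump_on_def)

lemma bump_on_continuous: "bump_on a b A \<Longrightarrow> continuous_on S A"
  by (simp add: bump_on_def smooth_continuous_on)

lemma continuous_on_prod_bump:
  assumes "bump_on a b A" "bump_on c d B"
  shows "continuous_on S (\<lambda>z. A (fst z) * B (snd z))"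
  by (intro continuous_intros continuous_on_compose2[OF bump_on_continuous[OF assms(1), of UNIV]]
        continuous_on_compose2[OF bump_on_continuous[OF assms(2), of UNIV]]) auto

lemma test_function_product:
  assumes "bump_on a b A" "bump_on c d B" "cbox (a, c) (b, d) \<subseteq> U"
  shows "test_function U (\<lambda>z. A (fst z) * B (snd z))"
  unfolding test_function_def
proof (intro conjI exI[of _ "cbox (a, c) (b, d)"])
  show "smooth_plane (\<lambda>z. A (fst z) * B (snd z))"
    using smooth_plane_product[of A B] assms by (simp add: bump_on_def case_prod_unfold)
  show "\<forall>z. z \<notin> cbox (a, c) (b, d) \<longrightarrow> A (fst z) * B (snd z) = 0"
    using assms(1,2) unfolding bump_on_def by (auto simp: cbox_Pair_eq)
qed (use assms in auto)

lemma partial_x_product: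
  assumes "\<And>x. (A has_real_derivative A' x) (at x)"
  shows "partial_x (\<lambda>z. A (fst z) * B (snd z)) = (\<lambda>z. A' (fst z) * B (snd z))"
  unfolding partial_x_def
  by (auto simp: fun_eq_iff intro!: DERIV_imp_deriv derivative_eq_intros assms)

lemma partial_t_product:
  assumes "\<And>t. (B has_real_derivative B' t) (at t)"
  shows "partial_t (\<lambda>z. A (fst z) * B (snd z)) = (\<lambda>z. A (fst z) * B' (snd z))"
  unfolding partial_t_def
  by (auto simp: fun_eq_iff intro!: DERIV_imp_deriv derivative_eq_intros assms)

lemma lebesgue_on_extend:
  fixes g :: "'a::euclidean_space \<Rightarrow> real"
  assumes "C \<subseteq> U" "C \<in> sets lebesgue" "U \<in> sets lebesgue" "\<And>z. z \<notin> C \<Longrightarrow> g z = 0"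
  shows "integrable (lebesgue_on C) g \<longleftrightarrow> integrable (lebesgue_on U) g"
    and "(LINT z|lebesgue_on C. g z) = (LINT z|lebesgue_on U. g z)"
proof -
  have "(\<lambda>x. indicator C x *\<^sub>R g x) = (\<lambda>x. indicator U x *\<^sub>R g x)"
    using assms by (auto simp: fun_eq_iff indicator_def)
  then show "integrable (lebesgue_on C) g \<longleftrightarrow> integrable (lebesgue_on U) g"
    and "(LINT z|lebesgue_on C. g z) = (LINT z|lebesgue_on U. g z)"
    using assms by (simp_all add: integrable_restrict_space integral_restrict_space)
qed

text \<open>On a compact set |f| \<le> 1 + |f|^p is an integrable bound, and \<open>g\<close> is
  bounded there.\<close>

lemma Lp_loc_integrable_mult:
  assumes "open U" "Lp_loc p U f" "p > 1" "compact C" "C \<subseteq> U" "continuous_on C g"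
  shows "integrable (lebesgue_on C) (\<lambda>z. f z * g z)"
proof -
  have C: "C \<in> sets lebesgue" using assms(4) by (simp add: fmeasurableD lmeasurable_compact)
  have fin: "finite_measure (lebesgue_on C)"
    using assms(4) by (intro finite_measure_lebesgue_on) (simp add: lmeasurable_compact)
  obtain M where M: "\<And>z. z \<in> C \<Longrightarrow> \<bar>g z\<bar> \<le> M"
    using compact_continuous_image[OF assms(6,4)] bounded_imp_bdd_above compact_imp_bounded
    by (metis assms(4,6) bounded_iff image_eqI real_norm_def)
  have ip: "integrable (lebesgue_on C) (\<lambda>z. \<bar>f z\<bar> powr p)"
    using assms unfolding Lp_loc_def by blast
  have fm: "f \<in> borel_measurable (lebesgue_on C)"
    using assms unfolding Lp_loc_def by (auto intro: measurable_restrict_mono)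
  have gm: "g \<in> borel_measurable (lebesgue_on C)"
    using assms(6) C by (simp add: continuous_imp_measurable_on_sets_lebesgue)
  have one: "integrable (lebesgue_on C) (\<lambda>z. 1::real)"
    using fin by (simp add: finite_measure.integrable_const)
  have "integrable (lebesgue_on C) (\<lambda>z. M * (1 + \<bar>f z\<bar> powr p))"
    using one ip by simp
  then show ?thesis
  proof (rule Bochner_Integration.integrable_bound)
    show "(\<lambda>z. f z * g z) \<in> borel_measurable (lebesgue_on C)" using fm gm by measurable
    show "AE z in lebesgue_on C. norm (f z * g z) \<le> norm (M * (1 + \<bar>f z\<bar> powr p))"
    proof (rule AE_I2)
      fix z assume "z \<in> space (lebesgue_on C)"
      then have z: "z \<in> C" by simp
      have "\<bar>f z\<bar> \<le> 1 + \<bar>f z\<bar> powr p"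
      proof (cases "\<bar>f z\<bar> \<le> 1")
        case False
        then have "\<bar>f z\<bar> powr 1 \<le> \<bar>f z\<bar> powr p" using assms(3) by (intro powr_mono) auto
        then show ?thesis using False by simp
      qed (simp add: add_increasing2)
      then have "\<bar>g z\<bar> * \<bar>f z\<bar> \<le> M * (1 + \<bar>f z\<bar> powr p)"
        using M[OF z] by (intro mult_mono) auto
      moreover have "0 \<le> M" using M[OF z] by simp
      ultimately show "norm (f z * g z) \<le> norm (M * (1 + \<bar>f z\<bar> powr p))"
        by (simp add: abs_mult mult.commute)
    qed
  qed
qed

section \<open>Weak derivatives and the adjoint operator on a box\<close>

locale sobolev_function =
  fixes U :: "(real \<times> real) set" and V Vx Vxx Vt :: "real \<times> real \<Rightarrow> real"
  assumes open_U: "open U" and W21: "W21_loc U V Vx Vxx Vt" and cont: "continuous_on U V"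
begin

lemma Lp: "p > 1 \<Longrightarrow> Lp_loc p U V \<and> Lp_loc p U Vx \<and> Lp_loc p U Vxx \<and> Lp_loc p U Vt"
  using W21 by (simp add: W21_loc_def)

text \<open>Integrals of \<open>V\<close> itself are turned into gauge integrals over a closed box,
  where differentiation under the integral sign applies; integrals of the weak derivatives, which
  are merely locally p-integrable, stay Lebesgue integrals throughout.\<close>

lemma integral_V:
  assumes "cbox (a, c) (b, d) \<subseteq> U" "bump_on a b A" "bump_on c d B"
  shows "(LINT z|lebesgue_on U. V z * (A (fst z) * B (snd z))) =
         integral (cbox (a, c) (b, d)) (\<lambda>z. V z * (A (fst z) * B (snd z)))"
proof -
  let ?Q = "cbox (a, c) (b, d)" and ?g = "\<lambda>z. V z * (A (fst z) * B (snd z))"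
  have "continuous_on ?Q ?g"
    using assms(1) by (intro continuous_intros continuous_on_subset[OF cont]
        continuous_on_prod_bump[OF assms(2,3)])
  then have i: "integrable (lebesgue_on ?Q) ?g"
    by (simp add: continuous_imp_integrable)
  have "?g z = 0" if "z \<notin> ?Q" for z
    using that bump_on_zero[OF assms(2)] bump_on_zero[OF assms(3)]
    by (cases z) (force simp: cbox_Pair_eq)
  then have "(LINT z|lebesgue_on U. ?g z) = (LINT z|lebesgue_on ?Q. ?g z)"
    using assms(1) open_U by (intro lebesgue_on_extend(2)[symmetric]) auto
  also have "\<dots> = integral ?Q ?g"
    using i by (intro lebesgue_integral_eq_integral) auto
  finally show ?thesis .
qed

lemma integral_box:
  assumes "cbox (a, c) (b, d) \<subseteq> U" "bump_on a b A" "bump_on c d B"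
  shows "(LINT z|lebesgue_on U. f z * (A (fst z) * B (snd z))) =
         (LINT z|lebesgue_on (cbox (a, c) (b, d)). f z * (A (fst z) * B (snd z)))"
proof -
  have "f z * (A (fst z) * B (snd z)) = 0" if "z \<notin> cbox (a, c) (b, d)" for z
    using that bump_on_zero[OF assms(2)] bump_on_zero[OF assms(3)]
    by (cases z) (force simp: cbox_Pair_eq)
  then show ?thesis
    using assms(1) open_U by (intro lebesgue_on_extend(2)[symmetric]) auto
qed

lemma
  assumes Q: "cbox (a, c) (b, d) \<subseteq> U" and A: "bump_on a b A" and B: "bump_on c d B"
  shows weak_t: "(\<And>t. (B has_real_derivative B' t) (at t)) \<Longrightarrow>
      integral (cbox (a, c) (b, d)) (\<lambda>z. V z * (A (fst z) * B' (snd z))) =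
      - (LINT z|lebesgue_on (cbox (a, c) (b, d)). Vt z * (A (fst z) * B (snd z)))"
    and weak_x: "(\<And>x. (A has_real_derivative A' x) (at x)) \<Longrightarrow>
      integral (cbox (a, c) (b, d)) (\<lambda>z. V z * (A' (fst z) * B (snd z))) =
      - (LINT z|lebesgue_on (cbox (a, c) (b, d)). Vx z * (A (fst z) * B (snd z)))"
    and weak_xx: "(\<And>x. (A has_real_derivative A' x) (at x)) \<Longrightarrow>
      (\<And>x. (A' has_real_derivative A'' x) (at x)) \<Longrightarrow>
      integral (cbox (a, c) (b, d)) (\<lambda>z. V z * (A'' (fst z) * B (snd z))) =
      (LINT z|lebesgue_on (cbox (a, c) (b, d)). Vxx z * (A (fst z) * B (snd z)))"
proof -
  note T = test_function_product[OF A B Q]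
  have weak: "weak_partial_x U V Vx" "weak_partial_t U V Vt" "weak_partial_x U Vx Vxx"
    using W21 by (auto simp: W21_loc_def)
  show "integral (cbox (a, c) (b, d)) (\<lambda>z. V z * (A (fst z) * B' (snd z))) =
      - (LINT z|lebesgue_on (cbox (a, c) (b, d)). Vt z * (A (fst z) * B (snd z)))"
    if d: "\<And>t. (B has_real_derivative B' t) (at t)"
  proof -
    have "(LINT z|lebesgue_on U. V z * (A (fst z) * B' (snd z))) =
      - (LINT z|lebesgue_on U. Vt z * (A (fst z) * B (snd z)))"
      using weak(2)[unfolded weak_partial_t_def, rule_format, OF T]
      by (simp add: partial_t_product[OF d])
    then show ?thesis
      by (simp add: integral_V[OF Q A bump_on_deriv[OF B d]] integral_box[OF Q A B])
  qed
  show x: "integral (cbox (a, c) (b, d)) (\<lambda>z. V z * (A' (fst z) * B (snd z))) =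
      - (LINT z|lebesgue_on (cbox (a, c) (b, d)). Vx z * (A (fst z) * B (snd z)))"
    if d: "\<And>x. (A has_real_derivative A' x) (at x)"
  proof -
    have "(LINT z|lebesgue_on U. V z * (A' (fst z) * B (snd z))) =
      - (LINT z|lebesgue_on U. Vx z * (A (fst z) * B (snd z)))"
      using weak(1)[unfolded weak_partial_x_def, rule_format, OF T]
      by (simp add: partial_x_product[OF d])
    then show ?thesis
      by (simp add: integral_V[OF Q bump_on_deriv[OF A d] B] integral_box[OF Q A B])
  qed
  show "integral (cbox (a, c) (b, d)) (\<lambda>z. V z * (A'' (fst z) * B (snd z))) =
      (LINT z|lebesgue_on (cbox (a, c) (b, d)). Vxx z * (A (fst z) * B (snd z)))"
    if d: "\<And>x. (A has_real_derivative A' x) (at x)"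
      and d2: "\<And>x. (A' has_real_derivative A'' x) (at x)"
  proof -
    have A': "bump_on a b A'" using bump_on_deriv[OF A d] .
    have "(LINT z|lebesgue_on U. V z * (A'' (fst z) * B (snd z))) =
      - (LINT z|lebesgue_on U. Vx z * (A' (fst z) * B (snd z)))"
      using weak(1)[unfolded weak_partial_x_def, rule_format, OF test_function_product[OF A' B Q]]
      by (simp add: partial_x_product[OF d2])
    also have "\<dots> = (LINT z|lebesgue_on U. Vxx z * (A (fst z) * B (snd z)))"
      using weak(3)[unfolded weak_partial_x_def, rule_format, OF T]
      by (simp add: partial_x_product[OF d])
    finally show ?thesis
      by (simp add: integral_V[OF Q bump_on_deriv[OF A' d2] B] integral_box[OF Q A B])
  qed
qed

lemma integrable_box:
  assumes "cbox (a, c) (b, d) \<subseteq> U" "bump_on a b A" "bump_on c d B" "f \<in> {V, Vx, Vxx, Vt}"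
  shows "integrable (lebesgue_on (cbox (a, c) (b, d))) (\<lambda>z. f z * (A (fst z) * B (snd z)))"
  by (rule Lp_loc_integrable_mult[OF open_U, of 2])
     (use assms Lp[of 2] continuous_on_prod_bump[OF assms(2,3)] in auto)

text \<open>The formal adjoint of the operator, applied to a product A(x)B(t). The variable
  coefficients are moved onto A, so that x V_x pairs with \<open>P\<close> = (xA)' and x^2 V_xx with
  \<open>R\<close> = (x^2 A)''; this is the form that the mollification kernel matches.\<close>

lemma weak_bond_operator:
  assumes Q: "cbox (a, c) (b, d) \<subseteq> U" and A: "bump_on a b A" and B: "bump_on c d B"
    and dB: "\<And>t. (B has_real_derivative B' t) (at t)"
    and dP: "\<And>x. ((\<lambda>x. x * A x) has_real_derivative P x) (at x)"
    and dR: "\<And>x. ((\<lambda>x. x\<^sup>2 * A x) has_real_derivative R1 x) (at x)"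
       "\<And>x. (R1 has_real_derivative R x) (at x)"
  shows "integral (cbox (a, c) (b, d)) (\<lambda>z. V z * (A (fst z) * B' (snd z)
            - 1/2 * \<sigma>\<^sup>2 * (R (fst z) * B (snd z)) + (r - q) * (P (fst z) * B (snd z))
            + r * (A (fst z) * B (snd z)))) =
         (LINT z|lebesgue_on (cbox (a, c) (b, d)).
            bond_operator \<sigma> r q V Vx Vxx Vt z * (A (fst z) * B (snd z)))"
    and "integrable (lebesgue_on (cbox (a, c) (b, d)))
            (\<lambda>z. bond_operator \<sigma> r q V Vx Vxx Vt z * (A (fst z) * B (snd z)))"
proof -
  let ?Q = "cbox (a, c) (b, d)"
  let ?I = "\<lambda>f A B. (LINT z|lebesgue_on ?Q. f z * (A (fst z) * B (snd z)))"
  let ?J = "\<lambda>A B. integral ?Q (\<lambda>z. V z * (A (fst z) * B (snd z)))"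
  have xA: "bump_on a b (\<lambda>x. x * A x)" by (intro bump_on_mult A smooth_intros)
  have xxA: "bump_on a b (\<lambda>x. x\<^sup>2 * A x)" by (intro bump_on_mult A smooth_intros)
  note B' = bump_on_deriv[OF B dB]
  note P = bump_on_deriv[OF xA dP]
  note R = bump_on_deriv[OF bump_on_deriv[OF xxA dR(1)] dR(2)]
  have J: "((\<lambda>z. V z * (A (fst z) * B (snd z))) has_integral ?J A B) ?Q"
    if "bump_on a b A" "bump_on c d B" for A B
    using Q that by (intro integrable_integral integrable_continuous continuous_intros
        continuous_on_subset[OF cont] continuous_on_prod_bump)
  have "integral ?Q (\<lambda>z. V z * (A (fst z) * B' (snd z)
            - 1/2 * \<sigma>\<^sup>2 * (R (fst z) * B (snd z)) + (r - q) * (P (fst z) * B (snd z))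
            + r * (A (fst z) * B (snd z)))) =
     integral ?Q (\<lambda>z. V z * (A (fst z) * B' (snd z))
            - 1/2 * \<sigma>\<^sup>2 * (V z * (R (fst z) * B (snd z)))
            + (r - q) * (V z * (P (fst z) * B (snd z)))
            + r * (V z * (A (fst z) * B (snd z))))"
    by (simp add: algebra_simps)
  also have "\<dots> = ?J A B' - 1/2 * \<sigma>\<^sup>2 * ?J R B + (r - q) * ?J P B + r * ?J A B"
    by (rule integral_unique[OF has_integral_add[OF has_integral_add[OF has_integral_diff[OF
          J[OF A B'] has_integral_mult_right[OF J[OF R B]]]
          has_integral_mult_right[OF J[OF P B]]] has_integral_mult_right[OF J[OF A B]]]])
  also have "?J A B' = - ?I Vt A B" by (rule weak_t[OF Q A B dB])
  also have "?J R B = ?I Vxx (\<lambda>x. x\<^sup>2 * A x) B" by (rule weak_xx[OF Q xxA B dR])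
  also have "?J P B = - ?I Vx (\<lambda>x. x * A x) B" by (rule weak_x[OF Q xA B dP])
  also have "?J A B = ?I V A B"
    using integral_V[OF Q A B] integral_box[OF Q A B] by simp
  finally have eq: "integral ?Q (\<lambda>z. V z * (A (fst z) * B' (snd z)
            - 1/2 * \<sigma>\<^sup>2 * (R (fst z) * B (snd z)) + (r - q) * (P (fst z) * B (snd z))
            + r * (A (fst z) * B (snd z)))) =
     - ?I Vt A B - 1/2 * \<sigma>\<^sup>2 * ?I Vxx (\<lambda>x. x\<^sup>2 * A x) B - (r - q) * ?I Vx (\<lambda>x. x * A x) B
       + r * ?I V A B" by simp
  note int = integrable_box[OF Q A B, of Vt] integrable_box[OF Q A B, of V]
    integrable_box[OF Q xA B, of Vx] integrable_box[OF Q xxA B, of Vxx]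
  have L: "bond_operator \<sigma> r q V Vx Vxx Vt z * (A (fst z) * B (snd z)) =
      - (Vt z * (A (fst z) * B (snd z))) - 1/2 * \<sigma>\<^sup>2 * (Vxx z * ((fst z)\<^sup>2 * A (fst z) * B (snd z)))
      - (r - q) * (Vx z * (fst z * A (fst z) * B (snd z))) + r * (V z * (A (fst z) * B (snd z)))" for z
    by (simp add: bond_operator_def case_prod_beta algebra_simps)
  show "integrable (lebesgue_on ?Q)
            (\<lambda>z. bond_operator \<sigma> r q V Vx Vxx Vt z * (A (fst z) * B (snd z)))"
    unfolding L using int by simp
  have "(LINT z|lebesgue_on ?Q. bond_operator \<sigma> r q V Vx Vxx Vt z * (A (fst z) * B (snd z))) =
     - ?I Vt A B - 1/2 * \<sigma>\<^sup>2 * ?I Vxx (\<lambda>x. x\<^sup>2 * A x) B - (r - q) * ?I Vx (\<lambda>x. x * A x) B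
       + r * ?I V A B"
    unfolding L using int by simp
  with eq show "integral ?Q (\<lambda>z. V z * (A (fst z) * B' (snd z)
            - 1/2 * \<sigma>\<^sup>2 * (R (fst z) * B (snd z)) + (r - q) * (P (fst z) * B (snd z))
            + r * (A (fst z) * B (snd z)))) =
         (LINT z|lebesgue_on ?Q.
            bond_operator \<sigma> r q V Vx Vxx Vt z * (A (fst z) * B (snd z)))" by simp
qed

end

section \<open>Multiplicative mollification\<close>

lemma continuous_on_smooth_compose:
  "smooth_real f \<Longrightarrow> continuous_on S g \<Longrightarrow> continuous_on S (\<lambda>x. f (g x))"
  by (rule continuous_on_compose2[OF smooth_continuous_on[of f UNIV]]) auto

lemmas continuous_on_bump [continuous_intros] =
  continuous_on_smooth_compose[OF smooth_bump]
  continuous_on_smooth_compose[OF smooth_bump_weight]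
  continuous_on_smooth_compose[OF smooth_deriv[OF smooth_bump]]
  continuous_on_smooth_compose[OF smooth_deriv[OF smooth_deriv[OF smooth_bump]]]
  continuous_on_smooth_compose[OF smooth_deriv[OF smooth_bump_weight]]

lemmas bump_DERIV_chain = DERIV_chain2[OF smooth_DERIV[OF smooth_bump]]
  DERIV_chain2[OF smooth_DERIV[OF smooth_deriv[OF smooth_bump]]]

section \<open>Mass of the bump and parameter integrals\<close>

definition bump_mass :: real where "bump_mass = integral {-1..1} bump"

lemma bump_mass_pos: "0 < bump_mass"
proof -
  have c: "continuous_on S bump" for S by (rule smooth_continuous_on[OF smooth_bump])
  have i: "bump integrable_on {-1..1}" by (rule integrable_continuous_interval[OF c])
  have "0 \<le> bump_mass" unfolding bump_mass_def by (rule integral_nonneg[OF i]) (simp add: bump_nonneg)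
  moreover have "bump_mass \<noteq> 0"
  proof
    assume "bump_mass = 0"
    then have "(bump has_integral 0) (cbox (-1) 1)"
      using i unfolding bump_mass_def by (simp add: has_integral_iff)
    then have "bump 0 = 0"
      by (rule has_integral_0_cbox_imp_0[OF c, rotated]) (auto simp: bump_nonneg)
    then show False using bump_pos[of 0] by simp
  qed
  ultimately show ?thesis by simp
qed

lemma integral_affine:
  assumes "smooth_real f" "\<And>x. 1 \<le> \<bar>x\<bar> \<Longrightarrow> f x = 0" "h > 0" "a \<le> p - h" "p + h \<le> b"
  shows "integral {a..b} (\<lambda>z. f ((z - p) / h)) = h * integral {-1..1} f"
proof -
  have "(f has_integral integral {-1..1} f) (cbox (-1) 1)"
    using assms(1)
    by (simp add: integrable_continuous_interval integrable_integral smooth_continuous_on)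
  moreover have "(- 1 - (- p/h)) /\<^sub>R (1/h) = p - h" "(1 - (- p/h)) /\<^sub>R (1/h) = p + h"
    "(1/h) *\<^sub>R z + - p/h = (z - p) / h" "i /\<^sub>R (1/h) ^ DIM(real) = h * i" for z i
    using assms(3) by (auto simp: field_simps)
  ultimately have "((\<lambda>z. f ((z - p) / h)) has_integral (h * integral {-1..1} f)) {p - h..p + h}"
    using has_integral_affinity'[of f "integral {-1..1} f" "- 1" 1 "1/h" "- p/h"] assms(3) by simp
  then have "((\<lambda>z. f ((z - p) / h)) has_integral (h * integral {-1..1} f)) {a..b}"
  proof (rule has_integral_on_superset)
    fix z assume "z \<notin> {p - h..p + h}"
    then show "f ((z - p) / h) = 0"
      using assms by (intro assms(2)) (auto simp: field_simps abs_if split: if_splits)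
  qed (use assms in auto)
  then show ?thesis by (rule integral_unique)
qed

lemma integral_bump_affine:
  assumes "h > 0" "a \<le> p - h" "p + h \<le> b"
  shows "integral {a..b} (\<lambda>z. bump ((z - p) / h)) = h * bump_mass"
  unfolding bump_mass_def by (rule integral_affine[OF smooth_bump bump_zero assms])

text \<open>The parameter occurs in the kernel only, so \<open>V\<close> has merely to be
  continuous.\<close>

lemma parametric_integral_DERIV:
  fixes h :: "real \<Rightarrow> real \<times> real \<Rightarrow> real"
  assumes "open S" "convex S" "continuous_on (cbox l u) V"
    and "\<And>x z. x \<in> S \<Longrightarrow> z \<in> cbox l u \<Longrightarrow> ((\<lambda>x. h x z) has_real_derivative hx x z) (at x)"
    and "\<And>x. x \<in> S \<Longrightarrow> continuous_on (cbox l u) (h x)"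
    and hx: "continuous_on (S \<times> cbox l u) (\<lambda>p. hx (fst p) (snd p))"
    and "x \<in> S"
  shows "((\<lambda>x. integral (cbox l u) (\<lambda>z. V z * h x z)) has_real_derivative
           integral (cbox l u) (\<lambda>z. V z * hx x z)) (at x)"
proof -
  have "((\<lambda>x. integral (cbox l u) (\<lambda>z. V z * h x z)) has_real_derivative
           integral (cbox l u) (\<lambda>z. V z * hx x z)) (at x within S)"
  proof (rule leibniz_rule_field_derivative[where f = "\<lambda>x z. V z * h x z" and fx = "\<lambda>x z. V z * hx x z"])
    show "((\<lambda>x. V z * h x z) has_real_derivative V z * hx x z) (at x within S)"
      if "x \<in> S" "z \<in> cbox l u" for x z
      by (intro DERIV_cmult has_field_derivative_at_within[OF assms(4)[OF that]])
    show "(\<lambda>z. V z * h x z) integrable_on cbox l u" if "x \<in> S" for x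
      using assms(3,5) that by (intro integrable_continuous continuous_intros) auto
    show "continuous_on (S \<times> cbox l u) (\<lambda>(x, z). V z * hx x z)"
      unfolding case_prod_unfold
      by (intro continuous_intros hx continuous_on_compose2[OF assms(3)]) auto
  qed (use assms in auto)
  then show ?thesis using at_within_open[OF assms(7,1)] by simp
qed

section \<open>Supersolutions as limits of classical ones\<close>

text \<open>The derivatives are two-sided even at boundary points of \<open>R\<close>, and no
  continuity is asked of them: comparison only uses their existence around a minimum of a
  difference.\<close>

definition C21_on :: "(real \<times> real) set \<Rightarrow> (real \<times> real \<Rightarrow> real) \<Rightarrow> (real \<times> real \<Rightarrow> real) \<Rightarrow>
    (real \<times> real \<Rightarrow> real) \<Rightarrow> (real \<times> real \<Rightarrow> real) \<Rightarrow> bool" where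
  "C21_on R v vx vxx vt \<longleftrightarrow> continuous_on R v \<and> (\<forall>x t. (x, t) \<in> R \<longrightarrow>
     ((\<lambda>y. v (y, t)) has_real_derivative vx (x, t)) (at x) \<and>
     ((\<lambda>y. vx (y, t)) has_real_derivative vxx (x, t)) (at x) \<and>
     ((\<lambda>s. v (x, s)) has_real_derivative vt (x, t)) (at t))"

text \<open>This way of saying \<open>\<L>W \<ge> g\<close> is immediately stable under sums, shifts and dilations.\<close>

definition supersolution :: "real \<Rightarrow> real \<Rightarrow> real \<Rightarrow> (real \<times> real) set \<Rightarrow> real \<Rightarrow>
    (real \<times> real \<Rightarrow> real) \<Rightarrow> bool" where
  "supersolution \<sigma> r q R g W \<longleftrightarrow> (\<forall>\<eta>>0. \<exists>v vx vxx vt. C21_on R v vx vxx vt \<and>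
     (\<forall>z\<in>R. \<bar>v z - W z\<bar> \<le> \<eta> \<and> g \<le> bond_operator \<sigma> r q v vx vxx vt z))"

text \<open>Averaging with the kernel \<open>m(z/x)/x\<close> in space commutes with \<open>x\<partial>\<^sub>x\<close>, hence with \<open>\<L>\<close>.\<close>

context
  fixes e :: real
  assumes e: "e > 0"
begin

text \<open>For x > 0 this is the bump of (z/x - 1)/e, divided by x. It is homogeneous of degree -1
  in x and z together, and its half-width xe scales with the point.\<close>

definition ker :: "real \<Rightarrow> real \<Rightarrow> real" where
  "ker x z = bump ((z - x) / (x * e)) / x"

definition ker_x :: "real \<Rightarrow> real \<Rightarrow> real" where
  "ker_x x z = - bump ((z - x) / (x * e)) / x^2 - z * deriv bump ((z - x) / (x * e)) / (e * x^3)"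

definition ker_xx :: "real \<Rightarrow> real \<Rightarrow> real" where
  "ker_xx x z = 2 * bump ((z - x) / (x * e)) / x^3
     + 4 * z * deriv bump ((z - x) / (x * e)) / (e * x^4)
     + z^2 * deriv (deriv bump) ((z - x) / (x * e)) / (e^2 * x^5)"

lemma arg_DERIV:
  assumes "x > 0"
  shows "((\<lambda>x. (z - x) / (x * e)) has_real_derivative - z / (e * x^2)) (at x)"
    and "((\<lambda>z. (z - x) / (x * e)) has_real_derivative 1 / (x * e)) (at z)"
  using e assms
  by (auto intro!: derivative_eq_intros simp: field_simps power2_eq_square)

lemma ker_DERIV_x:
  assumes "x > 0"
  shows "((\<lambda>x. ker x z) has_real_derivative ker_x x z) (at x)"
proof -
  have *: "((\<lambda>x. f x / x) has_real_derivative f' / x - f x / x^2) (at x)"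
    if "(f has_real_derivative f') (at x)" for f f'
    using that assms by (auto intro!: derivative_eq_intros simp: field_simps power2_eq_square)
  show ?thesis
    unfolding ker_def ker_x_def
    by (rule DERIV_cong[OF *[OF bump_DERIV_chain(1)[OF arg_DERIV(1)[OF assms, of z]]]])
       (use e assms in \<open>simp add: field_simps power_def numeral_eq_Suc\<close>)
qed

lemma ker_DERIV_xx:
  assumes "x > 0"
  shows "((\<lambda>x. ker_x x z) has_real_derivative ker_xx x z) (at x)"
proof -
  have *: "((\<lambda>x. - f x / x^2 - z * g x / (e * x^3)) has_real_derivative
      - f' / x^2 + 2 * f x / x^3 - z * g' / (e * x^3) + 3 * z * g x / (e * x^4)) (at x)"
    if "(f has_real_derivative f') (at x)" "(g has_real_derivative g') (at x)" for f f' g g'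
    using that assms e
    by (auto intro!: derivative_eq_intros simp: field_simps power_def numeral_eq_Suc)
  show ?thesis
    unfolding ker_xx_def ker_x_def
    by (rule DERIV_cong[OF *[OF bump_DERIV_chain(1)[OF arg_DERIV(1)[OF assms, of z]]
            bump_DERIV_chain(2)[OF arg_DERIV(1)[OF assms, of z]]]])
       (use e assms in \<open>simp add: field_simps power_def numeral_eq_Suc\<close>)
qed

text \<open>Euler's identity x k_x + z k_z = -k for a kernel homogeneous of degree -1. It exchanges
  the x-derivative of an average for the adjoint of z d/dz in the integration variable.\<close>

lemma ker_DERIV_z1:
  assumes "x > 0"
  shows "((\<lambda>z. z * ker x z) has_real_derivative - x * ker_x x z) (at z)"
proof -
  have *: "((\<lambda>z. z * (f z / x)) has_real_derivative f z / x + z * f' / x) (at z)"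
    if "(f has_real_derivative f') (at z)" for f f'
    using that assms by (auto intro!: derivative_eq_intros simp: field_simps)
  show ?thesis
    unfolding ker_def ker_x_def
    by (rule DERIV_cong[OF *[OF bump_DERIV_chain(1)[OF arg_DERIV(2)[OF assms, of z]]]])
       (use e assms in \<open>simp add: field_simps power_def numeral_eq_Suc\<close>)
qed

text \<open>The second-order Euler identity (z^2 k)_zz = x^2 k_xx; the first claim supplies the
  intermediate derivative required as \<open>R1\<close> in
  \<open>weak_bond_operator\<close>.\<close>

lemma ker_DERIV_z2:
  assumes "x > 0"
  shows "((\<lambda>z. z\<^sup>2 * ker x z) has_real_derivative
      2 * z * bump ((z - x) / (x * e)) / x + z\<^sup>2 * deriv bump ((z - x) / (x * e)) / (e * x\<^sup>2)) (at z)"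
    and "((\<lambda>z. 2 * z * bump ((z - x) / (x * e)) / x + z\<^sup>2 * deriv bump ((z - x) / (x * e)) / (e * x\<^sup>2))
      has_real_derivative x\<^sup>2 * ker_xx x z) (at z)"
proof -
  have *: "((\<lambda>z. z\<^sup>2 * (f z / x)) has_real_derivative 2 * z * f z / x + z\<^sup>2 * f' / x) (at z)"
    if "(f has_real_derivative f') (at z)" for f f'
    using that assms by (auto intro!: derivative_eq_intros simp: field_simps)
  show "((\<lambda>z. z\<^sup>2 * ker x z) has_real_derivative
      2 * z * bump ((z - x) / (x * e)) / x + z\<^sup>2 * deriv bump ((z - x) / (x * e)) / (e * x\<^sup>2)) (at z)"
    unfolding ker_def
    by (rule DERIV_cong[OF *[OF bump_DERIV_chain(1)[OF arg_DERIV(2)[OF assms, of z]]]])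
       (use e assms in \<open>simp add: field_simps power_def numeral_eq_Suc\<close>)
  have *: "((\<lambda>z. 2 * z * f z / x + z\<^sup>2 * g z / (e * x\<^sup>2)) has_real_derivative
      2 * f z / x + 2 * z * f' / x + 2 * z * g z / (e * x\<^sup>2) + z\<^sup>2 * g' / (e * x\<^sup>2)) (at z)"
    if "(f has_real_derivative f') (at z)" "(g has_real_derivative g') (at z)" for f f' g g'
    using that assms e by (auto intro!: derivative_eq_intros simp: field_simps)
  show "((\<lambda>z. 2 * z * bump ((z - x) / (x * e)) / x + z\<^sup>2 * deriv bump ((z - x) / (x * e)) / (e * x\<^sup>2))
      has_real_derivative x\<^sup>2 * ker_xx x z) (at z)"
    unfolding ker_xx_def
    by (rule DERIV_cong[OF *[OF bump_DERIV_chain(1)[OF arg_DERIV(2)[OF assms, of z]]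
            bump_DERIV_chain(2)[OF arg_DERIV(2)[OF assms, of z]]]])
       (use e assms in \<open>simp add: field_simps power_def numeral_eq_Suc\<close>)
qed

lemma ker_bump_on:
  assumes "x > 0" "a \<le> x - x * e" "x + x * e \<le> b"
  shows "bump_on a b (ker x)"
  unfolding bump_on_def
proof (intro conjI allI impI)
  show "smooth_real (ker x)"
    unfolding ker_def[abs_def] by (intro smooth_intros smooth_compose[OF smooth_bump])
  fix z assume "z \<notin> {a..b}"
  then have "z < x - x * e \<or> z > x + x * e" using assms by auto
  then have "1 \<le> \<bar>(z - x) / (x * e)\<bar>" using e assms by (auto simp: field_simps abs_if)
  then show "ker x z = 0" by (simp add: ker_def bump_zero)
qed

lemma ker_continuous:
  assumes "continuous_on S f" "continuous_on S g" "\<And>p. p \<in> S \<Longrightarrow> f p > 0"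
  shows "continuous_on S (\<lambda>p. ker (f p) (g p))" "continuous_on S (\<lambda>p. ker_x (f p) (g p))"
    "continuous_on S (\<lambda>p. ker_xx (f p) (g p))"
proof -
  have "\<forall>p\<in>S. f p \<noteq> 0" using assms(3) by force
  then have n: "\<forall>p\<in>S. f p * e \<noteq> 0" "\<forall>p\<in>S. f p \<noteq> 0" "\<forall>p\<in>S. e * f p ^ k \<noteq> 0"
     "\<forall>p\<in>S. e^2 * f p ^ k \<noteq> 0" "\<forall>p\<in>S. f p ^ k \<noteq> 0" for k
    using e by auto
  show "continuous_on S (\<lambda>p. ker (f p) (g p))" "continuous_on S (\<lambda>p. ker_x (f p) (g p))"
    "continuous_on S (\<lambda>p. ker_xx (f p) (g p))"
    unfolding ker_def ker_x_def ker_xx_def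
    by (intro continuous_intros assms(1,2) n)+
qed

end

lemma time_bump_DERIV:
  assumes "e > 0"
  shows "((\<lambda>s. bump ((s - t) / e)) has_real_derivative deriv bump ((s - t) / e) / e) (at s)"
    and "((\<lambda>t. bump ((s - t) / e)) has_real_derivative - deriv bump ((s - t) / e) / e) (at t)"
proof -
  have "((\<lambda>s. (s - t) / e) has_real_derivative 1 / e) (at s)"
    "((\<lambda>t. (s - t) / e) has_real_derivative - 1 / e) (at t)"
    using assms by (auto intro!: derivative_eq_intros)
  from bump_DERIV_chain(1)[OF this(1)] bump_DERIV_chain(1)[OF this(2)]
  show "((\<lambda>s. bump ((s - t) / e)) has_real_derivative deriv bump ((s - t) / e) / e) (at s)"
    and "((\<lambda>t. bump ((s - t) / e)) has_real_derivative - deriv bump ((s - t) / e) / e) (at t)"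
    by simp_all
qed

lemma time_bump_on:
  assumes "e > 0" "c \<le> t - e" "t + e \<le> d"
  shows "bump_on c d (\<lambda>s. bump ((s - t) / e))"
  unfolding bump_on_def
proof (intro conjI allI impI)
  show "smooth_real (\<lambda>s. bump ((s - t) / e))"
    by (intro smooth_compose[OF smooth_bump] smooth_intros)
  fix s assume "s \<notin> {c..d}"
  then have "s < t - e \<or> s > t + e" using assms by auto
  then have "1 \<le> \<bar>(s - t) / e\<bar>" using assms by (auto simp: field_simps abs_if)
  then show "bump ((s - t) / e) = 0" by (simp add: bump_zero)
qed

section \<open>Mollification of an almost everywhere supersolution\<close>

context sobolev_function
begin

text \<open>The operator applied to the average is the average of the weak operator: the kernel
  satisfies Euler's identities in space and is a translate in time. Averaging an almost everywhere
  inequality with a nonnegative kernel of mass 1 keeps the lower bound \<open>g\<close>. The larger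
  box leaves room for the support of the kernel.\<close>

lemma supersolution_mollify:
  assumes Q: "cbox (a', c') (b', d') \<subseteq> U" and a: "0 < a'" "a' < a" "b < b'" "c' < c" "d < d'"
    and AE: "AE z in lebesgue. z \<in> cbox (a', c') (b', d') \<longrightarrow> g \<le> bond_operator \<sigma> r q V Vx Vxx Vt z"
  shows "supersolution \<sigma> r q (cbox (a, c) (b, d)) g V"
  unfolding supersolution_def
proof (intro allI impI)
  fix \<eta> :: real assume "\<eta> > 0"
  define Q where "Q = cbox (a', c') (b', d')"
  have QU: "Q \<subseteq> U" using Q Q_def by simp
  have cQ: "continuous_on Q V" using QU continuous_on_subset[OF cont] by blast
  then have "uniformly_continuous_on Q V"
    by (intro compact_uniformly_continuous) (auto simp: Q_def)
  then obtain \<delta> where \<delta>: "\<delta> > 0" "\<And>z z'. z \<in> Q \<Longrightarrow> z' \<in> Q \<Longrightarrow> dist z' z < \<delta> \<Longrightarrow> \<bar>V z' - V z\<bar> < \<eta>"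
    unfolding uniformly_continuous_on_def dist_real_def using \<open>\<eta> > 0\<close> by metis
  \<comment> \<open>The smallest of the margins between the two boxes and of the radius of uniform
    continuity. Dividing it by 4(|b'| + 1) makes both half-widths, e in time and xe in space, at
    most m/4 for every x \<le> b'.\<close>
  define m where "m = min (min (a - a') (b' - b)) (min (min (c - c') (d' - d)) \<delta>)"
  have m: "m > 0" "m \<le> a - a'" "m \<le> b' - b" "m \<le> c - c'" "m \<le> d' - d" "m \<le> \<delta>"
    unfolding m_def using a \<delta> by auto
  define e where "e = m / (4 * (\<bar>b'\<bar> + 1))"
  have e: "e > 0" unfolding e_def using m by simp
  have "e * (\<bar>b'\<bar> + 1) = m / 4" unfolding e_def by (simp add: field_simps)
  moreover have "e * (\<bar>b'\<bar> + 1) = e * \<bar>b'\<bar> + e" by (simp add: algebra_simps)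
  moreover have "0 \<le> e * \<bar>b'\<bar>" using e by simp
  ultimately have e1: "e \<le> m / 4" and e2: "e * \<bar>b'\<bar> \<le> m / 4" using e by linarith+
  have e3: "x * e \<le> m / 4" if "x \<le> b'" for x
  proof -
    have "x * e \<le> \<bar>b'\<bar> * e" using that e by (intro mult_right_mono) auto
    with e2 show ?thesis by (simp add: mult.commute)
  qed
  \<comment> \<open>Each factor of the kernel has mass e times \<open>bump_mass\<close>, since the
    division by x in \<open>ker\<close> cancels the x in its width. The normalisation is therefore
    independent of the point and need not be differentiated.\<close>
  define n where "n = (e * bump_mass)\<^sup>2"
  have n: "n > 0" unfolding n_def using e bump_mass_pos by simp
  define J where "J f = integral Q (\<lambda>z. V z * f z)" for f
  define v where "v = (\<lambda>(x, t). J (\<lambda>z. ker e x (fst z) * bump ((snd z - t) / e)) / n)"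
  define vx where "vx = (\<lambda>(x, t). J (\<lambda>z. ker_x e x (fst z) * bump ((snd z - t) / e)) / n)"
  define vxx where "vxx = (\<lambda>(x, t). J (\<lambda>z. ker_xx e x (fst z) * bump ((snd z - t) / e)) / n)"
  define vt where "vt = (\<lambda>(x, t). J (\<lambda>z. ker e x (fst z) * (- deriv bump ((snd z - t) / e) / e)) / n)"
  have cker: "continuous_on S (\<lambda>z. ker e x (f z))" "continuous_on S (\<lambda>z. ker_x e x (f z))"
    "continuous_on S (\<lambda>z. ker_xx e x (f z))" if "x > 0" "continuous_on S f"
    for x and f :: "real \<times> real \<Rightarrow> real" and S
    using ker_continuous[OF e continuous_on_const that(2)] that(1) by auto
  have e': "e \<noteq> 0" using e by simp
  have Qc: "(\<lambda>z. V z * f z) integrable_on Q" if "continuous_on Q f" for f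
    using cQ that unfolding Q_def by (intro integrable_continuous continuous_intros)
  show "\<exists>v vx vxx vt. C21_on (cbox (a, c) (b, d)) v vx vxx vt \<and>
          (\<forall>z\<in>cbox (a, c) (b, d). \<bar>v z - V z\<bar> \<le> \<eta> \<and> g \<le> bond_operator \<sigma> r q v vx vxx vt z)"
  proof (intro exI conjI ballI)
    show "C21_on (cbox (a, c) (b, d)) v vx vxx vt"
      unfolding C21_on_def
    proof (intro allI impI conjI)
      have "cbox (a, c) (b, d) \<subseteq> {0<..} \<times> UNIV"
        using a by (auto simp: cbox_Pair_eq)
      then have "continuous_on (cbox (a, c) (b, d) \<times> Q)
          (\<lambda>(p, z). V z * (ker e (fst p) (fst z) * bump ((snd z - snd p) / e)))"
        unfolding case_prod_unfold using e'
        by (intro continuous_intros ker_continuous(1) e continuous_on_compose2[OF cQ]) auto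
      then have "continuous_on (cbox (a, c) (b, d))
          (\<lambda>p. integral Q (\<lambda>z. V z * (ker e (fst p) (fst z) * bump ((snd z - snd p) / e))))"
        unfolding Q_def by (rule integral_continuous_on_param)
      then show "continuous_on (cbox (a, c) (b, d)) v"
        unfolding v_def J_def case_prod_unfold using n by (intro continuous_intros) auto
      fix x t assume xt: "(x, t) \<in> cbox (a, c) (b, d)"
      then have x: "x > 0" using a by (auto simp: cbox_Pair_eq)
      have *: "((\<lambda>x. J (\<lambda>z. h x (fst z) * bump ((snd z - t) / e)) / n) has_real_derivative
          J (\<lambda>z. hx x (fst z) * bump ((snd z - t) / e)) / n) (at x)"
        if d: "\<And>x z. x > 0 \<Longrightarrow> ((\<lambda>x. h x z) has_real_derivative hx x z) (at x)"
          and h: "\<And>x. x > 0 \<Longrightarrow> continuous_on Q (\<lambda>z. h x (fst z))"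
          and hx: "continuous_on ({0<..} \<times> Q) (\<lambda>p. hx (fst p) (fst (snd p)))" for h hx
        unfolding J_def Q_def
      proof (rule DERIV_cdivide, rule parametric_integral_DERIV[where S = "{0<..}"])
        show "((\<lambda>x. h x (fst z) * bump ((snd z - t) / e)) has_real_derivative
            hx x (fst z) * bump ((snd z - t) / e)) (at x)" if "x \<in> {0<..}" for x z
          using d that by (intro DERIV_cmult_right) auto
        show "continuous_on (cbox (a', c') (b', d')) (\<lambda>z. h x (fst z) * bump ((snd z - t) / e))"
          if "x \<in> {0<..}" for x
          using h that e' by (intro continuous_intros) (auto simp: Q_def)
        show "continuous_on ({0<..} \<times> cbox (a', c') (b', d'))
             (\<lambda>p. hx (fst p) (fst (snd p)) * bump ((snd (snd p) - t) / e))"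
          using hx e' unfolding Q_def by (intro continuous_intros) auto
      qed (use x cQ in \<open>auto simp: Q_def\<close>)
      show "((\<lambda>y. v (y, t)) has_real_derivative vx (x, t)) (at x)"
        unfolding v_def vx_def prod.case
        by (rule *[where h = "ker e" and hx = "ker_x e"])
           (auto intro!: ker_DERIV_x e cker ker_continuous(2) continuous_intros)
      show "((\<lambda>y. vx (y, t)) has_real_derivative vxx (x, t)) (at x)"
        unfolding vxx_def vx_def prod.case
        by (rule *[where h = "ker_x e" and hx = "ker_xx e"])
           (auto intro!: ker_DERIV_xx e cker ker_continuous(3) continuous_intros)
      show "((\<lambda>s. v (x, s)) has_real_derivative vt (x, t)) (at t)"
        unfolding v_def vt_def prod.case J_def Q_def
      proof (rule DERIV_cdivide, rule parametric_integral_DERIV[where S = UNIV])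
        show "((\<lambda>t. ker e x (fst z) * bump ((snd z - t) / e)) has_real_derivative
           ker e x (fst z) * (- deriv bump ((snd z - t) / e) / e)) (at t)" for z t
          using time_bump_DERIV(2)[OF e] by (intro DERIV_cmult)
        show "continuous_on (cbox (a', c') (b', d')) (\<lambda>z. ker e x (fst z) * bump ((snd z - t) / e))" for t
          using x e' by (intro continuous_intros cker) auto
        show "continuous_on (UNIV \<times> cbox (a', c') (b', d'))
           (\<lambda>p. ker e x (fst (snd p)) * (- deriv bump ((snd (snd p) - fst p) / e) / e))"
          using x e' by (intro continuous_intros ker_continuous(1) e) auto
      qed (use cQ in \<open>auto simp: Q_def\<close>)
    qed
    fix z assume z: "z \<in> cbox (a, c) (b, d)"
    obtain x t where zxt: "z = (x, t)" by (cases z)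
    then have xt: "a \<le> x" "x \<le> b" "c \<le> t" "t \<le> d" using z by (auto simp: cbox_Pair_eq)
    have x: "x > 0" using xt a by simp
    have xe: "a' \<le> x - x * e" "x + x * e \<le> b'" "c' \<le> t - e" "t + e \<le> d'"
      using e1 e3[of x] xt m a by linarith+
    note A = ker_bump_on[OF e x xe(1,2)] and B = time_bump_on[OF e xe(3,4)]
    let ?A = "ker e x" and ?B = "\<lambda>s. bump ((s - t) / e)"
    have AB0: "0 \<le> ?A z * ?B s" for z s using x by (simp add: ker_def[OF e] bump_nonneg)
    have cAB: "continuous_on S (\<lambda>z. ?A (fst z) * ?B (snd z))" for S
      by (rule continuous_on_prod_bump[OF A B])
    have mass: "integral Q (\<lambda>z. ?A (fst z) * ?B (snd z)) = n"
    proof -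
      have "integral {a'..b'} ?A = e * bump_mass"
      proof -
        have "integral {a'..b'} ?A = integral {a'..b'} (\<lambda>z. bump ((z - x) / (x * e))) / x"
          unfolding ker_def[OF e] using e by simp
        then show ?thesis using integral_bump_affine[of "x * e" a' x b'] x e xe by simp
      qed
      moreover have "integral {c'..d'} ?B = e * bump_mass"
        using integral_bump_affine[of e c' t d'] e xe by simp
      ultimately show ?thesis
        unfolding Q_def n_def by (simp add: integral_prod_continuous[OF cAB] power2_eq_square)
    qed
    have iAB: "(\<lambda>z. ?A (fst z) * ?B (snd z)) integrable_on Q"
      unfolding Q_def by (rule integrable_continuous[OF cAB])
    have close: "\<bar>V z' - V z\<bar> * (?A (fst z') * ?B (snd z')) \<le> \<eta> * (?A (fst z') * ?B (snd z'))"
      if "z' \<in> Q" for z'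
    proof (cases "?A (fst z') * ?B (snd z') = 0")
      case False
      then have "\<bar>(fst z' - x) / (x * e)\<bar> < 1" "\<bar>(snd z' - t) / e\<bar> < 1"
        using bump_zero by (force simp: ker_def[OF e])+
      then have "\<bar>fst z' - x\<bar> < x * e" "\<bar>snd z' - t\<bar> < e"
        using x e by (auto simp: abs_divide field_simps abs_mult)
      moreover have "dist z' z \<le> \<bar>fst z' - x\<bar> + \<bar>snd z' - t\<bar>"
        unfolding zxt by (cases z') (simp add: dist_prod_def dist_real_def sqrt_sum_squares_le_sum_abs)
      ultimately have "dist z' z < \<delta>" using e1 e3[of x] m xt a \<delta>(1) by linarith
      moreover have "z \<in> Q" using xt a by (auto simp: Q_def zxt cbox_Pair_eq)
      ultimately have "\<bar>V z' - V z\<bar> < \<eta>" using \<delta>(2) that by blast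
      then show ?thesis using AB0 by (intro mult_right_mono) auto
    next
      case True
      then show ?thesis by (simp only: mult_zero_right order_refl)
    qed
    have "\<bar>J (\<lambda>z. ?A (fst z) * ?B (snd z)) - V z * n\<bar> \<le> \<eta> * n"
    proof -
      have cp: "continuous_on Q (\<lambda>z'. (V z' - V z) * (?A (fst z') * ?B (snd z')))"
        by (intro continuous_intros cQ cAB)
      have "J (\<lambda>z. ?A (fst z) * ?B (snd z)) - V z * n =
          integral Q (\<lambda>z'. V z' * (?A (fst z') * ?B (snd z')) - V z * (?A (fst z') * ?B (snd z')))"
        unfolding J_def mass[symmetric]
        by (subst integral_diff[OF Qc[OF cAB] integrable_on_mult_right[OF iAB]])
           (simp only: integral_mult_right)
      also have "\<dots> = integral Q (\<lambda>z'. (V z' - V z) * (?A (fst z') * ?B (snd z')))"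
        by (simp add: algebra_simps)
      also have "norm \<dots> \<le> integral Q (\<lambda>z'. \<eta> * (?A (fst z') * ?B (snd z')))"
      proof (rule integral_norm_bound_integral)
        show "(\<lambda>z'. (V z' - V z) * (?A (fst z') * ?B (snd z'))) integrable_on Q"
          using cp unfolding Q_def by (rule integrable_continuous)
        show "(\<lambda>z'. \<eta> * (?A (fst z') * ?B (snd z'))) integrable_on Q"
          using iAB by (rule integrable_on_mult_right)
        show "norm ((V z' - V z) * (?A (fst z') * ?B (snd z'))) \<le> \<eta> * (?A (fst z') * ?B (snd z'))"
          if "z' \<in> Q" for z'
          using close[OF that] AB0[of "fst z'" "snd z'"] 
          by (simp only: real_norm_def abs_mult[of "V z' - V z"] abs_of_nonneg)
      qed
      also have "\<dots> = \<eta> * n" by (simp only: integral_mult_right mass)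
      finally show ?thesis by simp
    qed
    moreover have "v z - V z = (J (\<lambda>z. ?A (fst z) * ?B (snd z)) - V z * n) / n"
      unfolding v_def zxt using n by (simp add: field_simps)
    ultimately show "\<bar>v z - V z\<bar> \<le> \<eta>" using n by (simp add: abs_divide pos_divide_le_eq)
    let ?L = "bond_operator \<sigma> r q V Vx Vxx Vt"
    let ?P = "\<lambda>z. - x * ker_x e x z" and ?R = "\<lambda>z. x\<^sup>2 * ker_xx e x z"
      and ?B' = "\<lambda>s. deriv bump ((s - t) / e) / e"
    \<comment> \<open>The test function is the kernel with (x, t) frozen. Its adjoint derivatives in
      the integration variables are -x k_x, x^2 k_xx and minus the t-derivative; together they give
      exactly the operator acting on the kernel in (x, t).\<close>
    note wb = weak_bond_operator[OF Q A B time_bump_DERIV(1)[OF e] ker_DERIV_z1[OF e x]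
        ker_DERIV_z2[OF e x], where \<sigma> = \<sigma> and r = r and q = q]
    have Jh: "((\<lambda>z. V z * (f (fst z) * k (snd z))) has_integral J (\<lambda>z. f (fst z) * k (snd z))) Q"
      if "continuous_on UNIV f" "continuous_on UNIV k" for f k :: "real \<Rightarrow> real"
      unfolding J_def
      by (intro integrable_integral Qc continuous_intros continuous_on_compose2[OF that(1)]
          continuous_on_compose2[OF that(2)]) auto
    have ck: "continuous_on UNIV (ker e x)" "continuous_on UNIV (ker_x e x)" "continuous_on UNIV (ker_xx e x)"
      using ker_continuous[OF e continuous_on_const continuous_on_id, of UNIV x] x by auto
    have cb: "continuous_on UNIV ?B" "continuous_on UNIV ?B'"
      "continuous_on UNIV (\<lambda>s. - deriv bump ((s - t) / e) / e)"
      using e' by (auto intro!: continuous_intros)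
    have "g * n = g * integral Q (\<lambda>z. ?A (fst z) * ?B (snd z))" using mass by simp
    also have "\<dots> = (LINT z|lebesgue_on Q. g * (?A (fst z) * ?B (snd z)))"
      using lebesgue_integral_eq_integral[of Q "\<lambda>z. ?A (fst z) * ?B (snd z)"] cAB
      by (simp add: Q_def continuous_imp_integrable)
    also have "\<dots> \<le> (LINT z|lebesgue_on Q. ?L z * (?A (fst z) * ?B (snd z)))"
    proof (rule integral_mono_AE)
      show "integrable (lebesgue_on Q) (\<lambda>z. g * (?A (fst z) * ?B (snd z)))"
        unfolding Q_def by (intro integrable_mult_right continuous_imp_integrable cAB)
      show "integrable (lebesgue_on Q) (\<lambda>z. ?L z * (?A (fst z) * ?B (snd z)))"
        unfolding Q_def by (rule wb(2))
      have "AE z in lebesgue_on Q. g \<le> ?L z"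
        using AE by (simp add: AE_restrict_space_iff Q_def)
      then show "AE z in lebesgue_on Q. g * (?A (fst z) * ?B (snd z)) \<le> ?L z * (?A (fst z) * ?B (snd z))"
        by eventually_elim (use AB0 in \<open>auto intro: mult_right_mono\<close>)
    qed
    also have "\<dots> = integral Q (\<lambda>z. V z * (?A (fst z) * ?B' (snd z)
            - 1/2 * \<sigma>\<^sup>2 * (?R (fst z) * ?B (snd z)) + (r - q) * (?P (fst z) * ?B (snd z))
            + r * (?A (fst z) * ?B (snd z))))"
      unfolding Q_def by (rule wb(1)[symmetric])
    also have "\<dots> = integral Q (\<lambda>z. - (V z * (?A (fst z) * (- deriv bump ((snd z - t) / e) / e)))
            - 1/2 * \<sigma>\<^sup>2 * x\<^sup>2 * (V z * (ker_xx e x (fst z) * ?B (snd z)))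
            - (r - q) * x * (V z * (ker_x e x (fst z) * ?B (snd z)))
            + r * (V z * (?A (fst z) * ?B (snd z))))"
      by (simp add: algebra_simps)
    also have "\<dots> = - J (\<lambda>z. ?A (fst z) * (- deriv bump ((snd z - t) / e) / e))
            - 1/2 * \<sigma>\<^sup>2 * x\<^sup>2 * J (\<lambda>z. ker_xx e x (fst z) * ?B (snd z))
            - (r - q) * x * J (\<lambda>z. ker_x e x (fst z) * ?B (snd z))
            + r * J (\<lambda>z. ?A (fst z) * ?B (snd z))"
      by (rule integral_unique[OF has_integral_add[OF has_integral_diff[OF has_integral_diff[OF
            has_integral_neg[OF Jh[OF ck(1) cb(3)]] has_integral_mult_right[OF Jh[OF ck(3) cb(1)]]]
            has_integral_mult_right[OF Jh[OF ck(2) cb(1)]]]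
            has_integral_mult_right[OF Jh[OF ck(1) cb(1)]]]])
    also have "\<dots> = bond_operator \<sigma> r q v vx vxx vt z * n"
      unfolding bond_operator_def v_def vx_def vxx_def vt_def zxt prod.case
      using n by (simp add: field_simps)
    finally show "g \<le> bond_operator \<sigma> r q v vx vxx vt z" using n by simp
  qed
qed

end

section \<open>Comparison with classical barriers\<close>

lemma C21_onD:
  assumes "C21_on R v vx vxx vt" "(x, t) \<in> R"
  shows "((\<lambda>y. v (y, t)) has_real_derivative vx (x, t)) (at x)"
    "((\<lambda>y. vx (y, t)) has_real_derivative vxx (x, t)) (at x)"
    "((\<lambda>s. v (x, s)) has_real_derivative vt (x, t)) (at t)"
  using assms unfolding C21_on_def by auto

lemma supersolution_subset:
  "supersolution \<sigma> r q R g W \<Longrightarrow> R' \<subseteq> R \<Longrightarrow> supersolution \<sigma> r q R' g W"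
  unfolding supersolution_def C21_on_def
  by (meson continuous_on_subset subsetD)

lemma supersolution_add:
  assumes "supersolution \<sigma> r q R g1 W1" "supersolution \<sigma> r q R g2 W2"
  shows "supersolution \<sigma> r q R (g1 + g2) (\<lambda>z. W1 z + W2 z)"
  unfolding supersolution_def
proof (intro allI impI)
  fix \<eta> :: real assume "\<eta> > 0"
  then have "\<eta> / 2 > 0" by simp
  obtain v vx vxx vt where v: "C21_on R v vx vxx vt"
    "\<And>z. z \<in> R \<Longrightarrow> \<bar>v z - W1 z\<bar> \<le> \<eta> / 2 \<and> g1 \<le> bond_operator \<sigma> r q v vx vxx vt z"
    using assms(1) \<open>\<eta> / 2 > 0\<close> unfolding supersolution_def by blast
  obtain w wx wxx wt where w: "C21_on R w wx wxx wt"
    "\<And>z. z \<in> R \<Longrightarrow> \<bar>w z - W2 z\<bar> \<le> \<eta> / 2 \<and> g2 \<le> bond_operator \<sigma> r q w wx wxx wt z"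
    using assms(2) \<open>\<eta> / 2 > 0\<close> unfolding supersolution_def by blast
  show "\<exists>v vx vxx vt. C21_on R v vx vxx vt \<and>
    (\<forall>z\<in>R. \<bar>v z - (W1 z + W2 z)\<bar> \<le> \<eta> \<and> g1 + g2 \<le> bond_operator \<sigma> r q v vx vxx vt z)"
  proof (intro exI conjI ballI)
    show "C21_on R (\<lambda>z. v z + w z) (\<lambda>z. vx z + wx z) (\<lambda>z. vxx z + wxx z) (\<lambda>z. vt z + wt z)"
      using v(1) w(1) unfolding C21_on_def by (auto intro!: continuous_intros DERIV_add)
    fix z assume z: "z \<in> R"
    show "\<bar>v z + w z - (W1 z + W2 z)\<bar> \<le> \<eta>" using v(2)[OF z] w(2)[OF z] unfolding abs_le_iff by linarith
    have "bond_operator \<sigma> r q (\<lambda>z. v z + w z) (\<lambda>z. vx z + wx z) (\<lambda>z. vxx z + wxx z) (\<lambda>z. vt z + wt z) z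
      = bond_operator \<sigma> r q v vx vxx vt z + bond_operator \<sigma> r q w wx wxx wt z"
      by (cases z) (simp add: bond_operator_def algebra_simps)
    then show "g1 + g2 \<le> bond_operator \<sigma> r q (\<lambda>z. v z + w z) (\<lambda>z. vx z + wx z) (\<lambda>z. vxx z + wxx z) (\<lambda>z. vt z + wt z) z"
      using v(2)[OF z] w(2)[OF z] by linarith
  qed
qed

lemma supersolution_scale:
  assumes "supersolution \<sigma> r q R g W" "k > 0"
  shows "supersolution \<sigma> r q R (k * g) (\<lambda>z. k * W z)"
  unfolding supersolution_def
proof (intro allI impI)
  fix \<eta> :: real assume "\<eta> > 0"
  then have "\<eta> / k > 0" using assms by simp
  obtain v vx vxx vt where v: "C21_on R v vx vxx vt"
    "\<And>z. z \<in> R \<Longrightarrow> \<bar>v z - W z\<bar> \<le> \<eta> / k \<and> g \<le> bond_operator \<sigma> r q v vx vxx vt z"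
    using assms(1) \<open>\<eta> / k > 0\<close> unfolding supersolution_def by blast
  show "\<exists>v vx vxx vt. C21_on R v vx vxx vt \<and>
    (\<forall>z\<in>R. \<bar>v z - k * W z\<bar> \<le> \<eta> \<and> k * g \<le> bond_operator \<sigma> r q v vx vxx vt z)"
  proof (intro exI conjI ballI)
    show "C21_on R (\<lambda>z. k * v z) (\<lambda>z. k * vx z) (\<lambda>z. k * vxx z) (\<lambda>z. k * vt z)"
      using v(1) unfolding C21_on_def by (auto intro!: continuous_intros DERIV_cmult)
    fix z assume z: "z \<in> R"
    have "\<bar>k * v z - k * W z\<bar> = k * \<bar>v z - W z\<bar>"
      using assms(2) by (simp add: abs_mult flip: right_diff_distrib)
    also have "\<dots> \<le> k * (\<eta> / k)" using v(2)[OF z] assms(2) by (intro mult_left_mono) auto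
    finally show "\<bar>k * v z - k * W z\<bar> \<le> \<eta>" using assms(2) by simp
    have "bond_operator \<sigma> r q (\<lambda>z. k * v z) (\<lambda>z. k * vx z) (\<lambda>z. k * vxx z) (\<lambda>z. k * vt z) z
      = k * bond_operator \<sigma> r q v vx vxx vt z"
      by (cases z) (simp add: bond_operator_def algebra_simps)
    then show "k * g \<le> bond_operator \<sigma> r q (\<lambda>z. k * v z) (\<lambda>z. k * vx z) (\<lambda>z. k * vxx z) (\<lambda>z. k * vt z) z"
      using v(2)[OF z] assms(2) by simp
  qed
qed

text \<open>The coefficients do not depend on t, and x d/dx and its second-order analogue are
  invariant under dilations, so a shifted and dilated approximant keeps the same lower
  bound.\<close>

lemma supersolution_translate:
  assumes "supersolution \<sigma> r q R g W"
    and "\<And>x t. (x, t) \<in> R' \<Longrightarrow> (l * x, t - h) \<in> R"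
  shows "supersolution \<sigma> r q R' g (\<lambda>z. W (l * fst z, snd z - h))"
  unfolding supersolution_def
proof (intro allI impI)
  fix \<eta> :: real assume "\<eta> > 0"
  then obtain v vx vxx vt where v: "C21_on R v vx vxx vt"
    "\<And>z. z \<in> R \<Longrightarrow> \<bar>v z - W z\<bar> \<le> \<eta> \<and> g \<le> bond_operator \<sigma> r q v vx vxx vt z"
    using assms(1) unfolding supersolution_def by blast
  let ?T = "\<lambda>z. (l * fst z, snd z - h)"
  have T: "?T z \<in> R" if "z \<in> R'" for z
    by (rule assms(2)[of "fst z" "snd z", unfolded prod.collapse, OF that])
  show "\<exists>v vx vxx vt. C21_on R' v vx vxx vt \<and>
    (\<forall>z\<in>R'. \<bar>v z - W (?T z)\<bar> \<le> \<eta> \<and> g \<le> bond_operator \<sigma> r q v vx vxx vt z)"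
  proof (rule exI[of _ "\<lambda>z. v (?T z)"], rule exI[of _ "\<lambda>z. l * vx (?T z)"],
      rule exI[of _ "\<lambda>z. l^2 * vxx (?T z)"], rule exI[of _ "\<lambda>z. vt (?T z)"], intro conjI ballI)
    show "C21_on R' (\<lambda>z. v (?T z)) (\<lambda>z. l * vx (?T z)) (\<lambda>z. l^2 * vxx (?T z)) (\<lambda>z. vt (?T z))"
      unfolding C21_on_def
    proof (intro conjI allI impI)
      show "continuous_on R' (\<lambda>z. v (?T z))"
        using v(1) T unfolding C21_on_def
        by (auto intro!: continuous_on_compose2[of R v R' ?T] continuous_intros)
      fix x t assume "(x, t) \<in> R'"
      note d = C21_onD[OF v(1) assms(2)[OF this]]
      have a: "((\<lambda>y. l * y) has_real_derivative l) (at x)" "((\<lambda>s. s - h) has_real_derivative 1) (at t)"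
        by (auto intro!: derivative_eq_intros)
      show "((\<lambda>y. v (?T (y, t))) has_real_derivative l * vx (?T (x, t))) (at x)"
        using DERIV_chain2[OF d(1) a(1)] by (simp add: mult.commute)
      show "((\<lambda>y. l * vx (?T (y, t))) has_real_derivative l^2 * vxx (?T (x, t))) (at x)"
        using DERIV_cmult[OF DERIV_chain2[OF d(2) a(1)], of l] by (simp add: power2_eq_square mult_ac)
      show "((\<lambda>s. v (?T (x, s))) has_real_derivative vt (?T (x, t))) (at t)"
        using DERIV_chain2[OF d(3) a(2)] by simp
    qed
    fix z assume z: "z \<in> R'"
    show "\<bar>v (?T z) - W (?T z)\<bar> \<le> \<eta>" using v(2)[OF T[OF z]] by simp
    have "bond_operator \<sigma> r q (\<lambda>z. v (?T z)) (\<lambda>z. l * vx (?T z)) (\<lambda>z. l^2 * vxx (?T z)) (\<lambda>z. vt (?T z)) z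
      = bond_operator \<sigma> r q v vx vxx vt (?T z)"
      by (cases z) (simp add: bond_operator_def power_mult_distrib algebra_simps)
    then show "g \<le> bond_operator \<sigma> r q (\<lambda>z. v (?T z)) (\<lambda>z. l * vx (?T z)) (\<lambda>z. l^2 * vxx (?T z)) (\<lambda>z. vt (?T z)) z"
      using v(2)[OF T[OF z]] by simp
  qed
qed

section \<open>Touching from below\<close>

text \<open>A negative second derivative would make f' negative just to the right of x, and the mean
  value theorem would give a smaller value there.\<close>

lemma second_derivative_local_min:
  fixes f f' :: "real \<Rightarrow> real"
  assumes d: "\<And>y. \<bar>y - x\<bar> < d \<Longrightarrow> (f has_real_derivative f' y) (at y)"
    and d2: "(f' has_real_derivative l) (at x)" and "d > 0"
    and min: "\<And>y. \<bar>y - x\<bar> < d \<Longrightarrow> f x \<le> f y"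
  shows "f' x = 0" "l \<ge> 0"
proof -
  have "\<forall>y. \<bar>x - y\<bar> < d \<longrightarrow> f x \<le> f y" using min by (simp add: abs_minus_commute)
  with DERIV_local_min[OF d[of x] \<open>d > 0\<close>] \<open>d > 0\<close> show 0: "f' x = 0" by simp
  show "l \<ge> 0"
  proof (rule ccontr)
    assume "\<not> l \<ge> 0"
    then obtain e where e: "e > 0" "\<And>h. h > 0 \<Longrightarrow> h < e \<Longrightarrow> f' (x + h) < f' x"
      using DERIV_neg_dec_right[OF d2] by auto
    define h where "h = min e d / 2"
    have h: "h > 0" "h < e" "h < d" using e \<open>d > 0\<close> by (auto simp: h_def min_def)
    obtain y where y: "x < y" "y < x + h" "f (x + h) - f x = (x + h - x) * f' y"
      using MVT2[of x "x + h" f f'] d h by force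
    have "f' y < 0" using e(2)[of "y - x"] y h 0 by simp
    then have "f (x + h) < f x" using y(3) mult_pos_neg[OF h(1), of "f' y"] by simp
    with min[of "x + h"] h show False by simp
  qed
qed

text \<open>Only the values at later times, the past of the backward equation, enter the comparison.\<close>

lemma supersolution_touch:
  assumes S: "supersolution \<sigma> r q R g W" and R: "cbox (x0 - \<rho>, t0) (x0 + \<rho>, t0 + \<rho>) \<subseteq> R"
    and "\<rho> > 0" and "r \<ge> 0"
    and \<psi>: "C21_on (cbox (x0 - \<rho>, t0) (x0 + \<rho>, t0 + \<rho>)) \<psi> \<psi>x \<psi>xx \<psi>t"
    and cont: "continuous_on (cbox (x0 - \<rho>, t0) (x0 + \<rho>, t0 + \<rho>)) (bond_operator \<sigma> r q \<psi> \<psi>x \<psi>xx \<psi>t)"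
    and ge: "\<And>z. z \<in> cbox (x0 - \<rho>, t0) (x0 + \<rho>, t0 + \<rho>) \<Longrightarrow> \<psi> z \<le> W z"
    and eq: "W (x0, t0) = \<psi> (x0, t0)"
  shows "g \<le> bond_operator \<sigma> r q \<psi> \<psi>x \<psi>xx \<psi>t (x0, t0)"
proof (rule ccontr)
  let ?Q = "\<lambda>\<rho>. cbox (x0 - \<rho>, t0) (x0 + \<rho>, t0 + \<rho>)"
  let ?L = "bond_operator \<sigma> r q"
  define \<theta> where "\<theta> = g - ?L \<psi> \<psi>x \<psi>xx \<psi>t (x0, t0)"
  assume "\<not> g \<le> ?L \<psi> \<psi>x \<psi>xx \<psi>t (x0, t0)"
  then have \<theta>: "\<theta> > 0" by (simp add: \<theta>_def)
  have z0: "(x0, t0) \<in> ?Q \<rho>" using \<open>\<rho> > 0\<close> by (auto simp: cbox_Pair_eq)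
  obtain \<delta> where \<delta>: "\<delta> > 0"
    "\<And>z. z \<in> ?Q \<rho> \<Longrightarrow> dist z (x0, t0) < \<delta> \<Longrightarrow> \<bar>?L \<psi> \<psi>x \<psi>xx \<psi>t z - ?L \<psi> \<psi>x \<psi>xx \<psi>t (x0, t0)\<bar> < \<theta> / 4"
    using cont z0 \<theta> unfolding continuous_on_iff dist_real_def
    by (metis divide_pos_pos zero_less_numeral)
  define \<rho>' where "\<rho>' = min \<rho> (\<delta> / 3)"
  have \<rho>': "\<rho>' > 0" "\<rho>' \<le> \<rho>" "\<rho>' < \<delta> / 2" using \<delta> \<open>\<rho> > 0\<close> by (auto simp: \<rho>'_def)
  have sub: "?Q \<rho>' \<subseteq> ?Q \<rho>" using \<rho>' by (auto simp: cbox_Pair_eq)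
  have L\<psi>: "?L \<psi> \<psi>x \<psi>xx \<psi>t z \<le> g - 3/4 * \<theta>" if z: "z \<in> ?Q \<rho>'" for z
  proof -
    have "dist z (x0, t0) \<le> \<bar>fst z - x0\<bar> + \<bar>snd z - t0\<bar>"
      by (cases z) (simp add: dist_prod_def dist_real_def sqrt_sum_squares_le_sum_abs)
    also have "\<dots> < \<delta>" using z \<rho>' by (cases z) (auto simp: cbox_Pair_eq)
    finally have "dist z (x0, t0) < \<delta>" .
    moreover have "z \<in> ?Q \<rho>" using sub z by blast
    ultimately have "\<bar>?L \<psi> \<psi>x \<psi>xx \<psi>t z - ?L \<psi> \<psi>x \<psi>xx \<psi>t (x0, t0)\<bar> < \<theta> / 4" using \<delta>(2) by blast
    moreover have "u \<le> g - 3/4 * (g - w)" if "\<bar>u - w\<bar> < (g - w) / 4" for u w :: real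
      using that by (simp add: field_simps abs_if split: if_splits)
    ultimately show ?thesis unfolding \<theta>_def by blast
  qed
  \<comment> \<open>The operator applied to minus the quadratic (x - x0)^2 + (t - t0); it is bounded
    on the box.\<close>
  define N where "N = (\<lambda>(x, t). 1 + \<sigma>\<^sup>2 * x\<^sup>2 + 2 * (r - q) * x * (x - x0) - r * ((x - x0)\<^sup>2 + (t - t0)))"
  have "continuous_on (?Q \<rho>') N"
    unfolding N_def case_prod_unfold by (intro continuous_intros)
  then have "bounded (N ` ?Q \<rho>')" by (intro compact_imp_bounded compact_continuous_image) auto
  then obtain B where B: "B > 0" "\<And>z. z \<in> ?Q \<rho>' \<Longrightarrow> \<bar>N z\<bar> \<le> B"
    unfolding bounded_pos by auto
  define \<kappa> where "\<kappa> = \<theta> / (4 * B)"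
  have \<kappa>: "\<kappa> > 0" "\<kappa> * B = \<theta> / 4" using \<theta> B by (auto simp: \<kappa>_def)
  \<comment> \<open>Lowering \<psi> by a multiple of this quadratic makes the contact at (x0, t0)
    strict, while the operator rises by at most \<kappa>B = \<theta>/4.\<close>
  define \<xi> where "\<xi> = (\<lambda>(x, t). \<psi> (x, t) - \<kappa> * ((x - x0)\<^sup>2 + (t - t0)))"
  \<comment> \<open>On the lateral and upper faces the quadratic is at least \<mu>. With \<eta>
    \<le> \<kappa>\<mu>/4 a minimum of v - \<xi> avoids these faces; the other bound on \<eta> keeps
    the zero-order error r\<eta> below \<theta>/4.\<close>
  define \<mu> where "\<mu> = min (\<rho>'\<^sup>2) \<rho>'"
  have \<mu>: "\<mu> > 0" using \<rho>' by (simp add: \<mu>_def)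
  define \<eta> where "\<eta> = min (\<kappa> * \<mu> / 4) (\<theta> / (4 * (r + 1)))"
  have "\<theta> / (4 * (r + 1)) > 0" using \<theta> \<open>r \<ge> 0\<close> by simp
  then have \<eta>: "\<eta> > 0" "\<eta> \<le> \<kappa> * \<mu> / 4" "\<eta> \<le> \<theta> / (4 * (r + 1))"
    unfolding \<eta>_def using mult_pos_pos[OF \<kappa>(1) \<mu>] by linarith+
  have r\<eta>: "r * \<eta> \<le> \<theta> / 4"
  proof -
    have "r * \<eta> \<le> (r + 1) * (\<theta> / (4 * (r + 1)))" using \<eta> \<open>r \<ge> 0\<close> by (intro mult_mono) auto
    moreover have "(r + 1) * (\<theta> / (4 * (r + 1))) = \<theta> / 4"
      using \<open>r \<ge> 0\<close> by (simp add: divide_simps)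
    ultimately show ?thesis by linarith
  qed
  obtain v vx vxx vt where v: "C21_on R v vx vxx vt"
    "\<And>z. z \<in> R \<Longrightarrow> \<bar>v z - W z\<bar> \<le> \<eta> \<and> g \<le> ?L v vx vxx vt z"
    using S \<eta>(1) unfolding supersolution_def by blast
  have QR: "?Q \<rho>' \<subseteq> R" using sub R by blast
  have cv: "continuous_on (?Q \<rho>') (\<lambda>z. v z - \<xi> z)"
    using v(1) \<psi> QR sub unfolding C21_on_def \<xi>_def case_prod_unfold
    by (auto intro!: continuous_intros intro: continuous_on_subset)
  have z0': "(x0, t0) \<in> ?Q \<rho>'" using \<rho>' by (auto simp: cbox_Pair_eq)
  obtain z1 where z1: "z1 \<in> ?Q \<rho>'" "\<And>z. z \<in> ?Q \<rho>' \<Longrightarrow> v z1 - \<xi> z1 \<le> v z - \<xi> z"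
    using continuous_attains_inf[OF _ _ cv] z0' by (metis compact_cbox empty_iff)
  obtain x1 t1 where z1_eq: "z1 = (x1, t1)" by (cases z1)
  have "v z1 - \<xi> z1 \<le> v (x0, t0) - W (x0, t0)"
    using z1(2)[OF z0'] eq by (simp add: \<xi>_def)
  also have "\<dots> \<le> \<eta>" using v(2)[OF subsetD[OF QR z0']] by linarith
  finally have v\<xi>: "v z1 - \<xi> z1 \<le> \<eta>" .
  have lower: "- \<eta> + \<kappa> * ((x1 - x0)\<^sup>2 + (t1 - t0)) \<le> v z1 - \<xi> z1"
  proof -
    have "W z1 - \<eta> \<le> v z1" using v(2)[OF subsetD[OF QR z1(1)]] by linarith
    moreover have "\<psi> z1 \<le> W z1" using ge z1(1) sub by blast
    ultimately show ?thesis by (simp add: \<xi>_def z1_eq)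
  qed
  have box: "\<bar>x1 - x0\<bar> \<le> \<rho>'" "t0 \<le> t1" "t1 \<le> t0 + \<rho>'"
    using z1(1) by (auto simp: z1_eq cbox_Pair_eq)
  have "\<kappa> * ((x1 - x0)\<^sup>2 + (t1 - t0)) \<le> 2 * \<eta>" using lower v\<xi> by linarith
  also have "\<dots> < \<kappa> * \<mu>" using \<eta>(2) mult_pos_pos[OF \<kappa>(1) \<mu>] by linarith
  finally have small: "(x1 - x0)\<^sup>2 + (t1 - t0) < \<mu>" using \<kappa>(1) by simp
  have x1: "\<bar>x1 - x0\<bar> < \<rho>'"
  proof -
    have "(x1 - x0)\<^sup>2 < \<rho>'\<^sup>2" using small box unfolding \<mu>_def by linarith
    then show ?thesis using \<rho>'(1) by (metis abs_of_pos power2_less_imp_less power2_abs less_imp_le)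
  qed
  have t1: "t1 < t0 + \<rho>'" using small zero_le_power2[of "x1 - x0"] unfolding \<mu>_def by linarith
  define \<xi>x where "\<xi>x = (\<lambda>(x, t). \<psi>x (x, t) - \<kappa> * (2 * (x - x0)))"
  define \<xi>xx where "\<xi>xx = (\<lambda>(x, t). \<psi>xx (x, t) - \<kappa> * 2)"
  define \<xi>t where "\<xi>t = (\<lambda>(x, t). \<psi>t (x, t) - \<kappa>)"
  have C\<xi>: "((\<lambda>y. \<xi> (y, t)) has_real_derivative \<xi>x (x, t)) (at x)"
      "((\<lambda>y. \<xi>x (y, t)) has_real_derivative \<xi>xx (x, t)) (at x)"
      "((\<lambda>s. \<xi> (x, s)) has_real_derivative \<xi>t (x, t)) (at t)" if "(x, t) \<in> ?Q \<rho>'" for x t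
  proof -
    note d = C21_onD[OF \<psi> subsetD[OF sub that]]
    show "((\<lambda>y. \<xi> (y, t)) has_real_derivative \<xi>x (x, t)) (at x)"
      "((\<lambda>y. \<xi>x (y, t)) has_real_derivative \<xi>xx (x, t)) (at x)"
      "((\<lambda>s. \<xi> (x, s)) has_real_derivative \<xi>t (x, t)) (at t)"
      unfolding \<xi>_def \<xi>x_def \<xi>xx_def \<xi>t_def by (auto intro!: derivative_eq_intros d)
  qed
  note Cv = C21_onD[OF v(1)]
  define d where "d = \<rho>' - \<bar>x1 - x0\<bar>"
  have d: "d > 0" using x1 by (simp add: d_def)
  have inQ: "(y, t1) \<in> ?Q \<rho>'" if "\<bar>y - x1\<bar> < d" for y
    using that box by (auto simp: cbox_Pair_eq d_def)
  have "\<bar>y - x1\<bar> < d \<Longrightarrow> ((\<lambda>y. v (y, t1) - \<xi> (y, t1)) has_real_derivative (vx (y, t1) - \<xi>x (y, t1))) (at y)" for y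
    using inQ QR by (intro DERIV_diff Cv(1) C\<xi>(1)) auto
  moreover have "((\<lambda>y. vx (y, t1) - \<xi>x (y, t1)) has_real_derivative (vxx (x1, t1) - \<xi>xx (x1, t1))) (at x1)"
    using z1(1) QR z1_eq by (intro DERIV_diff Cv(2) C\<xi>(2)) auto
  ultimately have fx: "vx (x1, t1) - \<xi>x (x1, t1) = 0" and fxx: "vxx (x1, t1) - \<xi>xx (x1, t1) \<ge> 0"
    using second_derivative_local_min[of x1 d "\<lambda>y. v (y, t1) - \<xi> (y, t1)"
        "\<lambda>y. vx (y, t1) - \<xi>x (y, t1)" "vxx (x1, t1) - \<xi>xx (x1, t1)"] d z1(2)[OF inQ]
    unfolding z1_eq by auto
  \<comment> \<open>The minimum may sit on the bottom t1 = t0, where only later times are available.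
    That is enough, since the sign needed is that v - \<xi> does not decrease forward in
    time.\<close>
  have ft: "vt (x1, t1) - \<xi>t (x1, t1) \<ge> 0"
  proof (rule ccontr)
    have "((\<lambda>s. v (x1, s) - \<xi> (x1, s)) has_real_derivative (vt (x1, t1) - \<xi>t (x1, t1))) (at t1)"
      using z1(1) QR z1_eq by (intro DERIV_diff Cv(3) C\<xi>(3)) auto
    moreover assume "\<not> vt (x1, t1) - \<xi>t (x1, t1) \<ge> 0"
    then have "vt (x1, t1) - \<xi>t (x1, t1) < 0" by simp
    ultimately obtain e where e: "e > 0"
      "\<And>h. h > 0 \<Longrightarrow> h < e \<Longrightarrow> v (x1, t1 + h) - \<xi> (x1, t1 + h) < v (x1, t1) - \<xi> (x1, t1)"
      using DERIV_neg_dec_right[of "\<lambda>s. v (x1, s) - \<xi> (x1, s)"] by blast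
    define h where "h = min (e / 2) (t0 + \<rho>' - t1)"
    have h: "h > 0" "h < e" "h \<le> t0 + \<rho>' - t1" using e(1) t1 by (auto simp: h_def)
    have "(x1, t1 + h) \<in> ?Q \<rho>'" using h box by (auto simp: cbox_Pair_eq)
    from z1(2)[OF this] e(2)[OF h(1,2)] show False by (simp add: z1_eq)
  qed
  have "g \<le> ?L v vx vxx vt z1" using v(2)[OF subsetD[OF QR z1(1)]] by blast
  also have "\<dots> \<le> ?L \<xi> \<xi>x \<xi>xx \<xi>t z1 + r * (v z1 - \<xi> z1)"
  proof -
    have "vx z1 = \<xi>x z1" using fx by (simp add: z1_eq)
    moreover have "\<sigma>\<^sup>2 * x1\<^sup>2 * \<xi>xx z1 \<le> \<sigma>\<^sup>2 * x1\<^sup>2 * vxx z1"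
      using fxx by (intro mult_left_mono) (auto simp: z1_eq)
    moreover have "\<xi>t z1 \<le> vt z1" using ft by (simp add: z1_eq)
    ultimately show ?thesis by (simp add: bond_operator_def z1_eq right_diff_distrib)
  qed
  also have "r * (v z1 - \<xi> z1) \<le> r * \<eta>" using v\<xi> \<open>r \<ge> 0\<close> by (intro mult_left_mono) auto
  also have "?L \<xi> \<xi>x \<xi>xx \<xi>t z1 = ?L \<psi> \<psi>x \<psi>xx \<psi>t z1 + \<kappa> * N z1"
    by (simp add: z1_eq bond_operator_def \<xi>_def \<xi>x_def \<xi>xx_def \<xi>t_def N_def field_simps)
  also have "\<kappa> * N z1 \<le> \<kappa> * B" using B(2)[OF z1(1)] \<kappa>(1) by (intro mult_left_mono) auto
  also have "?L \<psi> \<psi>x \<psi>xx \<psi>t z1 \<le> g - 3/4 * \<theta>" by (rule L\<psi>[OF z1(1)])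
  finally show False using r\<eta> \<kappa>(2) \<theta> by linarith
qed

text \<open>Take a point of {f \<le> 0} with the largest time. The face conditions keep it off the
  sides and the top, f is positive later, and continuity gives f \<ge> 0 on its own time level. It
  is thus a first contact in backward time, as required by
  \<open>supersolution_touch\<close>.\<close>

lemma positive_unless_touching:
  fixes f :: "real \<times> real \<Rightarrow> real"
  assumes cont: "continuous_on (cbox (xl, t1) (xr, t2)) f"
    and top: "\<And>x. xl \<le> x \<Longrightarrow> x \<le> xr \<Longrightarrow> f (x, t2) > 0"
    and left: "\<And>t. t1 \<le> t \<Longrightarrow> t \<le> t2 \<Longrightarrow> f (xl, t) > 0"
    and right: "\<And>t. t1 \<le> t \<Longrightarrow> t \<le> t2 \<Longrightarrow> f (xr, t) > 0"
    and touch: "\<And>x0 t0. xl < x0 \<Longrightarrow> x0 < xr \<Longrightarrow> t1 \<le> t0 \<Longrightarrow> t0 < t2 \<Longrightarrow> f (x0, t0) = 0 \<Longrightarrow>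
       (\<And>x t. xl \<le> x \<Longrightarrow> x \<le> xr \<Longrightarrow> t0 \<le> t \<Longrightarrow> t \<le> t2 \<Longrightarrow> f (x, t) \<ge> 0) \<Longrightarrow> False"
    and "xl \<le> x" "x \<le> xr" "t1 \<le> t" "t \<le> t2"
  shows "f (x, t) > 0"
proof (rule ccontr)
  let ?Q = "cbox (xl, t1) (xr, t2)"
  define S where "S = ?Q \<inter> f -` {..0}"
  assume "\<not> f (x, t) > 0"
  then have "(x, t) \<in> S" using assms by (auto simp: S_def cbox_Pair_eq)
  have "closed S" unfolding S_def by (intro continuous_closed_preimage cont closed_cbox) auto
  then have "compact S" unfolding S_def
    by (metis Int_lower1 bounded_cbox bounded_subset compact_eq_bounded_closed)
  then obtain z where z: "z \<in> S" "\<And>y. y \<in> S \<Longrightarrow> snd y \<le> snd z"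
    using continuous_attains_sup[of S snd] \<open>(x, t) \<in> S\<close> continuous_on_snd[OF continuous_on_id]
    by blast
  obtain x0 t0 where z_eq: "z = (x0, t0)" by (cases z)
  have b: "xl \<le> x0" "x0 \<le> xr" "t1 \<le> t0" "t0 \<le> t2" "f (x0, t0) \<le> 0"
    using z(1) by (auto simp: S_def z_eq cbox_Pair_eq)
  have s: "xl < x0" "x0 < xr" "t0 < t2"
    using b top[of x0] left[of t0] right[of t0] by (auto simp: order_less_le)
  have later: "f (y, s) > 0" if "xl \<le> y" "y \<le> xr" "t0 < s" "s \<le> t2" for y s
    using z(2)[of "(y, s)"] that b by (force simp: S_def z_eq cbox_Pair_eq)
  have ge: "f (y, s) \<ge> 0" if y: "xl \<le> y" "y \<le> xr" "t0 \<le> s" "s \<le> t2" for y s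
  proof (cases "s = t0")
    case True
    have "continuous_on {t0..t2} (\<lambda>s. f (y, s))"
      using y b by (intro continuous_on_compose2[OF cont] continuous_intros) (auto simp: cbox_Pair_eq)
    then have "((\<lambda>s. f (y, s)) \<longlongrightarrow> f (y, t0)) (at t0 within {t0..t2})"
      using b by (auto simp: continuous_on_def)
    then have "((\<lambda>s. f (y, s)) \<longlongrightarrow> f (y, t0)) (at_right t0)"
      using s by (simp add: at_within_Icc_at_right)
    moreover have "eventually (\<lambda>s. f (y, s) \<ge> 0) (at_right t0)"
      using s(3) by (auto simp: eventually_at_right intro!: exI[of _ t2] less_imp_le later y)
    ultimately show ?thesis unfolding True by (intro tendsto_lowerbound) auto
  next
    case False
    then show ?thesis using later[of y s] y by force
  qed
  have "f (x0, t0) = 0" using ge[of x0 t0] b by simp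
  from touch[OF s(1,2) b(3) s(3) this ge] show False by simp
qed

section \<open>No kinks at a maximum\<close>

context sobolev_function
begin

text \<open>Split |f| at the level 1/sqrt(\<rho>). The box has measure 2\<rho>^3, so the part below
  the level contributes 2\<rho>^2 sqrt(\<rho>). Above it six factors sqrt(\<rho>)|f| \<ge> 1 can be
  inserted, whence the seventh power and the factor \<rho>^3; the remaining integral runs over a box
  that does not shrink with \<rho>.\<close>

lemma parabolic_average_bound:
  assumes f: "f \<in> {Vxx, Vt}" and Q: "cbox l u \<subseteq> U"
    and Q': "cbox (x0 - \<rho>, t0) (x0 + \<rho>, t0 + \<rho>\<^sup>2) \<subseteq> cbox l u" and "\<rho> > 0"
    and A: "bump_on (x0 - \<rho>) (x0 + \<rho>) A" and B: "bump_on t0 (t0 + \<rho>\<^sup>2) B"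
    and m: "\<And>z. z \<in> cbox (x0 - \<rho>, t0) (x0 + \<rho>, t0 + \<rho>\<^sup>2) \<Longrightarrow> \<bar>A (fst z) * B (snd z)\<bar> \<le> m"
  shows "\<bar>LINT z|lebesgue_on (cbox (x0 - \<rho>, t0) (x0 + \<rho>, t0 + \<rho>\<^sup>2)). f z * (A (fst z) * B (snd z))\<bar>
     \<le> m * (2 * \<rho>\<^sup>2 * sqrt \<rho> + \<rho>^3 * (LINT z|lebesgue_on (cbox l u). \<bar>f z\<bar> powr 7))"
proof -
  let ?R = "cbox (x0 - \<rho>, t0) (x0 + \<rho>, t0 + \<rho>\<^sup>2)"
  let ?M = "lebesgue_on ?R"
  have RU: "?R \<subseteq> U" using Q Q' by blast
  have z: "(x0, t0) \<in> ?R" using \<open>\<rho> > 0\<close> by (auto simp: cbox_Pair_eq)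
  have m0: "0 \<le> m" using m[OF z] by simp
  define s where "s = sqrt \<rho>"
  have s: "s > 0" "s\<^sup>2 = \<rho>" using \<open>\<rho> > 0\<close> by (auto simp: s_def)
  have L7: "Lp_loc 7 U f" using Lp[of 7] f by auto
  have i7: "integrable (lebesgue_on (cbox l u)) (\<lambda>z. \<bar>f z\<bar> powr 7)"
    and i7': "integrable ?M (\<lambda>z. \<bar>f z\<bar> powr 7)"
    using L7 Q RU unfolding Lp_loc_def by (meson compact_cbox)+
  have mono: "(LINT z|?M. \<bar>f z\<bar> powr 7) \<le> (LINT z|lebesgue_on (cbox l u). \<bar>f z\<bar> powr 7)"
  proof -
    have "(LINT z|?M. \<bar>f z\<bar> powr 7) = integral ?R (\<lambda>z. \<bar>f z\<bar> powr 7)"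
      by (rule lebesgue_integral_eq_integral[OF i7']) simp
    also have "\<dots> \<le> integral (cbox l u) (\<lambda>z. \<bar>f z\<bar> powr 7)"
      using i7 i7' Q'
      by (intro integral_subset_le integrable_on_lebesgue_on) auto
    also have "\<dots> = (LINT z|lebesgue_on (cbox l u). \<bar>f z\<bar> powr 7)"
      by (rule lebesgue_integral_eq_integral[OF i7, symmetric]) simp
    finally show ?thesis .
  qed
  have young: "\<bar>y\<bar> \<le> 1 / s + \<rho>^3 * \<bar>y\<bar> powr 7" for y :: real
  proof (cases "\<bar>y\<bar> \<le> 1 / s")
    case False
    then have y: "\<bar>y\<bar> > 0" "1 \<le> s * \<bar>y\<bar>" using s by (auto simp: field_simps)
    have "\<bar>y\<bar> * 1 \<le> \<bar>y\<bar> * (s * \<bar>y\<bar>)^6" using y by (intro mult_left_mono one_le_power) auto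
    also have "\<dots> = (s\<^sup>2)^3 * \<bar>y\<bar>^7" by (simp add: power_mult_distrib power_def numeral_eq_Suc)
    also have "\<bar>y\<bar>^7 = \<bar>y\<bar> powr 7" using y by (simp add: powr_numeral)
    finally have "\<bar>y\<bar> \<le> \<rho>^3 * \<bar>y\<bar> powr 7" using s by simp
    moreover have "0 < 1 / s" using s by simp
    ultimately show ?thesis by linarith
  qed (use \<open>\<rho> > 0\<close> in \<open>simp add: add_increasing2\<close>)
  have meas: "integrable ?M (\<lambda>z. 1 / s)"
    by (intro finite_measure.integrable_const finite_measure_lebesgue_on) simp
  have int: "integrable ?M (\<lambda>z. m * (1 / s + \<rho>^3 * \<bar>f z\<bar> powr 7))"
    using meas i7' by simp
  have ifA: "integrable ?M (\<lambda>z. f z * (A (fst z) * B (snd z)))"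
    by (rule integrable_box[OF RU A B]) (use f in auto)
  have "\<bar>LINT z|?M. f z * (A (fst z) * B (snd z))\<bar> \<le> (LINT z|?M. \<bar>f z * (A (fst z) * B (snd z))\<bar>)"
    by (rule integral_abs_bound)
  also have "\<dots> \<le> (LINT z|?M. m * (1 / s + \<rho>^3 * \<bar>f z\<bar> powr 7))"
  proof (rule integral_mono)
    fix z assume "z \<in> space ?M"
    then have "\<bar>A (fst z) * B (snd z)\<bar> \<le> m" using m by simp
    then have "\<bar>A (fst z) * B (snd z)\<bar> * \<bar>f z\<bar> \<le> m * (1 / s + \<rho>^3 * \<bar>f z\<bar> powr 7)"
      by (intro mult_mono young m0) auto
    then show "\<bar>f z * (A (fst z) * B (snd z))\<bar> \<le> m * (1 / s + \<rho>^3 * \<bar>f z\<bar> powr 7)"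
      by (simp add: abs_mult mult_ac)
  qed (use ifA int in auto)
  also have "\<dots> = m * (1 / s * measure lebesgue ?R + \<rho>^3 * (LINT z|?M. \<bar>f z\<bar> powr 7))"
    using meas i7' by (simp add: measure_restrict_space)
  also have "measure lebesgue ?R = 2 * \<rho>^3"
    using \<open>\<rho> > 0\<close> by (simp add: content_Pair power_def numeral_eq_Suc)
  also have "1 / s * (2 * \<rho>^3) = 2 * \<rho>\<^sup>2 * s"
    using s(1) by (simp add: field_simps power_def numeral_eq_Suc flip: s(2))
  finally have "\<bar>LINT z|?M. f z * (A (fst z) * B (snd z))\<bar>
      \<le> m * (2 * \<rho>\<^sup>2 * s + \<rho>^3 * (LINT z|?M. \<bar>f z\<bar> powr 7))" .
  also have "\<dots> \<le> m * (2 * \<rho>\<^sup>2 * s + \<rho>^3 * (LINT z|lebesgue_on (cbox l u). \<bar>f z\<bar> powr 7))"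
    using mono m0 \<open>\<rho> > 0\<close> by (intro mult_left_mono add_left_mono) auto
  finally show ?thesis by (simp add: s_def)
qed

text \<open>The average \<open>M \<rho>\<close> of \<open>V\<close> over a parabolic box of size \<open>\<rho>\<close> has derivative
  \<open>O(\<rho> (\<bar>V\<^sub>x\<^sub>x\<bar> + \<bar>V\<^sub>t\<bar>))\<close> on average, which is \<open>O(\<surd>\<rho>)\<close> by integrability of the seventh powers. A kink
  at the top level \<open>K\<close> would make \<open>K - M \<rho>\<close> at least linear in \<open>\<rho>\<close>.\<close>

lemma no_kink_at_maximum:
  assumes Q: "cbox (x0 - d, t0) (x0 + d, t0 + d) \<subseteq> U" and d: "0 < d" "d \<le> 1"
    and le: "\<And>z. z \<in> cbox (x0 - d, t0) (x0 + d, t0 + d) \<Longrightarrow> V z \<le> K"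
    and top: "V (x0, t0) = K" and "0 \<le> b"
    and kink: "\<And>x t. (x, t) \<in> cbox (x0 - d, t0) (x0 + d, t0 + d) \<Longrightarrow>
       V (x, t) \<le> K - (a * (x - x0) - b * (t - t0) - b * (x - x0)\<^sup>2)"
  shows "a = 0"
proof (rule ccontr)
  assume "a \<noteq> 0"
  let ?Q = "cbox (x0 - d, t0) (x0 + d, t0 + d)"
  \<comment> \<open>Parabolic scaling: width \<rho> in space and, in time, support in
    [t0, t0 + \<rho>^2], entirely after t0 because the kink bound is known only there. The later
    division by \<rho>^3 makes the mass of \<open>k\<close> independent of \<rho>.\<close>
  define P where "P \<rho> z = bump_weight ((fst z - x0) / \<rho>) * bump (2 * (snd z - t0) / \<rho>\<^sup>2 - 1)"
    for \<rho> and z :: "real \<times> real"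
  define k where "k \<rho> z = P \<rho> z / \<rho>^3" for \<rho> z
  define k' where "k' \<rho> z = - 3 * P \<rho> z / \<rho>^4
      - (fst z - x0) / \<rho>^5 * (deriv bump_weight ((fst z - x0) / \<rho>) * bump (2 * (snd z - t0) / \<rho>\<^sup>2 - 1))
      - 4 * (snd z - t0) / \<rho>^6 * (bump_weight ((fst z - x0) / \<rho>) * deriv bump (2 * (snd z - t0) / \<rho>\<^sup>2 - 1))"
    for \<rho> and z :: "real \<times> real"
  define M where "M \<rho> = integral ?Q (\<lambda>z. V z * k \<rho> z)" for \<rho>
  define M' where "M' \<rho> = integral ?Q (\<lambda>z. V z * k' \<rho> z)" for \<rho>
  have cQ: "continuous_on ?Q V" using continuous_on_subset[OF cont Q] .
  have P0: "0 \<le> P \<rho> z" for \<rho> z by (simp add: P_def bump_nonneg bump_weight_nonneg)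
  have cP: "continuous_on S (P \<rho>)" if "\<rho> > 0" for S \<rho>
    using that unfolding P_def by (intro continuous_intros) auto
  have ck: "continuous_on S (k \<rho>)" if "\<rho> > 0" for S \<rho>
    using that unfolding k_def by (intro continuous_intros cP) auto
  have k_d: "((\<lambda>\<rho>. k \<rho> z) has_real_derivative k' \<rho> z) (at \<rho>)" if "\<rho> > 0" for \<rho> z
  proof -
    have 1: "((\<lambda>\<rho>. (fst z - x0) / \<rho>) has_real_derivative - (fst z - x0) / \<rho>\<^sup>2) (at \<rho>)"
      "((\<lambda>\<rho>. 2 * (snd z - t0) / \<rho>\<^sup>2 - 1) has_real_derivative - 4 * (snd z - t0) / \<rho>^3) (at \<rho>)"
      using that by (auto intro!: derivative_eq_intros simp: field_simps power_def numeral_eq_Suc)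
    have 2: "((\<lambda>\<rho>. f \<rho> * g \<rho> / \<rho>^3) has_real_derivative
        - 3 * (f \<rho> * g \<rho>) / \<rho>^4 + f' * g \<rho> / \<rho>^3 + f \<rho> * g' / \<rho>^3) (at \<rho>)"
      if "(f has_real_derivative f') (at \<rho>)" "(g has_real_derivative g') (at \<rho>)" for f g f' g'
      using that \<open>\<rho> > 0\<close> by (auto intro!: derivative_eq_intros simp: field_simps power_def numeral_eq_Suc)
    show ?thesis
      unfolding k_def P_def k'_def
      by (rule DERIV_cong[OF 2[OF DERIV_chain2[OF smooth_DERIV[OF smooth_bump_weight] 1(1)]
            bump_DERIV_chain(1)[OF 1(2)]]])
         (use that in \<open>simp add: field_simps power_def numeral_eq_Suc\<close>)
  qed
  have M_d: "(M has_real_derivative M' \<rho>) (at \<rho>)" if "\<rho> > 0" for \<rho>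
    unfolding M_def[abs_def] M'_def
  proof (rule parametric_integral_DERIV[where S = "{0<..}"])
    have n: "\<forall>p\<in>{0::real<..} \<times> ?Q. fst p ^ j \<noteq> 0" "\<forall>p\<in>{0::real<..} \<times> ?Q. fst p \<noteq> 0" for j :: nat
      by (auto simp: mem_Times_iff)
    show "continuous_on ({0<..} \<times> ?Q) (\<lambda>p. k' (fst p) (snd p))"
      unfolding k'_def P_def by (intro continuous_intros n)
  qed (use cQ k_d ck that in auto)
  define I where "I f = (LINT z|lebesgue_on ?Q. \<bar>f z\<bar> powr 7)" for f :: "real \<times> real \<Rightarrow> real"
  have I0: "0 \<le> I f" for f unfolding I_def by (rule integral_nonneg_AE) auto
  have "compact (cbox (-1) (1::real))" by simp
  then have "bounded (bump ` cbox (-1) 1)" "bounded (bump_weight ` cbox (-1) 1)"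
    by (intro compact_imp_bounded compact_continuous_image smooth_continuous_on smooth_bump
        smooth_bump_weight; simp)+
  then obtain C1 C2 where C: "C1 > 0" "\<And>y. y \<in> {-1..1} \<Longrightarrow> \<bar>bump y\<bar> \<le> C1"
    "C2 > 0" "\<And>y. y \<in> {-1..1} \<Longrightarrow> \<bar>bump_weight y\<bar> \<le> C2"
    unfolding bounded_pos by (auto simp: image_iff)
  have C': "\<bar>bump y\<bar> \<le> C1" "\<bar>bump_weight y\<bar> \<le> C2" for y
    using C(2,4)[of y] C(1,3) bump_zero[of y] bump_weight_zero[of y] by (cases "\<bar>y\<bar> \<le> 1"; force)+
  define C where "C = C1 * C1 * (2 + I Vxx) + 2 * C2 * C1 * (2 + I Vt)"
  have C0: "C \<ge> 0" unfolding C_def using C I0[of Vxx] I0[of Vt] by simp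
  have sub: "cbox (x0 - \<rho>, t0) (x0 + \<rho>, t0 + \<rho>\<^sup>2) \<subseteq> ?Q" if "0 < \<rho>" "\<rho> < d" for \<rho>
  proof -
    have "\<rho>\<^sup>2 \<le> \<rho> * 1" unfolding power2_eq_square using that d by (intro mult_left_mono) auto
    then show ?thesis using that by (auto simp: cbox_Pair_eq)
  qed
  have tb: "bump_on t0 (t0 + \<rho>\<^sup>2) (\<lambda>s. bump (2 * (s - t0) / \<rho>\<^sup>2 - 1))" if "0 < \<rho>" for \<rho>
    unfolding bump_on_def
  proof (intro conjI allI impI)
    show "smooth_real (\<lambda>s. bump (2 * (s - t0) / \<rho>\<^sup>2 - 1))"
      by (intro smooth_compose[OF smooth_bump] smooth_intros)
    fix s assume "s \<notin> {t0..t0 + \<rho>\<^sup>2}"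
    then show "bump (2 * (s - t0) / \<rho>\<^sup>2 - 1) = 0"
      using that by (intro bump_zero) (auto simp: field_simps abs_if)
  qed
  have xb: "bump_on (x0 - \<rho>) (x0 + \<rho>) (\<lambda>x. f ((x - x0) / \<rho>))"
    if "0 < \<rho>" "smooth_real f" "\<And>y. 1 \<le> \<bar>y\<bar> \<Longrightarrow> f y = 0" for \<rho> f
    unfolding bump_on_def
  proof (intro conjI allI impI)
    show "smooth_real (\<lambda>x. f ((x - x0) / \<rho>))"
      by (intro smooth_compose[OF that(2)] smooth_intros)
    fix x assume "x \<notin> {x0 - \<rho>..x0 + \<rho>}"
    then show "f ((x - x0) / \<rho>) = 0"
      using that(1) by (intro that(3)) (auto simp: field_simps abs_if)
  qed
  have M'_bound: "\<bar>M' \<rho>\<bar> \<le> C * sqrt \<rho>" if \<rho>: "0 < \<rho>" "\<rho> < d" for \<rho>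
  proof -
    let ?R = "cbox (x0 - \<rho>, t0) (x0 + \<rho>, t0 + \<rho>\<^sup>2)"
    let ?B = "\<lambda>s. bump (2 * (s - t0) / \<rho>\<^sup>2 - 1)" and ?B' = "\<lambda>s. deriv bump (2 * (s - t0) / \<rho>\<^sup>2 - 1)"
    let ?b = "\<lambda>x. bump ((x - x0) / \<rho>)" and ?w = "\<lambda>x. bump_weight ((x - x0) / \<rho>)"
    let ?w' = "\<lambda>x. deriv bump_weight ((x - x0) / \<rho>)"
    let ?S = "\<lambda>s. (s - t0) * ?B s" and ?S' = "\<lambda>s. ?B s + 2 * (s - t0) / \<rho>\<^sup>2 * ?B' s"
    let ?b1 = "\<lambda>x. - (x - x0) / \<rho>\<^sup>2 * ?w x"
    let ?b2 = "\<lambda>x. - ?w x / \<rho>\<^sup>2 - (x - x0) / \<rho>^3 * ?w' x"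
    have RU: "?R \<subseteq> U" using sub[OF \<rho>] Q by blast
    have bB: "bump_on (x0 - \<rho>) (x0 + \<rho>) ?b" "bump_on t0 (t0 + \<rho>\<^sup>2) ?B" "bump_on (x0 - \<rho>) (x0 + \<rho>) ?w"
      using xb[OF \<rho>(1) smooth_bump bump_zero] tb[OF \<rho>(1)]
        xb[OF \<rho>(1) smooth_bump_weight bump_weight_zero] by auto
    have bS: "bump_on t0 (t0 + \<rho>\<^sup>2) ?S" by (intro bump_on_mult bB smooth_intros)
    have arg: "((\<lambda>x. (x - x0) / \<rho>) has_real_derivative 1 / \<rho>) (at x)"
      "((\<lambda>s. 2 * (s - t0) / \<rho>\<^sup>2 - 1) has_real_derivative 2 / \<rho>\<^sup>2) (at s)" for x s
      using \<rho> by (auto intro!: derivative_eq_intros simp: field_simps)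
    have db: "(?b has_real_derivative ?b1 x) (at x)" for x
      by (rule DERIV_cong[OF DERIV_chain2[OF bump_DERIV arg(1)]])
         (use \<rho> in \<open>simp add: field_simps power2_eq_square\<close>)
    have db1: "(?b1 has_real_derivative ?b2 x) (at x)" for x
    proof -
      have 1: "((\<lambda>x. - (x - x0) / \<rho>\<^sup>2 * f x) has_real_derivative - f x / \<rho>\<^sup>2 - (x - x0) / \<rho>\<^sup>2 * f') (at x)"
        if "(f has_real_derivative f') (at x)" for f f'
        using that \<rho> by (auto intro!: derivative_eq_intros simp: field_simps)
      show ?thesis
        by (rule DERIV_cong[OF 1[OF DERIV_chain2[OF smooth_DERIV[OF smooth_bump_weight] arg(1)]]])
           (use \<rho> in \<open>simp add: field_simps power_def numeral_eq_Suc\<close>)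
    qed
    have dS: "(?S has_real_derivative ?S' s) (at s)" for s
    proof -
      have 1: "((\<lambda>s. (s - t0) * f s) has_real_derivative f s + (s - t0) * f') (at s)"
        if "(f has_real_derivative f') (at s)" for f f'
        using that by (auto intro!: derivative_eq_intros simp: field_simps)
      show ?thesis
        by (rule DERIV_cong[OF 1[OF bump_DERIV_chain(1)[OF arg(2)]]])
           (use \<rho> in \<open>simp add: field_simps\<close>)
    qed
    \<comment> \<open>The identity bump'(y) = -y bump_weight(y) pays off here: up to powers of
      \<rho>, the \<rho>-derivative of the kernel is an exact second x-derivative plus an exact
      t-derivative of compactly supported functions. Paired with V these become V_xx and V_t,
      without a first-order term.\<close>
    have k'_eq: "V z * k' \<rho> z = 1 / \<rho>\<^sup>2 * (V z * (?b2 (fst z) * ?B (snd z)))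
        - 2 / \<rho>^4 * (V z * (?w (fst z) * ?S' (snd z)))" for z
      unfolding k'_def P_def using \<rho> by (simp add: field_simps power_def numeral_eq_Suc)
    have k'0: "k' \<rho> z = 0" if "z \<notin> ?R" for z
    proof -
      have b2: "bump_on (x0 - \<rho>) (x0 + \<rho>) ?b2" by (rule bump_on_deriv[OF bump_on_deriv[OF bB(1) db] db1])
      have S': "bump_on t0 (t0 + \<rho>\<^sup>2) ?S'" by (rule bump_on_deriv[OF bS dS])
      have "fst z \<notin> {x0 - \<rho>..x0 + \<rho>} \<or> snd z \<notin> {t0..t0 + \<rho>\<^sup>2}"
        using that by (cases z) (auto simp: cbox_Pair_eq)
      then have "?b2 (fst z) * ?B (snd z) = 0" "?w (fst z) * ?S' (snd z) = 0"
        using bump_on_zero[OF b2, of "fst z"] bump_on_zero[OF S', of "snd z"]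
          bump_on_zero[OF bB(2), of "snd z"] bump_on_zero[OF bB(3), of "fst z"] by auto
      moreover have "k' \<rho> z = 1 / \<rho>\<^sup>2 * (?b2 (fst z) * ?B (snd z)) - 2 / \<rho>^4 * (?w (fst z) * ?S' (snd z))"
        unfolding k'_def P_def using \<rho> by (simp add: field_simps power_def numeral_eq_Suc)
      ultimately show ?thesis by (simp only: mult_zero_right diff_self)
    qed
    have int: "(\<lambda>z. V z * (f (fst z) * g (snd z))) integrable_on ?R"
      if "continuous_on UNIV f" "continuous_on UNIV g" for f g :: "real \<Rightarrow> real"
      by (intro integrable_continuous continuous_intros continuous_on_subset[OF cont RU]
          continuous_on_compose2[OF that(1)] continuous_on_compose2[OF that(2)]) auto
    have "M' \<rho> = integral ?R (\<lambda>z. V z * k' \<rho> z)"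
      unfolding M'_def
    proof (rule integral_unique, rule has_integral_on_superset[OF _ _ sub[OF \<rho>]])
      have "continuous_on ?R (k' \<rho>)"
        unfolding k'_def P_def using \<rho>(1) by (intro continuous_intros) auto
      then show "((\<lambda>z. V z * k' \<rho> z) has_integral integral ?R (\<lambda>z. V z * k' \<rho> z)) ?R"
        by (intro integrable_integral integrable_continuous continuous_intros
            continuous_on_subset[OF cont RU])
    qed (use k'0 in auto)
    also have "\<dots> = 1 / \<rho>\<^sup>2 * integral ?R (\<lambda>z. V z * (?b2 (fst z) * ?B (snd z)))
        - 2 / \<rho>^4 * integral ?R (\<lambda>z. V z * (?w (fst z) * ?S' (snd z)))"
      unfolding k'_eq
      by (rule integral_unique[OF has_integral_diff[OF
            has_integral_mult_right[OF integrable_integral[OF int]]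
            has_integral_mult_right[OF integrable_integral[OF int]]]];
          use \<rho>(1) in \<open>intro continuous_intros\<close>; simp)
    also have "integral ?R (\<lambda>z. V z * (?b2 (fst z) * ?B (snd z))) =
        (LINT z|lebesgue_on ?R. Vxx z * (?b (fst z) * ?B (snd z)))"
      by (rule weak_xx[OF RU bB(1,2) db db1])
    also have "integral ?R (\<lambda>z. V z * (?w (fst z) * ?S' (snd z))) =
        - (LINT z|lebesgue_on ?R. Vt z * (?w (fst z) * ?S (snd z)))"
      by (rule weak_t[OF RU bB(3) bS dS])
    finally have eq: "M' \<rho> = 1 / \<rho>\<^sup>2 * (LINT z|lebesgue_on ?R. Vxx z * (?b (fst z) * ?B (snd z)))
        + 2 / \<rho>^4 * (LINT z|lebesgue_on ?R. Vt z * (?w (fst z) * ?S (snd z)))" by simp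
    have m1: "\<bar>?b (fst z) * ?B (snd z)\<bar> \<le> C1 * C1" for z :: "real \<times> real"
      unfolding abs_mult using C C' by (intro mult_mono) auto
    have m2: "\<bar>?w (fst z) * ?S (snd z)\<bar> \<le> C2 * (\<rho>\<^sup>2 * C1)" if "z \<in> ?R" for z
    proof -
      have "\<bar>snd z - t0\<bar> \<le> \<rho>\<^sup>2" using that by (cases z) (auto simp: cbox_Pair_eq)
      then show ?thesis unfolding abs_mult using C C' by (intro mult_mono) auto
    qed
    have b1: "\<bar>LINT z|lebesgue_on ?R. Vxx z * (?b (fst z) * ?B (snd z))\<bar>
        \<le> C1 * C1 * (2 * \<rho>\<^sup>2 * sqrt \<rho> + \<rho>^3 * I Vxx)"
      unfolding I_def
      by (rule parabolic_average_bound[OF _ Q sub[OF \<rho>] \<rho>(1) bB(1,2) m1]) simp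
    have b2: "\<bar>LINT z|lebesgue_on ?R. Vt z * (?w (fst z) * ?S (snd z))\<bar>
        \<le> C2 * (\<rho>\<^sup>2 * C1) * (2 * \<rho>\<^sup>2 * sqrt \<rho> + \<rho>^3 * I Vt)"
      unfolding I_def
      by (rule parabolic_average_bound[OF _ Q sub[OF \<rho>] \<rho>(1) bB(3) bS m2]) auto
    have \<rho>3: "\<rho>^3 \<le> \<rho>\<^sup>2 * sqrt \<rho>"
    proof -
      have "sqrt \<rho> \<le> 1" using \<rho> d by simp
      then have "sqrt \<rho> * sqrt \<rho> \<le> 1 * sqrt \<rho>" using \<rho> by (intro mult_right_mono) auto
      then have "\<rho> \<le> sqrt \<rho>" using \<rho> by simp
      then have "\<rho>\<^sup>2 * \<rho> \<le> \<rho>\<^sup>2 * sqrt \<rho>" by (intro mult_left_mono) auto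
      then show ?thesis by (simp add: power_def numeral_eq_Suc)
    qed
    have s3: "2 * \<rho>\<^sup>2 * sqrt \<rho> + \<rho>^3 * i \<le> \<rho>\<^sup>2 * sqrt \<rho> * (2 + i)" if "0 \<le> i" for i
      using mult_left_mono[OF \<rho>3 that] by (simp add: algebra_simps)
    have "\<bar>M' \<rho>\<bar> \<le> 1 / \<rho>\<^sup>2 * \<bar>LINT z|lebesgue_on ?R. Vxx z * (?b (fst z) * ?B (snd z))\<bar>
        + 2 / \<rho>^4 * \<bar>LINT z|lebesgue_on ?R. Vt z * (?w (fst z) * ?S (snd z))\<bar>"
      unfolding eq by (rule order_trans[OF abs_triangle_ineq]) (simp add: abs_mult)
    also have "\<dots> \<le> 1 / \<rho>\<^sup>2 * (C1 * C1 * (\<rho>\<^sup>2 * sqrt \<rho> * (2 + I Vxx)))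
        + 2 / \<rho>^4 * (C2 * (\<rho>\<^sup>2 * C1) * (\<rho>\<^sup>2 * sqrt \<rho> * (2 + I Vt)))"
      using C by (intro add_mono mult_left_mono order_trans[OF b1] order_trans[OF b2] s3 I0) auto
    also have "\<dots> = C * sqrt \<rho>"
      unfolding C_def using \<rho>(1) by (simp add: field_simps power_def numeral_eq_Suc)
    finally show ?thesis .
  qed
  define n where "n = integral {-1..1} bump_weight * bump_mass / 2"
  have mass: "integral ?Q (k \<rho>) = n" if \<rho>: "0 < \<rho>" "\<rho> < d" for \<rho>
  proof -
    have \<rho>2: "\<rho>\<^sup>2 \<le> \<rho> * 1" unfolding power2_eq_square using \<rho> d by (intro mult_left_mono) auto
    have 1: "integral {x0 - d..x0 + d} (\<lambda>x. bump_weight ((x - x0) / \<rho>)) = \<rho> * integral {-1..1} bump_weight"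
      using \<rho> by (intro integral_affine[OF smooth_bump_weight bump_weight_zero]) auto
    have "integral {t0..t0 + d} (\<lambda>s. bump ((s - (t0 + \<rho>\<^sup>2 / 2)) / (\<rho>\<^sup>2 / 2))) = \<rho>\<^sup>2 / 2 * bump_mass"
      using \<rho> \<rho>2 by (intro integral_bump_affine) auto
    moreover have "(s - (t0 + \<rho>\<^sup>2 / 2)) / (\<rho>\<^sup>2 / 2) = 2 * (s - t0) / \<rho>\<^sup>2 - 1" for s
      using \<rho>(1) by (simp add: field_simps)
    ultimately have 2: "integral {t0..t0 + d} (\<lambda>s. bump (2 * (s - t0) / \<rho>\<^sup>2 - 1)) = \<rho>\<^sup>2 / 2 * bump_mass"
      by simp
    have "integral ?Q (P \<rho>) = \<rho>^3 * n"
    proof -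
      have "integral ?Q (P \<rho>) = integral {x0 - d..x0 + d} (\<lambda>x. integral {t0..t0 + d} (\<lambda>s. P \<rho> (x, s)))"
        by (simp add: integral_prod_continuous[OF cP[OF \<rho>(1)]])
      also have "\<dots> = integral {x0 - d..x0 + d} (\<lambda>x. bump_weight ((x - x0) / \<rho>) * (\<rho>\<^sup>2 / 2 * bump_mass))"
        unfolding P_def fst_conv snd_conv by (simp only: integral_mult_right 2)
      also have "\<dots> = \<rho> * integral {-1..1} bump_weight * (\<rho>\<^sup>2 / 2 * bump_mass)"
        by (simp only: integral_mult_left 1)
      finally show ?thesis by (simp add: n_def power_def numeral_eq_Suc)
    qed
    then show ?thesis unfolding k_def using \<rho>(1) by simp
  qed
  have ik: "k \<rho> integrable_on ?Q" if "\<rho> > 0" for \<rho> by (rule integrable_continuous[OF ck[OF that]])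
  have iVk: "(\<lambda>z. (K - V z) * k \<rho> z) integrable_on ?Q" if "\<rho> > 0" for \<rho>
    by (intro integrable_continuous continuous_intros cQ ck that)
  have def_eq: "K * n - M \<rho> = integral ?Q (\<lambda>z. (K - V z) * k \<rho> z)" if \<rho>: "0 < \<rho>" "\<rho> < d" for \<rho>
  proof -
    have "((\<lambda>z. K * k \<rho> z - V z * k \<rho> z) has_integral (K * integral ?Q (k \<rho>) - M \<rho>)) ?Q"
      unfolding M_def
      by (intro has_integral_diff has_integral_mult_right integrable_integral ik \<rho>(1)
          integrable_continuous continuous_intros cQ ck)
    then show ?thesis using mass[OF \<rho>] by (simp add: algebra_simps integral_unique)
  qed
  \<comment> \<open>As \<rho>' tends to 0 the average M(\<rho>') tends to Kn, by continuity and
    V(x0, t0) = K; the mean value theorem and the bound on M' cover the way from \<rho>' to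
    \<rho>.\<close>
  have upper: "\<bar>K * n - M \<rho>\<bar> \<le> C * sqrt \<rho> * \<rho>" if \<rho>: "0 < \<rho>" "\<rho> < d" for \<rho>
  proof (rule field_le_epsilon)
    fix \<epsilon> :: real assume "\<epsilon> > 0"
    have n0: "0 \<le> n"
      using mass[OF \<rho>] integral_nonneg[OF ik[OF \<rho>(1)]] P0 \<rho>(1) by (auto simp: k_def)
    have "(x0, t0) \<in> ?Q" using d by (auto simp: cbox_Pair_eq)
    moreover have "0 < \<epsilon> / (n + 1)" using \<open>\<epsilon> > 0\<close> n0 by simp
    ultimately obtain \<delta> where \<delta>: "\<delta> > 0" "\<And>z. z \<in> ?Q \<Longrightarrow> dist z (x0, t0) < \<delta> \<Longrightarrow> \<bar>V z - K\<bar> < \<epsilon> / (n + 1)"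
      using cQ unfolding continuous_on_iff dist_real_def top[symmetric] by metis
    define \<rho>' where "\<rho>' = min (\<rho> / 2) (\<delta> / 3)"
    have \<rho>': "0 < \<rho>'" "\<rho>' < \<rho>" "\<rho>' < d" "2 * \<rho>' < \<delta>" using \<rho> \<delta>(1) by (auto simp: \<rho>'_def)
    have \<rho>'2: "\<rho>'\<^sup>2 \<le> \<rho>' * 1" unfolding power2_eq_square using \<rho>' d by (intro mult_left_mono) auto
    have "\<bar>K * n - M \<rho>'\<bar> \<le> integral ?Q (\<lambda>z. \<epsilon> / (n + 1) * k \<rho>' z)"
      unfolding def_eq[OF \<rho>'(1,3)] real_norm_def[symmetric]
    proof (rule integral_norm_bound_integral[OF iVk[OF \<rho>'(1)] integrable_on_mult_right[OF ik[OF \<rho>'(1)]]])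
      fix z assume z: "z \<in> ?Q"
      have k0: "0 \<le> k \<rho>' z" using P0 \<rho>'(1) by (simp add: k_def)
      have "\<bar>K - V z\<bar> * k \<rho>' z \<le> \<epsilon> / (n + 1) * k \<rho>' z"
      proof (cases "k \<rho>' z = 0")
        case False
        then have "\<bar>(fst z - x0) / \<rho>'\<bar> < 1" "\<bar>2 * (snd z - t0) / \<rho>'\<^sup>2 - 1\<bar> < 1"
          using bump_zero bump_weight_zero unfolding k_def P_def by (force, force)
        then have "\<bar>fst z - x0\<bar> < \<rho>'" "\<bar>snd z - t0\<bar> \<le> \<rho>'\<^sup>2"
          using \<rho>'(1) by (auto simp: abs_less_iff abs_le_iff field_simps)
        moreover have "dist z (x0, t0) \<le> \<bar>fst z - x0\<bar> + \<bar>snd z - t0\<bar>"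
          by (cases z) (simp add: dist_prod_def dist_real_def sqrt_sum_squares_le_sum_abs)
        ultimately have "dist z (x0, t0) < \<delta>" using \<rho>'2 \<rho>' by linarith
        from \<delta>(2)[OF z this] show ?thesis
          using k0 by (intro mult_right_mono) (auto simp: abs_minus_commute)
      qed simp
      then show "norm ((K - V z) * k \<rho>' z) \<le> \<epsilon> / (n + 1) * k \<rho>' z"
        using k0 by (simp only: real_norm_def abs_mult[of "K - V z"] abs_of_nonneg)
    qed
    also have "\<dots> = \<epsilon> / (n + 1) * n" using mass[OF \<rho>'(1,3)] by (simp only: integral_mult_right)
    also have "\<dots> \<le> \<epsilon>" using n0 \<open>\<epsilon> > 0\<close> by (simp add: field_simps)
    finally have 1: "\<bar>K * n - M \<rho>'\<bar> \<le> \<epsilon>" .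
    obtain \<zeta> where \<zeta>: "\<rho>' < \<zeta>" "\<zeta> < \<rho>" "M \<rho> - M \<rho>' = (\<rho> - \<rho>') * M' \<zeta>"
      using MVT2[of \<rho>' \<rho> M M'] \<rho>' M_d by force
    have "\<bar>M \<rho> - M \<rho>'\<bar> = (\<rho> - \<rho>') * \<bar>M' \<zeta>\<bar>" unfolding \<zeta>(3) using \<rho>' by (simp add: abs_mult)
    also have "\<dots> \<le> \<rho> * (C * sqrt \<rho>)"
    proof (rule mult_mono)
      have "C * sqrt \<zeta> \<le> C * sqrt \<rho>" using \<zeta> C0 by (intro mult_left_mono) auto
      with M'_bound[of \<zeta>] show "\<bar>M' \<zeta>\<bar> \<le> C * sqrt \<rho>" using \<zeta> \<rho>' \<rho> by linarith
    qed (use \<rho>' in auto)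
    finally have "\<bar>M \<rho> - M \<rho>'\<bar> \<le> C * sqrt \<rho> * \<rho>" by (simp add: mult_ac)
    with 1 show "\<bar>K * n - M \<rho>\<bar> \<le> C * sqrt \<rho> * \<rho> + \<epsilon>" by linarith
  qed
  have inner: "\<exists>A>0. \<forall>y. \<bar>y\<bar> \<le> 1/2 \<longrightarrow> A \<le> f y"
    if f: "smooth_real f" "\<And>y. \<bar>y\<bar> < 1 \<Longrightarrow> 0 < f y" for f
  proof -
    obtain y0 where y0: "y0 \<in> {-1/2..1/2::real}" "\<forall>y\<in>{-1/2..1/2}. f y0 \<le> f y"
      using continuous_attains_inf[of "{-1/2..1/2::real}" f] smooth_continuous_on[OF f(1)] by auto
    have "f y0 \<le> f y" if "\<bar>y\<bar> \<le> 1/2" for y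
    proof -
      have "y \<in> {-1/2..1/2}" using that by (auto simp: abs_le_iff)
      then show ?thesis using y0(2) by blast
    qed
    moreover have "0 < f y0" using f(2)[of y0] y0(1) by (auto simp: abs_less_iff)
    ultimately show ?thesis by blast
  qed
  obtain A1 where A1: "A1 > 0" "\<And>y. \<bar>y\<bar> \<le> 1/2 \<Longrightarrow> A1 \<le> bump y"
    using inner[OF smooth_bump bump_pos] by blast
  obtain A2 where A2: "A2 > 0" "\<And>y. \<bar>y\<bar> \<le> 1/2 \<Longrightarrow> A2 \<le> bump_weight y"
    using inner[OF smooth_bump_weight bump_weight_pos] by blast
  define c where "c = \<bar>a\<bar> * A1 * A2 / 64"
  have c: "c > 0" using \<open>a \<noteq> 0\<close> A1 A2 by (simp add: c_def)
  have lower: "c * \<rho> \<le> K * n - M \<rho>" if \<rho>: "0 < \<rho>" "\<rho> < d" "16 * b * \<rho> \<le> \<bar>a\<bar>" for \<rho>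
  proof -
    \<comment> \<open>A box of measure \<rho>^3/8 on the side where a(x - x0) is positive, at
      distance between \<rho>/4 and \<rho>/2 from x0. There K - V is at least |a|\<rho>/8 and the
      kernel at least A1 A2/\<rho>^3, which explains the 64 in \<open>c\<close>.\<close>
    define xa where "xa = (if a > 0 then x0 + \<rho> / 4 else x0 - \<rho> / 2)"
    let ?R = "cbox (xa, t0 + \<rho>\<^sup>2 / 4) (xa + \<rho> / 4, t0 + 3 * \<rho>\<^sup>2 / 4)"
    have \<rho>2: "\<rho>\<^sup>2 \<le> \<rho> * 1" unfolding power2_eq_square using \<rho> d by (intro mult_left_mono) auto
    have RQ: "?R \<subseteq> ?Q" using \<rho> \<rho>2 by (auto simp: cbox_Pair_eq xa_def)
    have pt: "\<bar>a\<bar> * \<rho> / 8 * (A1 * A2 / \<rho>^3) \<le> (K - V z) * k \<rho> z" if z: "z \<in> ?R" for z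
    proof (rule mult_mono)
      obtain x t where zxt: "z = (x, t)" by (cases z)
      have x: "\<rho> / 4 \<le> \<bar>x - x0\<bar>" "\<bar>x - x0\<bar> \<le> \<rho> / 2" "a * (x - x0) = \<bar>a\<bar> * \<bar>x - x0\<bar>"
        and t: "\<rho>\<^sup>2 / 4 \<le> t - t0" "t - t0 \<le> 3 * \<rho>\<^sup>2 / 4"
        using z \<open>a \<noteq> 0\<close> \<rho>(1) unfolding zxt xa_def
        by (auto simp: cbox_Pair_eq abs_if algebra_simps split: if_splits)
      have "\<bar>a\<bar> * (\<rho> / 4) \<le> a * (x - x0)" unfolding x(3) using x by (intro mult_left_mono) auto
      moreover have "b * (t - t0) \<le> b * \<rho>\<^sup>2" using t \<open>0 \<le> b\<close> by (intro mult_left_mono) auto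
      moreover have "b * (x - x0)\<^sup>2 \<le> b * \<rho>\<^sup>2"
        using x(2) \<rho>(1) \<open>0 \<le> b\<close> by (intro mult_left_mono) (auto simp: abs_le_square_iff[symmetric])
      moreover have "16 * b * \<rho> * \<rho> \<le> \<bar>a\<bar> * \<rho>" using \<rho> by (intro mult_right_mono) auto
      ultimately have "\<bar>a\<bar> * \<rho> / 8 \<le> a * (x - x0) - b * (t - t0) - b * (x - x0)\<^sup>2"
        by (simp add: power2_eq_square)
      moreover have "(x, t) \<in> ?Q" using RQ z zxt by blast
      ultimately show "\<bar>a\<bar> * \<rho> / 8 \<le> K - V z" using kink[of x t] zxt by simp
      have "\<bar>(x - x0) / \<rho>\<bar> \<le> 1/2" using x \<rho>(1) by (simp add: abs_divide field_simps)
      moreover have "\<bar>2 * (t - t0) / \<rho>\<^sup>2 - 1\<bar> \<le> 1/2"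
      proof -
        have "1/2 \<le> 2 * (t - t0) / \<rho>\<^sup>2" "2 * (t - t0) / \<rho>\<^sup>2 \<le> 3/2"
          using t \<rho>(1) by (auto simp: field_simps)
        then show ?thesis unfolding abs_le_iff by linarith
      qed
      ultimately have "A2 * A1 \<le> P \<rho> z"
        unfolding P_def zxt fst_conv snd_conv using A1 A2
        by (intro mult_mono) (auto simp: bump_weight_nonneg)
      then show "A1 * A2 / \<rho>^3 \<le> k \<rho> z"
        unfolding k_def using \<rho>(1) by (intro divide_right_mono) (auto simp: mult.commute)
      show "0 \<le> K - V z" using le[of z] RQ z by auto
      show "0 \<le> A1 * A2 / \<rho>^3" using A1 A2 \<rho> by simp
    qed
    have content: "measure lborel ?R = \<rho>^3 / 8"
      using \<rho>(1) by (simp add: content_Pair power_def numeral_eq_Suc)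
    have "c * \<rho> = \<bar>a\<bar> * \<rho> / 8 * (A1 * A2 / \<rho>^3) * measure lborel ?R"
      unfolding content c_def using \<rho>(1) by (simp add: field_simps)
    also have "\<dots> = integral ?R (\<lambda>z. \<bar>a\<bar> * \<rho> / 8 * (A1 * A2 / \<rho>^3))" by simp
    also have "\<dots> \<le> integral ?R (\<lambda>z. (K - V z) * k \<rho> z)"
      using RQ cQ by (intro integral_le pt integrable_continuous continuous_intros ck \<rho>)
        (auto intro: continuous_on_subset)
    also have "\<dots> \<le> integral ?Q (\<lambda>z. (K - V z) * k \<rho> z)"
    proof -
      have "(\<lambda>z. (K - V z) * k \<rho> z) integrable_on ?R"
        using RQ cQ by (intro integrable_continuous continuous_intros ck \<rho>)
          (auto intro: continuous_on_subset)
      moreover have "0 \<le> (K - V z) * k \<rho> z" if "z \<in> ?Q" for z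
        using le[OF that] P0 \<rho>(1) by (simp add: k_def)
      ultimately show ?thesis using RQ iVk[OF \<rho>(1)] by (intro integral_subset_le) blast+
    qed
    also have "\<dots> = K * n - M \<rho>" using def_eq[OF \<rho>(1,2)] by simp
    finally show ?thesis .
  qed
  \<comment> \<open>The last entry makes C sqrt(\<rho>) smaller than c, so that the linear lower
    bound exceeds the upper bound of order \<rho> sqrt(\<rho>).\<close>
  define \<rho> where "\<rho> = min (d / 2) (min (\<bar>a\<bar> / (16 * b + 1)) ((c / (C + 1))\<^sup>2 / 2))"
  have \<rho>: "0 < \<rho>" "\<rho> < d" "\<rho> \<le> \<bar>a\<bar> / (16 * b + 1)" "\<rho> < (c / (C + 1))\<^sup>2"
  proof -
    have "0 < (c / (C + 1))\<^sup>2" using c C0 by simp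
    moreover have "0 < \<bar>a\<bar> / (16 * b + 1)" using \<open>a \<noteq> 0\<close> \<open>0 \<le> b\<close> by simp
    ultimately show "0 < \<rho>" "\<rho> < d" "\<rho> \<le> \<bar>a\<bar> / (16 * b + 1)" "\<rho> < (c / (C + 1))\<^sup>2"
      using d unfolding \<rho>_def by linarith+
  qed
  have "(16 * b + 1) * \<rho> \<le> \<bar>a\<bar>" using \<rho>(3) \<open>0 \<le> b\<close> by (simp add: field_simps)
  then have "16 * b * \<rho> \<le> \<bar>a\<bar>" using \<rho>(1) by (simp add: algebra_simps)
  from order_trans[OF lower[OF \<rho>(1,2) this] order_trans[OF abs_ge_self upper[OF \<rho>(1,2)]]]
  have "c \<le> C * sqrt \<rho>" using \<rho>(1) by simp
  also have "C * sqrt \<rho> \<le> C * (c / (C + 1))"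
  proof (rule mult_left_mono[OF _ C0])
    show "sqrt \<rho> \<le> c / (C + 1)" using \<rho>(4) c C0 by (intro real_le_lsqrt) auto
  qed
  also have "\<dots> < c" using c C0 by (simp add: field_simps)
  finally show False by simp
qed

end

section \<open>The value function as a supersolution\<close>

text \<open>The barriers below all have the form f(x) + (h0 + h1 x)(t - \<tau>), and the touching
  inequality is evaluated once for this shape. Derivatives are required for x > 0 only, which admits
  the logarithm.\<close>

lemma barrier_touch:
  assumes S: "supersolution \<sigma> r q (cbox (x0 - \<rho>, t0 - \<rho>) (x0 + \<rho>, t0 + \<rho>)) g W"
    and "\<rho> > 0" and "r \<ge> 0" and x0: "0 < x0" "xl < x0" "x0 < xr" and "t0 < t2"
    and f: "\<And>x. x > 0 \<Longrightarrow> (f has_real_derivative f' x) (at x)"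
      "\<And>x. x > 0 \<Longrightarrow> (f' has_real_derivative f'' x) (at x)" "continuous_on {0<..} f''"
    and ge: "\<And>x t. xl \<le> x \<Longrightarrow> x \<le> xr \<Longrightarrow> t0 \<le> t \<Longrightarrow> t \<le> t2 \<Longrightarrow>
       f x + (h0 + h1 * x) * (t - \<tau>) \<le> W (x, t)"
    and eq: "W (x0, t0) = f x0 + (h0 + h1 * x0) * (t0 - \<tau>)"
  shows "g \<le> - (h0 + h1 * x0) - 1/2 * \<sigma>\<^sup>2 * x0\<^sup>2 * f'' x0
      - (r - q) * x0 * (f' x0 + h1 * (t0 - \<tau>)) + r * W (x0, t0)"
proof -
  define \<psi> where "\<psi> = (\<lambda>(x, t). f x + (h0 + h1 * x) * (t - \<tau>))"
  define \<psi>x where "\<psi>x = (\<lambda>(x, t). f' x + h1 * (t - \<tau>))"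
  define \<psi>xx where "\<psi>xx = (\<lambda>(x, t::real). f'' x)"
  define \<psi>t where "\<psi>t = (\<lambda>(x, t::real). h0 + h1 * x)"
  define \<rho>' where "\<rho>' = min (min \<rho> (x0 / 2)) (min (min (x0 - xl) (xr - x0)) (t2 - t0))"
  have \<rho>': "\<rho>' > 0" "\<rho>' \<le> \<rho>" "\<rho>' \<le> x0 / 2" "\<rho>' \<le> x0 - xl" "\<rho>' \<le> xr - x0" "\<rho>' \<le> t2 - t0"
    using assms(2) x0 \<open>t0 < t2\<close> unfolding \<rho>'_def by linarith+
  let ?Q = "cbox (x0 - \<rho>', t0) (x0 + \<rho>', t0 + \<rho>')"
  have Qpos: "x > 0" if "(x, t) \<in> ?Q" for x t using that \<rho>' x0 by (auto simp: cbox_Pair_eq)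
  have cf: "continuous_on {0<..} f" "continuous_on {0<..} f'"
    using f(1,2) by (meson DERIV_isCont continuous_at_imp_continuous_on greaterThan_iff)+
  have cQ: "continuous_on ?Q (\<lambda>z. k (fst z))" if "continuous_on {0<..} k" for k :: "real \<Rightarrow> real"
    by (rule continuous_on_compose2[OF that]) (use Qpos in \<open>auto intro!: continuous_intros\<close>)
  have C: "C21_on ?Q \<psi> \<psi>x \<psi>xx \<psi>t"
    unfolding C21_on_def
  proof (intro conjI allI impI)
    show "continuous_on ?Q \<psi>"
      unfolding \<psi>_def case_prod_unfold by (intro continuous_intros cQ cf)
    fix x t assume "(x, t) \<in> ?Q"
    then have x: "x > 0" by (rule Qpos)
    show "((\<lambda>y. \<psi> (y, t)) has_real_derivative \<psi>x (x, t)) (at x)"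
      "((\<lambda>y. \<psi>x (y, t)) has_real_derivative \<psi>xx (x, t)) (at x)"
      "((\<lambda>s. \<psi> (x, s)) has_real_derivative \<psi>t (x, t)) (at t)"
      unfolding \<psi>_def \<psi>x_def \<psi>xx_def \<psi>t_def
      by (auto intro!: derivative_eq_intros f(1)[OF x] f(2)[OF x])
  qed
  have "continuous_on ?Q (bond_operator \<sigma> r q \<psi> \<psi>x \<psi>xx \<psi>t)"
    unfolding bond_operator_def \<psi>_def \<psi>x_def \<psi>xx_def \<psi>t_def case_prod_unfold fst_conv snd_conv
    by (intro continuous_intros cQ cf f(3))
  moreover have "?Q \<subseteq> cbox (x0 - \<rho>, t0 - \<rho>) (x0 + \<rho>, t0 + \<rho>)"
    using \<rho>' by (auto simp: cbox_Pair_eq)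
  moreover have "\<psi> z \<le> W z" if "z \<in> ?Q" for z
    using that ge[of "fst z" "snd z"] \<rho>' by (cases z) (auto simp: cbox_Pair_eq \<psi>_def)
  ultimately have "g \<le> bond_operator \<sigma> r q \<psi> \<psi>x \<psi>xx \<psi>t (x0, t0)"
    using eq by (intro supersolution_touch[OF S _ \<rho>'(1) \<open>r \<ge> 0\<close> C]) (auto simp: \<psi>_def)
  then show ?thesis
    unfolding eq by (simp add: bond_operator_def \<psi>_def \<psi>x_def \<psi>xx_def \<psi>t_def)
qed

lemma sobolev_function_uminus:
  assumes "sobolev_function U V Vx Vxx Vt"
  shows "sobolev_function U (\<lambda>z. - V z) (\<lambda>z. - Vx z) (\<lambda>z. - Vxx z) (\<lambda>z. - Vt z)"
proof -
  have Lp: "Lp_loc p U (\<lambda>z. - f z)" if "Lp_loc p U f" for p f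
    using that by (auto simp: Lp_loc_def)
  have wx: "weak_partial_x U (\<lambda>z. - f z) (\<lambda>z. - g z)" if "weak_partial_x U f g" for f g
    using that by (auto simp: weak_partial_x_def)
  have wt: "weak_partial_t U (\<lambda>z. - f z) (\<lambda>z. - g z)" if "weak_partial_t U f g" for f g
    using that by (auto simp: weak_partial_t_def)
  from assms show ?thesis
    unfolding sobolev_function_def W21_loc_def using Lp wx wt by (auto intro!: continuous_intros)
qed

lemma positive_lower_bound:
  fixes A :: "real set"
  assumes "finite A" "\<forall>a\<in>A. 0 < a"
  obtains d where "0 < d" "\<forall>a\<in>A. d \<le> a"
  using that[of "Min (insert 1 A)"] assms by auto

section \<open>The bond problem and its local one-sided equations\<close>

text \<open>The data have a locale of their own: constants defined in it cannot depend on V or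
  \<open>tstar\<close>, which secures the uniformity of the final modulus and radius.\<close>

locale bond_data =
  fixes K \<gamma> T \<sigma> r q c :: real
  assumes K: "K > 0" and \<gamma>: "\<gamma> > 0" and T: "T > 0" and \<sigma>: "\<sigma> > 0" and r: "r > 0" and q: "q > 0"
    and c: "c \<ge> 0" "c < r * K" "c < q * K"
begin

definition X :: real where "X = K / \<gamma>"

lemma X: "X > 0" "\<gamma> * X = K" using K \<gamma> by (auto simp: X_def)

end

locale bond = bond_data +
  fixes V :: "real \<times> real \<Rightarrow> real"
  assumes solution: "bond_solution K \<gamma> T \<sigma> r q c V"
begin

lemma domain_iff: "(x, t) \<in> bond_domain K \<gamma> T \<longleftrightarrow> 0 < x \<and> x < X \<and> 0 < t \<and> t < T"
  by (auto simp: bond_domain_def X_def)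

lemma open_domain: "open (bond_domain K \<gamma> T)"
  unfolding bond_domain_def by (intro open_Times) auto

lemma V_right: "0 \<le> t \<Longrightarrow> t \<le> T \<Longrightarrow> V (X, t) = K"
  using solution by (auto simp: bond_solution_def X_def)

lemma V_top: "0 \<le> x \<Longrightarrow> x \<le> X \<Longrightarrow> V (x, T) = K"
  using solution by (auto simp: bond_solution_def X_def)

lemma V_bounds:
  assumes "0 < x" "x \<le> X" "0 < t" "t \<le> T"
  shows "\<gamma> * x \<le> V (x, t)" "V (x, t) \<le> K" "0 < V (x, t)"
proof -
  have "\<gamma> * x \<le> \<gamma> * X" using assms \<gamma> by simp
  moreover have "V (x, t) = K" if "x = X \<or> t = T"
    using that assms V_right[of t] V_top[of x] by auto
  moreover have "\<gamma> * x \<le> V (x, t) \<and> V (x, t) \<le> K" if "\<not> (x = X \<or> t = T)"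
  proof -
    have "(x, t) \<in> bond_domain K \<gamma> T" using that assms by (auto simp: domain_iff)
    then show ?thesis using solution unfolding bond_solution_def by blast
  qed
  ultimately show 1: "\<gamma> * x \<le> V (x, t)" "V (x, t) \<le> K"
    using X(2) by (cases "x = X \<or> t = T"; simp)+
  have "0 < \<gamma> * x" using assms \<gamma> by simp
  then show "0 < V (x, t)" using 1 by linarith
qed

lemma cont_V: "continuous_on ({0<..X} \<times> {0<..T}) V"
proof -
  have "{0<..X} \<times> {0<..T} \<subseteq> bond_domain K \<gamma> T \<union> bond_data_boundary K \<gamma> T"
    by (auto simp: bond_domain_def bond_data_boundary_def X_def)
  then show ?thesis using solution continuous_on_subset unfolding bond_solution_def by blast
qed

lemma cont_V_compose:
  assumes "continuous_on S f" "continuous_on S g"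
    and "\<And>z. z \<in> S \<Longrightarrow> 0 < f z \<and> f z \<le> X \<and> 0 < g z \<and> g z \<le> T"
  shows "continuous_on S (\<lambda>z. V (f z, g z))"
  by (rule continuous_on_compose2[OF cont_V]) (use assms in \<open>auto intro!: continuous_intros\<close>)

lemma weak_solution:
  obtains Vx Vxx Vt where "sobolev_function (bond_domain K \<gamma> T) V Vx Vxx Vt"
    "AE z in lebesgue. z \<in> bond_domain K \<gamma> T \<and> \<gamma> * fst z < V z \<and> V z < K \<longrightarrow>
           bond_operator \<sigma> r q V Vx Vxx Vt z = c"
    "AE z in lebesgue. z \<in> bond_domain K \<gamma> T \<longrightarrow> c \<le> bond_operator \<sigma> r q V Vx Vxx Vt z"
proof -
  obtain Vx Vxx Vt where *: "W21_loc (bond_domain K \<gamma> T) V Vx Vxx Vt"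
    "AE z in lebesgue. z \<in> bond_domain K \<gamma> T \<and> \<gamma> * fst z < V z \<and> V z < K \<longrightarrow>
           bond_operator \<sigma> r q V Vx Vxx Vt z = c"
    "AE z in lebesgue. z \<in> bond_domain K \<gamma> T \<longrightarrow> c \<le> bond_operator \<sigma> r q V Vx Vxx Vt z"
    using solution unfolding bond_solution_def by auto
  have "continuous_on (bond_domain K \<gamma> T) V"
    using solution continuous_on_subset unfolding bond_solution_def by blast
  with * open_domain that show ?thesis unfolding sobolev_function_def by blast
qed

lemma V_supersolution:
  assumes "0 < a" "b < X" "0 < s" "d < T"
  shows "supersolution \<sigma> r q (cbox (a, s) (b, d)) c V"
proof -
  obtain Vx Vxx Vt where *: "sobolev_function (bond_domain K \<gamma> T) V Vx Vxx Vt"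
    "AE z in lebesgue. z \<in> bond_domain K \<gamma> T \<and> \<gamma> * fst z < V z \<and> V z < K \<longrightarrow>
           bond_operator \<sigma> r q V Vx Vxx Vt z = c"
    "AE z in lebesgue. z \<in> bond_domain K \<gamma> T \<longrightarrow> c \<le> bond_operator \<sigma> r q V Vx Vxx Vt z"
    by (rule weak_solution)
  interpret sobolev_function "bond_domain K \<gamma> T" V Vx Vxx Vt by fact
  have sub: "cbox (a/2, s/2) ((b + X)/2, (d + T)/2) \<subseteq> bond_domain K \<gamma> T"
    using assms by (auto simp: cbox_Pair_eq domain_iff)
  then have "AE z in lebesgue. z \<in> cbox (a/2, s/2) ((b + X)/2, (d + T)/2) \<longrightarrow>
      c \<le> bond_operator \<sigma> r q V Vx Vxx Vt z"
    using *(3) by (auto elim!: eventually_mono)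
  from supersolution_mollify[OF sub _ _ _ _ _ this] show ?thesis using assms by auto
qed

lemma V_supersolution_at:
  assumes "0 < x0" "x0 < X" "0 < t0" "t0 < T"
  obtains \<rho> where "\<rho> > 0" "supersolution \<sigma> r q (cbox (x0 - \<rho>, t0 - \<rho>) (x0 + \<rho>, t0 + \<rho>)) c V"
proof -
  let ?A = "{x0/2, (X - x0)/2, t0/2, (T - t0)/2}"
  have "\<forall>a\<in>?A. 0 < a" using assms by auto
  then obtain \<rho> where "0 < \<rho>" "\<forall>a\<in>?A. \<rho> \<le> a" using positive_lower_bound[of ?A] by blast
  with that[of \<rho>] V_supersolution[of "x0 - \<rho>" "x0 + \<rho>" "t0 - \<rho>" "t0 + \<rho>"] assms show ?thesis by auto
qed

lemma box_in_open:
  assumes "open S" "(x0, t0) \<in> S"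
  obtains \<rho> where "\<rho> > 0" "cbox (x0 - \<rho>, t0 - \<rho>) (x0 + \<rho>, t0 + \<rho>) \<subseteq> (S :: (real \<times> real) set)"
proof -
  obtain e where e: "e > 0" "ball (x0, t0) e \<subseteq> S" using assms open_contains_ball by blast
  have "cbox (x0 - e/3, t0 - e/3) (x0 + e/3, t0 + e/3) \<subseteq> ball (x0, t0) e"
  proof
    fix z assume z: "z \<in> cbox (x0 - e/3, t0 - e/3) (x0 + e/3, t0 + e/3)"
    have "dist z (x0, t0) \<le> \<bar>fst z - x0\<bar> + \<bar>snd z - t0\<bar>"
      by (cases z) (simp add: dist_prod_def dist_real_def sqrt_sum_squares_le_sum_abs)
    also have "\<dots> < e" using z e(1) by (cases z) (auto simp: cbox_Pair_eq abs_if)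
    finally show "z \<in> ball (x0, t0) e" by (simp add: dist_commute)
  qed
  with e that[of "e/3"] show ?thesis by auto
qed

lemma open_above_obstacle: "open {z \<in> bond_domain K \<gamma> T. \<gamma> * fst z < V z}"
  and open_below_K: "open {z \<in> bond_domain K \<gamma> T. V z < K}"
proof -
  have c: "continuous_on (bond_domain K \<gamma> T) V"
    using solution continuous_on_subset unfolding bond_solution_def by blast
  have "{z \<in> bond_domain K \<gamma> T. \<gamma> * fst z < V z} =
      bond_domain K \<gamma> T \<inter> (\<lambda>z. V z - \<gamma> * fst z) -` {0<..}" by auto
  then show "open {z \<in> bond_domain K \<gamma> T. \<gamma> * fst z < V z}"
    by (simp only:) (intro continuous_open_preimage continuous_intros c open_domain open_greaterThan)
  have "{z \<in> bond_domain K \<gamma> T. V z < K} = bond_domain K \<gamma> T \<inter> V -` {..<K}" by auto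
  then show "open {z \<in> bond_domain K \<gamma> T. V z < K}"
    by (simp only:) (intro continuous_open_preimage c open_domain open_lessThan)
qed

text \<open>Both strict inequalities persist on a small box, where the equation makes -V a
  supersolution for -c. This half of the equation is what allows V to be bounded from above by
  comparison.\<close>

lemma V_solves:
  assumes z: "0 < x0" "x0 < X" "0 < t0" "t0 < T" and V: "\<gamma> * x0 < V (x0, t0)" "V (x0, t0) < K"
  obtains \<rho> where "\<rho> > 0"
    "supersolution \<sigma> r q (cbox (x0 - \<rho>, t0 - \<rho>) (x0 + \<rho>, t0 + \<rho>)) (- c) (\<lambda>z. - V z)"
proof -
  obtain Vx Vxx Vt where *: "sobolev_function (bond_domain K \<gamma> T) V Vx Vxx Vt"
    "AE z in lebesgue. z \<in> bond_domain K \<gamma> T \<and> \<gamma> * fst z < V z \<and> V z < K \<longrightarrow>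
           bond_operator \<sigma> r q V Vx Vxx Vt z = c"
    "AE z in lebesgue. z \<in> bond_domain K \<gamma> T \<longrightarrow> c \<le> bond_operator \<sigma> r q V Vx Vxx Vt z"
    by (rule weak_solution)
  interpret sobolev_function "bond_domain K \<gamma> T" "\<lambda>z. - V z" "\<lambda>z. - Vx z" "\<lambda>z. - Vxx z" "\<lambda>z. - Vt z"
    using *(1) by (rule sobolev_function_uminus)
  let ?S = "{z \<in> bond_domain K \<gamma> T. \<gamma> * fst z < V z} \<inter> {z \<in> bond_domain K \<gamma> T. V z < K}"
  have "(x0, t0) \<in> ?S" using z V by (simp add: domain_iff)
  then obtain \<rho> where \<rho>: "\<rho> > 0" "cbox (x0 - \<rho>, t0 - \<rho>) (x0 + \<rho>, t0 + \<rho>) \<subseteq> ?S"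
    using box_in_open[of ?S] open_above_obstacle open_below_K by blast
  let ?Q = "cbox (x0 - \<rho>, t0 - \<rho>) (x0 + \<rho>, t0 + \<rho>)"
  have sub: "?Q \<subseteq> bond_domain K \<gamma> T" using \<rho>(2) by blast
  have op: "bond_operator \<sigma> r q (\<lambda>z. - V z) (\<lambda>z. - Vx z) (\<lambda>z. - Vxx z) (\<lambda>z. - Vt z) z
      = - bond_operator \<sigma> r q V Vx Vxx Vt z" for z
    by (cases z) (simp add: bond_operator_def algebra_simps)
  have "AE z in lebesgue. z \<in> ?Q \<longrightarrow>
      - c \<le> bond_operator \<sigma> r q (\<lambda>z. - V z) (\<lambda>z. - Vx z) (\<lambda>z. - Vxx z) (\<lambda>z. - Vt z) z"
    using *(2) by eventually_elim (use \<rho>(2) op in auto)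
  moreover have "0 < x0 - \<rho>"
  proof -
    have "(x0 - \<rho>, t0) \<in> ?Q" using \<rho>(1) by (auto simp: cbox_Pair_eq)
    then show ?thesis using sub domain_iff by blast
  qed
  ultimately have "supersolution \<sigma> r q (cbox (x0 - \<rho>/2, t0 - \<rho>/2) (x0 + \<rho>/2, t0 + \<rho>/2)) (- c) (\<lambda>z. - V z)"
    using supersolution_mollify[OF sub, of "x0 - \<rho>/2" "x0 + \<rho>/2" "t0 - \<rho>/2" "t0 + \<rho>/2" "- c"] \<rho>(1) by auto
  with \<rho>(1) that[of "\<rho>/2"] show ?thesis by simp
qed

text \<open>The summand l V(x, t - h) only needs the inequality, which holds everywhere; the
  equation is used for V(l x, t) alone, hence the strict bounds at the dilated point. The resulting
  right-hand side (l - 1)c is nonnegative.\<close>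

lemma V_difference_supersolution:
  assumes z: "0 < x0" "x0 < X" "h < t0" "0 \<le> h" "t0 < T" and l: "1 \<le> l" "l * x0 < X"
    and V: "\<gamma> * (l * x0) < V (l * x0, t0)" "V (l * x0, t0) < K"
  obtains \<rho> where "\<rho> > 0" "supersolution \<sigma> r q (cbox (x0 - \<rho>, t0 - \<rho>) (x0 + \<rho>, t0 + \<rho>)) (l * c - c)
     (\<lambda>z. l * V (fst z, snd z - h) - V (l * fst z, snd z))"
proof -
  have "0 < l * x0" using z l by simp
  then obtain \<rho>1 where \<rho>1: "\<rho>1 > 0"
    "supersolution \<sigma> r q (cbox (l * x0 - \<rho>1, t0 - \<rho>1) (l * x0 + \<rho>1, t0 + \<rho>1)) (- c) (\<lambda>z. - V z)"
    using V_solves[OF _ l(2) _ z(5) V] z by auto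
  obtain \<rho>2 where \<rho>2: "\<rho>2 > 0"
    "supersolution \<sigma> r q (cbox (x0 - \<rho>2, t0 - h - \<rho>2) (x0 + \<rho>2, t0 - h + \<rho>2)) c V"
    using V_supersolution_at[of x0 "t0 - h"] z by auto
  define \<rho> where "\<rho> = min (\<rho>1 / l) \<rho>2"
  have \<rho>: "\<rho> > 0" "\<rho> \<le> \<rho>2" "l * \<rho> \<le> \<rho>1" "\<rho> \<le> \<rho>1"
  proof -
    show "\<rho> > 0" "\<rho> \<le> \<rho>2" using \<rho>1 \<rho>2 l by (auto simp: \<rho>_def)
    have "\<rho> \<le> \<rho>1 / l" by (simp add: \<rho>_def)
    then show "l * \<rho> \<le> \<rho>1" using l by (simp add: field_simps)
    moreover have "1 * \<rho> \<le> l * \<rho>" using l \<open>\<rho> > 0\<close> by (intro mult_right_mono) auto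
    ultimately show "\<rho> \<le> \<rho>1" by linarith
  qed
  let ?R = "cbox (x0 - \<rho>, t0 - \<rho>) (x0 + \<rho>, t0 + \<rho>)"
  have S1: "supersolution \<sigma> r q ?R (- c) (\<lambda>z. - V (l * fst z, snd z - 0))"
  proof (rule supersolution_translate[OF \<rho>1(2)])
    fix u v assume uv: "(u, v) \<in> ?R"
    then have "l * (x0 - \<rho>) \<le> l * u" "l * u \<le> l * (x0 + \<rho>)" using l by (auto simp: cbox_Pair_eq)
    then show "(l * u, v - 0) \<in> cbox (l * x0 - \<rho>1, t0 - \<rho>1) (l * x0 + \<rho>1, t0 + \<rho>1)"
      using \<rho> uv by (auto simp: cbox_Pair_eq algebra_simps)
  qed
  have "supersolution \<sigma> r q ?R c (\<lambda>z. V (1 * fst z, snd z - h))"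
    by (rule supersolution_translate[OF \<rho>2(2)]) (use \<rho> in \<open>auto simp: cbox_Pair_eq\<close>)
  then have "supersolution \<sigma> r q ?R (l * c) (\<lambda>z. l * V (1 * fst z, snd z - h))"
    using l by (intro supersolution_scale) auto
  from supersolution_add[OF this S1] \<rho>(1) that[of \<rho>] show ?thesis by simp
qed

lemma V_no_kink:
  assumes z: "0 < x0" "x0 < X" "0 < t0" "t0 < T" and top: "V (x0, t0) = K" and "0 \<le> b"
    and nbd: "xl < x0" "x0 < xr" "t0 < t2"
    and kink: "\<And>x t. xl \<le> x \<Longrightarrow> x \<le> xr \<Longrightarrow> t0 \<le> t \<Longrightarrow> t \<le> t2 \<Longrightarrow>
       V (x, t) \<le> K - (a * (x - x0) - b * (t - t0) - b * (x - x0)\<^sup>2)"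
  shows "a = 0"
proof -
  obtain Vx Vxx Vt where *: "sobolev_function (bond_domain K \<gamma> T) V Vx Vxx Vt"
    "AE z in lebesgue. z \<in> bond_domain K \<gamma> T \<and> \<gamma> * fst z < V z \<and> V z < K \<longrightarrow>
           bond_operator \<sigma> r q V Vx Vxx Vt z = c"
    "AE z in lebesgue. z \<in> bond_domain K \<gamma> T \<longrightarrow> c \<le> bond_operator \<sigma> r q V Vx Vxx Vt z"
    by (rule weak_solution)
  interpret sobolev_function "bond_domain K \<gamma> T" V Vx Vxx Vt by fact
  have "\<forall>a\<in>{1, x0/2, (X - x0)/2, (T - t0)/2, x0 - xl, xr - x0, t2 - t0}. 0 < a"
    using z nbd by auto
  then obtain d where "0 < d" "\<forall>a\<in>{1, x0/2, (X - x0)/2, (T - t0)/2, x0 - xl, xr - x0, t2 - t0}. d \<le> a"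
    using positive_lower_bound by (metis finite.emptyI finite.insertI)
  then have d: "0 < d" "d \<le> 1" "d \<le> x0/2" "d \<le> (X - x0)/2" "d \<le> (T - t0)/2" "d \<le> x0 - xl"
    "d \<le> xr - x0" "d \<le> t2 - t0"
    by auto
  let ?Q = "cbox (x0 - d, t0) (x0 + d, t0 + d)"
  have sub: "?Q \<subseteq> bond_domain K \<gamma> T" using z d by (auto simp: cbox_Pair_eq domain_iff)
  show ?thesis
  proof (rule no_kink_at_maximum[OF sub d(1,2) _ top \<open>0 \<le> b\<close>])
    fix z assume "z \<in> ?Q"
    then have "z \<in> bond_domain K \<gamma> T" using sub by blast
    then show "V z \<le> K" using V_bounds(2)[of "fst z" "snd z"] by (cases z) (auto simp: domain_iff)
  next
    fix x t assume "(x, t) \<in> ?Q"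
    then show "V (x, t) \<le> K - (a * (x - x0) - b * (t - t0) - b * (x - x0)\<^sup>2)"
      using d by (intro kink) (auto simp: cbox_Pair_eq)
  qed
qed

end

section \<open>The strong maximum principle\<close>

context bond
begin

text \<open>Because \<open>\<L>K = rK > c\<close>, a small multiple of an expanding parabola is a strict subsolution for
  \<open>K - V\<close> where it is positive; a first contact at level \<open>0\<close> would be a kink.\<close>

lemma K_spreads_locally:
  assumes z0: "0 < x0" "x0 < X" "0 < t0" "t0 < T" and top: "V (x0, t0) = K"
  obtains \<delta> where "\<delta> > 0"
    "\<And>x t. \<bar>x - x0\<bar> < \<delta> \<Longrightarrow> t0 < t \<Longrightarrow> t < t0 + \<delta> \<Longrightarrow> V (x, t) = K"
proof -
  have "\<gamma> * x0 < \<gamma> * X" using z0 \<gamma> by simp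
  then have "(x0, t0) \<in> {z \<in> bond_domain K \<gamma> T. \<gamma> * fst z < V z}"
    using z0 top X by (simp add: domain_iff)
  then obtain \<delta>0 where \<delta>0: "\<delta>0 > 0"
    "cbox (x0 - \<delta>0, t0 - \<delta>0) (x0 + \<delta>0, t0 + \<delta>0) \<subseteq> {z \<in> bond_domain K \<gamma> T. \<gamma> * fst z < V z}"
    using box_in_open[OF open_above_obstacle] by blast
  have box: "0 < x \<and> x < X \<and> 0 < t \<and> t < T \<and> \<gamma> * x < V (x, t)"
    if "\<bar>x - x0\<bar> \<le> \<delta>0" "\<bar>t - t0\<bar> \<le> \<delta>0" for x t
  proof -
    have "(x, t) \<in> cbox (x0 - \<delta>0, t0 - \<delta>0) (x0 + \<delta>0, t0 + \<delta>0)"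
      using that by (auto simp: cbox_Pair_eq abs_le_iff)
    from subsetD[OF \<delta>0(2) this] show ?thesis by (simp add: domain_iff)
  qed
  define \<delta> where "\<delta> = \<delta>0 / 4"
  have \<delta>: "\<delta> > 0" "\<delta>0 = 4 * \<delta>" using \<delta>0 by (auto simp: \<delta>_def)
  have "V (x1, t1) = K" if x1: "\<bar>x1 - x0\<bar> < \<delta>" and t1: "t0 < t1" "t1 < t0 + \<delta>" for x1 t1
  proof (rule ccontr)
    assume "V (x1, t1) \<noteq> K"
    have z1: "0 < x1" "x1 < X" "0 < t1" "t1 < T" using box[of x1 t1] x1 t1 \<delta> by auto
    have "(x1, t1) \<in> {z \<in> bond_domain K \<gamma> T. V z < K}"
      using \<open>V (x1, t1) \<noteq> K\<close> V_bounds(2)[of x1 t1] z1 by (auto simp: domain_iff)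
    then obtain \<rho>0 where \<rho>0: "\<rho>0 > 0"
      "cbox (x1 - \<rho>0, t1 - \<rho>0) (x1 + \<rho>0, t1 + \<rho>0) \<subseteq> {z \<in> bond_domain K \<gamma> T. V z < K}"
      using box_in_open[OF open_below_K] by blast
    define \<rho> where "\<rho> = min \<rho>0 \<delta>"
    have \<rho>: "\<rho> > 0" "\<rho> \<le> \<rho>0" "\<rho> \<le> \<delta>" using \<rho>0(1) \<delta>(1) by (auto simp: \<rho>_def)
    have below: "V (x, t1) < K" if "\<bar>x - x1\<bar> \<le> \<rho>" for x
    proof -
      have "(x, t1) \<in> cbox (x1 - \<rho>0, t1 - \<rho>0) (x1 + \<rho>0, t1 + \<rho>0)"
        using that \<rho> by (auto simp: cbox_Pair_eq abs_le_iff)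
      then show ?thesis using \<rho>0(2) by blast
    qed
    have "continuous_on {x1 - \<rho>..x1 + \<rho>} (\<lambda>x. V (x, t1))"
    proof (intro cont_V_compose continuous_intros)
      fix x assume "x \<in> {x1 - \<rho>..x1 + \<rho>}"
      then have "\<bar>x - x0\<bar> \<le> \<delta>0" using x1 \<rho> \<delta> by (auto simp: abs_le_iff abs_less_iff)
      from box[OF this, of t1] t1 \<delta> show "0 < x \<and> x \<le> X \<and> 0 < t1 \<and> t1 \<le> T" by auto
    qed
    then obtain xm where xm: "xm \<in> {x1 - \<rho>..x1 + \<rho>}" "\<forall>x\<in>{x1 - \<rho>..x1 + \<rho>}. V (x, t1) \<le> V (xm, t1)"
      using continuous_attains_sup[of "{x1 - \<rho>..x1 + \<rho>}" "\<lambda>x. V (x, t1)"] \<rho>(1) by auto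
    define m where "m = K - V (xm, t1)"
    have m: "m > 0" using below[of xm] xm(1) by (auto simp: m_def abs_le_iff)
    have w_m: "V (x, t1) \<le> K - m" if "\<bar>x - x1\<bar> \<le> \<rho>" for x
      using xm(2) that by (auto simp: m_def abs_le_iff)
    \<comment> \<open>The parabola is centred at x1. At time t1 it is positive exactly for |x - x1|
      < \<rho>, and N lets it spread backward fast enough that \<phi>(x0, t0) = \<eta>\<rho>^2 > 0.
      Comparison will then contradict V(x0, t0) = K.\<close>
    define N where "N = (x0 - x1)\<^sup>2 / (t1 - t0)"
    have N: "N \<ge> 0" "N * (t1 - t0) = (x0 - x1)\<^sup>2" using t1 by (auto simp: N_def)
    \<comment> \<open>On the box, C - 1 is an upper bound for the operator applied to
      \<phi>/\<eta>.\<close>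
    define C where "C = N + \<sigma>\<^sup>2 * X\<^sup>2 + 2 * \<bar>r - q\<bar> * X\<^sup>2 + r * (\<rho>\<^sup>2 + (x0 - x1)\<^sup>2) + 1"
    have C: "C > 0" unfolding C_def using N r
      by (intro add_nonneg_pos add_nonneg_nonneg mult_nonneg_nonneg) auto
    \<comment> \<open>Small in two respects: the parabola stays below the gap m on the slice t1, and
      \<eta>C < rK - c makes \<phi> a strict subsolution for K - V.\<close>
    define \<eta> where "\<eta> = min (m / (\<rho>\<^sup>2 + 1)) ((r * K - c) / C) / 2"
    have "0 < m / (\<rho>\<^sup>2 + 1)" "0 < (r * K - c) / C" using m C c by (auto simp: add_nonneg_pos)
    moreover have "0 < min u v / 2 \<and> min u v / 2 < u \<and> min u v / 2 < v" if "0 < u" "0 < v" for u v :: real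
      using that by linarith
    ultimately have \<eta>: "\<eta> > 0" "\<eta> < m / (\<rho>\<^sup>2 + 1)" "\<eta> < (r * K - c) / C" unfolding \<eta>_def by blast+
    have \<eta>m: "\<eta> * \<rho>\<^sup>2 < m"
    proof -
      have "\<eta> * (\<rho>\<^sup>2 + 1) < m" using \<eta>(2) by (simp add: pos_less_divide_eq add_nonneg_pos)
      then show ?thesis using \<eta>(1) by (simp add: algebra_simps)
    qed
    have \<eta>C: "\<eta> * C < r * K - c" using \<eta>(3) C by (simp add: pos_less_divide_eq)
    define \<phi> where "\<phi> x t = \<eta> * (\<rho>\<^sup>2 + N * (t1 - t) - (x - x1)\<^sup>2)" for x t
    have small: "(x0 - x1)\<^sup>2 \<le> \<delta>\<^sup>2" using x1 \<delta>(1) by (intro power2_le_iff_abs_le[THEN iffD2]) (auto simp: abs_minus_commute)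
    have \<rho>\<delta>: "\<rho>\<^sup>2 \<le> \<delta>\<^sup>2" using \<rho> by (intro power_mono) auto
    have \<phi>_side: "\<phi> x t < 0" if "\<bar>x - x1\<bar> = 2 * \<delta>" "t0 \<le> t" for x t
    proof -
      have "N * (t1 - t) \<le> N * (t1 - t0)" using N(1) that by (intro mult_left_mono) auto
      moreover have "(x - x1)\<^sup>2 = 4 * \<delta>\<^sup>2" using that(1) by (metis power2_abs power_mult_distrib four_x_squared)
      moreover have "0 < \<delta>\<^sup>2" using \<delta>(1) by simp
      ultimately have "\<rho>\<^sup>2 + N * (t1 - t) - (x - x1)\<^sup>2 < 0" using N(2) small \<rho>\<delta> by linarith
      then show ?thesis unfolding \<phi>_def using \<eta>(1) by (simp add: mult_pos_neg)
    qed
    let ?xl = "x1 - 2 * \<delta>" and ?xr = "x1 + 2 * \<delta>"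
    have in_box: "0 < x \<and> x < X \<and> 0 < t \<and> t < T \<and> \<gamma> * x < V (x, t) \<and> V (x, t) \<le> K"
      if "?xl \<le> x" "x \<le> ?xr" "t0 \<le> t" "t \<le> t1" for x t
    proof -
      have "\<bar>x - x0\<bar> \<le> \<delta>0" "\<bar>t - t0\<bar> \<le> \<delta>0" using that x1 t1 \<delta> by (auto simp: abs_le_iff abs_less_iff)
      from box[OF this] V_bounds(2)[of x t] show ?thesis by auto
    qed
    have "0 < K - V (x0, t0) - \<phi> x0 t0"
    proof (rule positive_unless_touching[of ?xl t0 ?xr t1 "\<lambda>(x, t). K - V (x, t) - \<phi> x t" x0 t0, simplified prod.case])
      show "continuous_on (cbox (?xl, t0) (?xr, t1)) (\<lambda>(x, t). K - V (x, t) - \<phi> x t)"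
        unfolding \<phi>_def case_prod_unfold
      proof (intro continuous_intros cont_V_compose)
        fix z assume "z \<in> cbox (?xl, t0) (?xr, t1)"
        then show "0 < fst z \<and> fst z \<le> X \<and> 0 < snd z \<and> snd z \<le> T"
          using in_box[of "fst z" "snd z"] by (cases z) (auto simp: cbox_Pair_eq)
      qed
    next
      fix x assume x: "?xl \<le> x" "x \<le> ?xr"
      show "0 < K - V (x, t1) - \<phi> x t1"
      proof (cases "\<bar>x - x1\<bar> \<le> \<rho>")
        case True
        have "\<phi> x t1 \<le> \<eta> * \<rho>\<^sup>2" unfolding \<phi>_def using \<eta>(1) by (intro mult_left_mono) auto
        with w_m[OF True] \<eta>m show ?thesis by linarith
      next
        case False
        then have "\<rho>\<^sup>2 < (x - x1)\<^sup>2" using \<rho>(1)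
          by (metis abs_of_pos abs_le_square_iff not_le)
        then have "\<phi> x t1 < 0" unfolding \<phi>_def using \<eta>(1) by (simp add: mult_pos_neg)
        then show ?thesis using in_box[OF x, of t1] t1 by force
      qed
    next
      fix t assume t: "t0 \<le> t" "t \<le> t1"
      show "0 < K - V (?xl, t) - \<phi> ?xl t" "0 < K - V (?xr, t) - \<phi> ?xr t"
        using \<phi>_side[of ?xl t] \<phi>_side[of ?xr t] in_box[of ?xl t] in_box[of ?xr t] t \<delta>(1) by auto
    next
      fix y s assume y: "?xl < y" "y < ?xr" and s: "t0 \<le> s" "s < t1"
        and eq: "K - V (y, s) - \<phi> y s = 0"
        and ge: "\<And>x t. ?xl \<le> x \<Longrightarrow> x \<le> ?xr \<Longrightarrow> s \<le> t \<Longrightarrow> t \<le> t1 \<Longrightarrow> 0 \<le> K - V (x, t) - \<phi> x t"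
      have ys: "0 < y" "y < X" "0 < s" "s < T" "\<gamma> * y < V (y, s)" "V (y, s) \<le> K"
        using in_box[of y s] y s by auto
      show False
      proof (cases "V (y, s) = K")
        case False
        then have "V (y, s) < K" using ys by simp
        then obtain \<rho>1 where \<rho>1: "\<rho>1 > 0"
          "supersolution \<sigma> r q (cbox (y - \<rho>1, s - \<rho>1) (y + \<rho>1, s + \<rho>1)) (- c) (\<lambda>z. - V z)"
          using V_solves ys by metis
        have "- c \<le> - ((- \<eta> * N) + 0 * y) - 1/2 * \<sigma>\<^sup>2 * y\<^sup>2 * (- 2 * \<eta>)
          - (r - q) * y * ((- 2 * \<eta> * (y - x1)) + 0 * (s - t1)) + r * (- V (y, s))"
        proof (rule barrier_touch[OF \<rho>1(2,1) _ ys(1) y s(2),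
              where f = "\<lambda>x. \<eta> * (\<rho>\<^sup>2 - (x - x1)\<^sup>2) - K" and f' = "\<lambda>x. - 2 * \<eta> * (x - x1)" and f'' = "\<lambda>x. - 2 * \<eta>"])
          show "((\<lambda>x. \<eta> * (\<rho>\<^sup>2 - (x - x1)\<^sup>2) - K) has_real_derivative - 2 * \<eta> * (x - x1)) (at x)" for x
            by (auto intro!: derivative_eq_intros simp: algebra_simps)
          show "((\<lambda>x. - 2 * \<eta> * (x - x1)) has_real_derivative - 2 * \<eta>) (at x)" for x
            by (auto intro!: derivative_eq_intros)
          show "\<eta> * (\<rho>\<^sup>2 - (x - x1)\<^sup>2) - K + (- \<eta> * N + 0 * x) * (t - t1) \<le> - V (x, t)"
            if "?xl \<le> x" "x \<le> ?xr" "s \<le> t" "t \<le> t1" for x t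
            using ge[OF that] by (simp add: \<phi>_def algebra_simps)
          show "- V (y, s) = \<eta> * (\<rho>\<^sup>2 - (y - x1)\<^sup>2) - K + (- \<eta> * N + 0 * y) * (s - t1)"
            using eq by (simp add: \<phi>_def algebra_simps)
        qed (use r in \<open>auto intro!: continuous_intros\<close>)
        also have "\<dots> = \<eta> * (N + \<sigma>\<^sup>2 * y\<^sup>2 + 2 * ((r - q) * y * (y - x1))) + r * \<phi> y s - r * K"
        proof -
          have V: "V (y, s) = K - \<phi> y s" using eq by simp
          show ?thesis unfolding V by (simp add: algebra_simps)
        qed
        also have "\<phi> y s \<le> \<eta> * (\<rho>\<^sup>2 + (x0 - x1)\<^sup>2)"
        proof -
          have "N * (t1 - s) \<le> N * (t1 - t0)" using N(1) s by (intro mult_left_mono) auto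
          moreover have "0 \<le> (y - x1)\<^sup>2" by simp
          ultimately have "\<rho>\<^sup>2 + N * (t1 - s) - (y - x1)\<^sup>2 \<le> \<rho>\<^sup>2 + (x0 - x1)\<^sup>2"
            using N(2) by linarith
          then show ?thesis unfolding \<phi>_def using \<eta>(1) by (intro mult_left_mono) auto
        qed
        also have "(r - q) * y * (y - x1) \<le> \<bar>r - q\<bar> * X\<^sup>2"
        proof -
          have "\<bar>(r - q) * y * (y - x1)\<bar> \<le> \<bar>r - q\<bar> * X * X"
            unfolding abs_mult using ys z1 by (intro mult_mono) auto
          then show ?thesis by (simp add: power2_eq_square)
        qed
        also have "\<sigma>\<^sup>2 * y\<^sup>2 \<le> \<sigma>\<^sup>2 * X\<^sup>2" using ys by (intro mult_left_mono power_mono) auto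
        finally have "- c \<le> \<eta> * (C - 1) - r * K"
          using \<eta>(1) r by (simp add: C_def algebra_simps)
        with \<eta>C \<eta>(1) show False by (simp add: algebra_simps)
      next
        case True
        then have \<phi>0: "\<phi> y s = 0" using eq by simp
        \<comment> \<open>A contact with V = K has \<phi> = 0. The exact expansion of \<phi> around
          (y, s) bounds V by a function with slope \<open>a\<close>, which \<open>V_no_kink\<close>
          forces to vanish; then y is the centre x1, where \<phi> > 0.\<close>
        define a where "a = - 2 * \<eta> * (y - x1)"
        define b where "b = \<eta> * (N + 1)"
        have b: "b \<ge> 0" using \<eta> N by (simp add: b_def)
        have "a = 0"
        proof (rule V_no_kink[OF ys(1-4) True b y s(2)])
          fix x t assume xt: "?xl \<le> x" "x \<le> ?xr" "s \<le> t" "t \<le> t1"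
          have "\<phi> x t = \<phi> y s + a * (x - y) - \<eta> * N * (t - s) - \<eta> * (x - y)\<^sup>2"
            unfolding \<phi>_def a_def by (simp add: algebra_simps power2_eq_square)
          moreover have "\<eta> * N * (t - s) \<le> b * (t - s)"
            using xt \<eta>(1) by (intro mult_right_mono) (auto simp: b_def algebra_simps)
          moreover have "\<eta> * (x - y)\<^sup>2 \<le> b * (x - y)\<^sup>2"
            using \<eta>(1) N(1) by (intro mult_right_mono) (auto simp: b_def algebra_simps)
          ultimately show "V (x, t) \<le> K - (a * (x - y) - b * (t - s) - b * (x - y)\<^sup>2)"
            using ge[OF xt] \<phi>0 by linarith
        qed
        then have "y = x1" using \<eta>(1) by (simp add: a_def)
        then have "\<phi> y s = \<eta> * (\<rho>\<^sup>2 + N * (t1 - s))" by (simp add: \<phi>_def)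
        moreover have "0 < \<eta> * (\<rho>\<^sup>2 + N * (t1 - s))"
          using \<eta>(1) \<rho>(1) N(1) s by (intro mult_pos_pos add_pos_nonneg) auto
        ultimately show False using \<phi>0 by linarith
      qed
    qed (use x1 t1 in \<open>auto simp: abs_less_iff\<close>)
    moreover have "\<phi> x0 t0 = \<eta> * \<rho>\<^sup>2" unfolding \<phi>_def N(2) by simp
    moreover have "0 \<le> \<eta> * \<rho>\<^sup>2" using \<eta>(1) by simp
    ultimately show False using top by simp
  qed
  with that \<delta>(1) show ?thesis by blast
qed

text \<open>Continuity in time adds the initial slice t = t0, which the continuation along a fixed
  time level in \<open>K_spreads\<close> needs.\<close>

lemma K_neighbourhood:
  assumes z0: "0 < x0" "x0 < X" "0 < t0" "t0 < T" and top: "V (x0, t0) = K"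
  obtains \<delta> where "\<delta> > 0"
    "\<And>x t. \<bar>x - x0\<bar> < \<delta> \<Longrightarrow> t0 \<le> t \<Longrightarrow> t < t0 + \<delta> \<Longrightarrow> V (x, t) = K"
proof -
  obtain \<delta> where \<delta>: "\<delta> > 0"
    "\<And>x t. \<bar>x - x0\<bar> < \<delta> \<Longrightarrow> t0 < t \<Longrightarrow> t < t0 + \<delta> \<Longrightarrow> V (x, t) = K"
    using K_spreads_locally[OF assms] by blast
  define \<delta>' where "\<delta>' = min (min \<delta> (T - t0)) (min x0 (X - x0))"
  have \<delta>': "\<delta>' > 0" "\<delta>' \<le> \<delta>" "\<delta>' \<le> T - t0" "\<delta>' \<le> x0" "\<delta>' \<le> X - x0"
    using \<delta>(1) z0 unfolding \<delta>'_def by linarith+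
  have "V (x, t0) = K" if x: "\<bar>x - x0\<bar> < \<delta>'" for x
  proof -
    have "continuous_on {t0..t0 + \<delta>'/2} (\<lambda>t. V (x, t))"
      using x \<delta>' z0 by (intro cont_V_compose continuous_intros) auto
    then have "((\<lambda>t. V (x, t)) \<longlongrightarrow> V (x, t0)) (at t0 within {t0..t0 + \<delta>'/2})"
      unfolding continuous_on_def using \<delta>' by simp
    then have "((\<lambda>t. V (x, t)) \<longlongrightarrow> V (x, t0)) (at_right t0)"
      using \<delta>' at_within_Icc_at_right[of t0 "t0 + \<delta>'/2"] by simp
    moreover have "eventually (\<lambda>t. V (x, t) = K) (at_right t0)"
      unfolding eventually_at_right[OF less_add_same_cancel1[THEN iffD2, OF \<delta>'(1)]]
      using x \<delta>' by (intro exI[of _ "t0 + \<delta>'"]) (auto intro!: \<delta>(2))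
    ultimately have "((\<lambda>t. K) \<longlongrightarrow> V (x, t0)) (at_right t0)"
      by (rule Lim_transform_eventually)
    then show ?thesis by (simp add: tendsto_const_iff)
  qed
  with \<delta> \<delta>' that[of \<delta>'] show ?thesis
    by (metis less_le_trans order_less_le add_left_mono)
qed

text \<open>Continuation along the segment from x0 to x at time t0, then forward in time at fixed x.
  In both cases the closed set where V = K has an extremal point, nearest to the target or latest,
  and \<open>K_neighbourhood\<close> reaches beyond it.\<close>

lemma K_spreads:
  assumes z0: "0 < x0" "x0 < X" "0 < t0" "t0 < T" and top: "V (x0, t0) = K"
    and x: "0 < x" "x < X" and t: "t0 \<le> t" "t < T"
  shows "V (x, t) = K"
proof -
  have time: "V (y, t) = K" if y: "0 < y" "y < X" "V (y, t0) = K" for y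
  proof (rule ccontr)
    assume ne: "V (y, t) \<noteq> K"
    define S where "S = {s \<in> {t0..t}. V (y, s) = K}"
    have "continuous_on {t0..t} (\<lambda>s. V (y, s))"
      using y z0 t by (intro cont_V_compose continuous_intros) auto
    then have "closed S" unfolding S_def
      by (intro continuous_closed_preimage_constant) auto
    moreover have "bounded S" by (rule bounded_subset[of "{t0..t}"]) (auto simp: S_def)
    ultimately have "compact S" by (simp add: compact_eq_bounded_closed)
    moreover have "t0 \<in> S" using y t by (simp add: S_def)
    ultimately obtain s where s: "s \<in> S" "\<forall>u\<in>S. u \<le> s" using compact_attains_sup[of S] by blast
    then have "s < t" using ne by (auto simp: S_def order_less_le)
    have sK: "V (y, s) = K" "t0 \<le> s" using s(1) by (auto simp: S_def)
    then obtain \<delta> where \<delta>: "\<delta> > 0" "\<And>x u. \<bar>x - y\<bar> < \<delta> \<Longrightarrow> s \<le> u \<Longrightarrow> u < s + \<delta> \<Longrightarrow> V (x, u) = K"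
      using K_neighbourhood[of y s] y z0 t \<open>s < t\<close> by auto
    define u where "u = min t (s + \<delta> / 2)"
    have "s < u" "u \<le> t" "u < s + \<delta>" using \<delta>(1) \<open>s < t\<close> by (auto simp: u_def)
    then have "u \<in> S" using \<delta>(2)[of y u] \<delta>(1) sK by (auto simp: S_def)
    then show False using s(2) \<open>s < u\<close> by force
  qed
  have slice: "V (x, t0) = K"
  proof (rule ccontr)
    assume ne: "V (x, t0) \<noteq> K"
    define S where "S = {y \<in> closed_segment x0 x. V (y, t0) = K}"
    have seg: "0 < y \<and> y < X" if "y \<in> closed_segment x0 x" for y
      using that x z0 by (auto simp: closed_segment_eq_real_ivl split: if_splits)
    have "continuous_on (closed_segment x0 x) (\<lambda>y. V (y, t0))"
      using seg z0 by (intro cont_V_compose continuous_intros) (auto simp: less_imp_le)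
    then have "closed S" unfolding S_def
      by (intro continuous_closed_preimage_constant) auto
    moreover have "bounded S" by (rule bounded_subset[OF bounded_closed_segment[of x0 x]]) (auto simp: S_def)
    ultimately have "compact S" by (simp add: compact_eq_bounded_closed)
    moreover have "x0 \<in> S" using top by (simp add: S_def)
    moreover have "continuous_on S (dist x)" by (intro continuous_intros)
    ultimately obtain y where y: "y \<in> S" "\<forall>u\<in>S. dist x y \<le> dist x u"
      using continuous_attains_inf[of S "dist x"] by blast
    have yK: "V (y, t0) = K" "y \<in> closed_segment x0 x" using y(1) by (auto simp: S_def)
    have "y \<noteq> x" using ne yK by auto
    obtain \<delta> where \<delta>: "\<delta> > 0" "\<And>u s. \<bar>u - y\<bar> < \<delta> \<Longrightarrow> t0 \<le> s \<Longrightarrow> s < t0 + \<delta> \<Longrightarrow> V (u, s) = K"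
      using K_neighbourhood[of y t0] seg[OF yK(2)] yK z0 by blast
    define u where "u = (if y < x then min x (y + \<delta>/2) else max x (y - \<delta>/2))"
    have "\<bar>u - y\<bar> < \<delta>" "dist x u < dist x y" "u \<in> closed_segment x0 x"
      using \<delta>(1) \<open>y \<noteq> x\<close> yK(2) unfolding u_def
      by (auto simp: dist_real_def closed_segment_eq_real_ivl abs_if min_def max_def split: if_splits)
    moreover from this have "u \<in> S" using \<delta>(2)[of u t0] \<delta>(1) by (simp add: S_def)
    ultimately show False using y(2) by force
  qed
  show ?thesis by (rule time[OF x slice])
qed

end

section \<open>Shifts and dilations\<close>

context bond_data
begin

text \<open>The added 1 keeps the bound positive when r = q, so that it may be divided by.\<close>

definition drift_bound :: real where "drift_bound = \<bar>r - q\<bar> + 1"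

text \<open>A rate for which ln x + \<open>log_rate\<close> t is a subsolution of the operator
  without its zero-order term.\<close>

definition log_rate :: real where "log_rate = \<sigma>\<^sup>2 / 2 + drift_bound"

lemma drift: "\<bar>r - q\<bar> \<le> drift_bound" "0 < drift_bound" "0 < log_rate"
  by (auto simp: drift_bound_def log_rate_def add_pos_nonneg add_nonneg_pos)

end

lemma le_if_le_add_eps:
  fixes a b M :: real
  assumes "\<And>\<epsilon>. \<epsilon> > 0 \<Longrightarrow> a \<le> b + \<epsilon> * M" "M > 0"
  shows "a \<le> b"
proof (rule field_le_epsilon)
  fix e :: real assume "e > 0"
  then show "a \<le> b + e" using assms(1)[of "e / M"] assms(2) by simp
qed

context bond
begin

text \<open>The logarithm in the barrier compensates for the missing boundary condition at \<open>x = 0\<close>.\<close>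

lemma drop_from_slice:
  assumes \<tau>: "0 < \<tau>" "\<tau> \<le> T" and slice: "\<And>x. 0 < x \<Longrightarrow> x < X \<Longrightarrow> V (x, \<tau>) = K"
    and x: "0 < x" "x \<le> X" and t: "0 < t" "t \<le> \<tau>"
  shows "K - r * K * (\<tau> - t) \<le> V (x, t)"
proof (rule le_if_le_add_eps)
  let ?M = "1 + log_rate * (\<tau> - t) + ln (X / x)"
  have "0 \<le> ln (X / x)" using x by simp
  then show "?M > 0" using drift(3) t by (simp add: add_pos_nonneg)
  fix \<epsilon> :: real assume \<epsilon>: "\<epsilon> > 0"
  \<comment> \<open>At this abscissa the logarithmic penalty alone is at least K, so positivity of V
    suffices on the left side of the box.\<close>
  define xl where "xl = min x (X * exp (- K / \<epsilon>))"
  have xl: "0 < xl" "xl \<le> x" "xl \<le> X" using x X by (auto simp: xl_def)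
  have "xl \<le> X * exp (- K / \<epsilon>)" by (simp add: xl_def)
  then have "ln xl \<le> ln (X * exp (- K / \<epsilon>))" using xl by simp
  then have "K / \<epsilon> \<le> ln X - ln xl" using X by (simp add: ln_mult)
  then have lnxl: "K \<le> \<epsilon> * (ln X - ln xl)" using \<epsilon> by (simp add: field_simps)
  define f where "f = (\<lambda>(y, s). V (y, s) - (K - r * K * (\<tau> - s) - \<epsilon> * (1 + log_rate * (\<tau> - s) + (ln X - ln y))))"
  have cK: "\<gamma> * y \<le> V (y, s)" "V (y, s) \<le> K" "0 < V (y, s)" if "xl \<le> y" "y \<le> X" "t \<le> s" "s \<le> \<tau>" for y s
    using V_bounds[of y s] that xl t \<tau> by auto
  have lnp: "0 \<le> ln X - ln y" if "xl \<le> y" "y \<le> X" for y using that xl X by simp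
  have pos: "0 \<le> r * K * (\<tau> - s)" "0 \<le> log_rate * (\<tau> - s)" if "s \<le> \<tau>" for s
    using that r K drift(3) by auto
  have "0 < f (x, t)"
  proof (rule positive_unless_touching[of xl t X \<tau> f])
    show "continuous_on (cbox (xl, t) (X, \<tau>)) f"
      unfolding f_def case_prod_unfold
    proof (intro continuous_intros cont_V_compose)
      fix z assume "z \<in> cbox (xl, t) (X, \<tau>)"
      then show "0 < fst z \<and> fst z \<le> X \<and> 0 < snd z \<and> snd z \<le> T"
        using xl t \<tau> by (cases z) (auto simp: cbox_Pair_eq)
    next
      show "\<forall>z\<in>cbox (xl, t) (X, \<tau>). fst z \<noteq> 0" using xl by (auto simp: cbox_Pair_eq)
    qed
  next
    fix y assume y: "xl \<le> y" "y \<le> X"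
    have "V (y, \<tau>) = K" using slice[of y] V_right[of \<tau>] y xl \<tau> by (cases "y = X") auto
    moreover have "0 < \<epsilon> * (1 + (ln X - ln y))" using \<epsilon> lnp[OF y] by simp
    ultimately show "f (y, \<tau>) > 0" by (simp add: f_def)
  next
    fix s assume s: "t \<le> s" "s \<le> \<tau>"
    have "0 < \<epsilon> * (1 + log_rate * (\<tau> - s))" using \<epsilon> pos(2)[OF s(2)] by (simp add: add_pos_nonneg)
    then show "f (X, s) > 0" using V_right[of s] s t \<tau> pos(1)[OF s(2)] by (simp add: f_def)
    have "\<epsilon> * (1 + log_rate * (\<tau> - s) + (ln X - ln xl)) = \<epsilon> * (1 + log_rate * (\<tau> - s)) + \<epsilon> * (ln X - ln xl)"
      by (simp add: algebra_simps)
    then show "f (xl, s) > 0"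
      using lnxl cK(3)[of xl s] xl s pos(1)[OF s(2)] \<open>0 < \<epsilon> * (1 + log_rate * (\<tau> - s))\<close>
      by (simp add: f_def)
  next
    fix y s assume y: "xl < y" "y < X" and s: "t \<le> s" "s < \<tau>" and eq: "f (y, s) = 0"
      and ge: "\<And>y' s'. xl \<le> y' \<Longrightarrow> y' \<le> X \<Longrightarrow> s \<le> s' \<Longrightarrow> s' \<le> \<tau> \<Longrightarrow> 0 \<le> f (y', s')"
    have ys: "0 < y" "0 < s" "s < T" using y s xl t \<tau> by auto
    obtain \<rho> where \<rho>: "\<rho> > 0" "supersolution \<sigma> r q (cbox (y - \<rho>, s - \<rho>) (y + \<rho>, s + \<rho>)) c V"
      using V_supersolution_at ys(1) y(2) ys(2,3) by blast
    have "c \<le> - (r * K + \<epsilon> * log_rate + 0 * y) - 1/2 * \<sigma>\<^sup>2 * y\<^sup>2 * (- \<epsilon> / y\<^sup>2)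
      - (r - q) * y * (\<epsilon> / y + 0 * (s - \<tau>)) + r * V (y, s)"
    proof (rule barrier_touch[OF \<rho>(2,1) _ ys(1) y s(2),
          where f = "\<lambda>y. K - \<epsilon> * (1 + (ln X - ln y))" and f' = "\<lambda>y. \<epsilon> / y" and f'' = "\<lambda>y. - \<epsilon> / y\<^sup>2"])
      show "((\<lambda>y. K - \<epsilon> * (1 + (ln X - ln y))) has_real_derivative \<epsilon> / y) (at y)" if "y > 0" for y
        using that by (auto intro!: derivative_eq_intros)
      show "((\<lambda>y. \<epsilon> / y) has_real_derivative - \<epsilon> / y\<^sup>2) (at y)" if "y > 0" for y
        using that by (auto intro!: derivative_eq_intros simp: power2_eq_square)
      show "K - \<epsilon> * (1 + (ln X - ln y')) + (r * K + \<epsilon> * log_rate + 0 * y') * (s' - \<tau>) \<le> V (y', s')"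
        if "xl \<le> y'" "y' \<le> X" "s \<le> s'" "s' \<le> \<tau>" for y' s'
        using ge[OF that] by (simp add: f_def algebra_simps)
      show "V (y, s) = K - \<epsilon> * (1 + (ln X - ln y)) + (r * K + \<epsilon> * log_rate + 0 * y) * (s - \<tau>)"
        using eq by (simp add: f_def algebra_simps)
    qed (use r in \<open>auto intro!: continuous_intros\<close>)
    also have "\<dots> = - \<epsilon> * (drift_bound + (r - q)) + r * (V (y, s) - K)"
      using ys(1) by (simp add: log_rate_def field_simps)
    finally have "c \<le> - \<epsilon> * (drift_bound + (r - q)) + r * (V (y, s) - K)" .
    moreover have "0 \<le> \<epsilon> * (drift_bound + (r - q))" using drift(1) \<epsilon> by simp
    moreover have "r * (V (y, s) - K) < 0"
    proof -
      have "0 < \<epsilon> * (1 + log_rate * (\<tau> - s) + (ln X - ln y))"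
        using \<epsilon> pos(2)[of s] lnp[of y] y s by (simp add: add_pos_nonneg)
      then have "V (y, s) < K" using eq pos(1)[of s] s by (simp add: f_def)
      then show ?thesis using r by (simp add: mult_pos_neg)
    qed
    ultimately show False using c by linarith
  qed (use x t xl in auto)
  moreover have "ln (X / x) = ln X - ln x" using x X by (simp add: ln_div)
  ultimately show "K - r * K * (\<tau> - t) \<le> V (x, t) + \<epsilon> * ?M" by (simp add: f_def)
qed

text \<open>Shift and dilation share one boundary check. On the right side, l x = X, the obstacle
  gives l V \<ge> l\<gamma>x = K; at the top \<open>drop_from_slice\<close> gives V + rKh \<ge> K;
  the logarithm handles small x. At an interior contact the obstacle at the undilated point keeps V
  strictly above \<gamma>x at the dilated one, so only the level K has to be excluded.\<close>

lemma dilation_shift_comparison: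
  assumes l: "1 \<le> l" and h: "0 \<le> h" "h < t" and t: "t \<le> T" and x: "0 < x" "l * x \<le> X"
  shows "V (l * x, t) \<le> l * (V (x, t - h) + r * K * h)"
proof (rule le_if_le_add_eps)
  let ?M = "1 + log_rate * (T - t) + ln (X / x)"
  have xX: "x \<le> X" using x l mult_right_mono[OF l, of x] by linarith
  have "0 \<le> ln (X / x)" using x xX by simp
  then show "?M > 0" using drift(3) t by (simp add: add_pos_nonneg)
  fix \<epsilon> :: real assume \<epsilon>: "\<epsilon> > 0"
  define xl where "xl = min x (X * exp (- K / \<epsilon>))"
  have xl: "0 < xl" "xl \<le> x" "xl \<le> X" using x X xX by (auto simp: xl_def)
  have "xl \<le> X * exp (- K / \<epsilon>)" by (simp add: xl_def)
  then have "ln xl \<le> ln (X * exp (- K / \<epsilon>))" using xl by simp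
  then have "K / \<epsilon> \<le> ln X - ln xl" using X by (simp add: ln_mult)
  then have lnxl: "K \<le> \<epsilon> * (ln X - ln xl)" using \<epsilon> by (simp add: field_simps)
  define xr where "xr = X / l"
  have xr: "x \<le> xr" "xr \<le> X" "l * xr = X" "0 < xr" using x l X by (auto simp: xr_def field_simps)
  have lX: "l * y \<le> X" "y \<le> X" "0 < l * y" if "0 < y" "y \<le> xr" for y
    using that xr l mult_left_mono[of y xr l] by auto
  define f where "f = (\<lambda>(y, s). l * (V (y, s - h) + r * K * h) - V (l * y, s)
      + \<epsilon> * (1 + log_rate * (T - s) + (ln X - ln y)))"
  have lnp: "0 \<le> ln X - ln y" if "xl \<le> y" "y \<le> X" for y using that xl X by simp
  have Ch: "0 \<le> r * K * h" using r K h by simp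
  have bar: "0 < \<epsilon> * (1 + log_rate * (T - s) + (ln X - ln y))" if "xl \<le> y" "y \<le> X" "s \<le> T" for y s
    using that \<epsilon> drift(3) lnp[of y] by (simp add: add_pos_nonneg)
  have drop: "K \<le> V (y, s - h) + r * K * h"
    if "0 < y" "y \<le> X" "h < s" "s \<le> T" "\<And>x. 0 < x \<Longrightarrow> x < X \<Longrightarrow> V (x, s) = K" for y s
    using drop_from_slice[of s y "s - h"] that h by simp
  have "0 < f (x, t)"
  proof (rule positive_unless_touching[of xl t xr T f])
    show "continuous_on (cbox (xl, t) (xr, T)) f"
      unfolding f_def case_prod_unfold
    proof (intro continuous_intros cont_V_compose)
      fix z assume z: "z \<in> cbox (xl, t) (xr, T)"
      then show "0 < fst z \<and> fst z \<le> X \<and> 0 < snd z - h \<and> snd z - h \<le> T"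
        using xl h xr by (cases z) (auto simp: cbox_Pair_eq)
      show "0 < l * fst z \<and> l * fst z \<le> X \<and> 0 < snd z \<and> snd z \<le> T"
        using z xl h lX[of "fst z"] by (cases z) (auto simp: cbox_Pair_eq)
    next
      show "\<forall>z\<in>cbox (xl, t) (xr, T). fst z \<noteq> 0" using xl by (auto simp: cbox_Pair_eq)
    qed
  next
    fix y assume y: "xl \<le> y" "y \<le> xr"
    have "K \<le> V (y, T - h) + r * K * h" using drop[of y T] y xl xr V_top h t by auto
    then have "1 * K \<le> l * (V (y, T - h) + r * K * h)" using l K by (intro mult_mono) auto
    moreover have "V (l * y, T) = K" using V_top[of "l * y"] lX[of y] y xl by auto
    ultimately show "f (y, T) > 0" using bar[of y T] y xr by (simp add: f_def)
  next
    fix s assume s: "t \<le> s" "s \<le> T"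
    have "\<gamma> * xr \<le> V (xr, s - h) + r * K * h" using V_bounds(1)[of xr "s - h"] xr s h Ch by auto
    then have "l * (\<gamma> * xr) \<le> l * (V (xr, s - h) + r * K * h)" using l by (intro mult_left_mono) auto
    moreover have "l * (\<gamma> * xr) = K" using xr(3) X(2) by (metis mult.left_commute)
    moreover have "V (l * xr, s) = K" using V_right[of s] xr(3) s h by simp
    ultimately show "f (xr, s) > 0" using bar[of xr s] xr s xl by (simp add: f_def)
    have "0 < V (xl, s - h)" "V (l * xl, s) \<le> K"
      using V_bounds(3)[of xl "s - h"] V_bounds(2)[of "l * xl" s] lX[of xl] xl xr s h by auto
    then have "0 < l * (V (xl, s - h) + r * K * h)" using l Ch by (intro mult_pos_pos) auto
    moreover have "0 < \<epsilon> * (1 + log_rate * (T - s))" using \<epsilon> drift(3) s by (simp add: add_pos_nonneg)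
    moreover have "\<epsilon> * (1 + log_rate * (T - s) + (ln X - ln xl)) = \<epsilon> * (1 + log_rate * (T - s)) + \<epsilon> * (ln X - ln xl)"
      by (simp add: algebra_simps)
    ultimately show "f (xl, s) > 0"
      using lnxl \<open>V (l * xl, s) \<le> K\<close> unfolding f_def prod.case by linarith
  next
    fix y s assume y: "xl < y" "y < xr" and s: "t \<le> s" "s < T" and eq: "f (y, s) = 0"
      and ge: "\<And>y' s'. xl \<le> y' \<Longrightarrow> y' \<le> xr \<Longrightarrow> s \<le> s' \<Longrightarrow> s' \<le> T \<Longrightarrow> 0 \<le> f (y', s')"
    have ys: "0 < y" "0 < s" "y < X" "h < s" using y s xl h xr by auto
    have ly: "0 < l * y" "l * y < X"
    proof -
      show "0 < l * y" using l ys by simp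
      have "l * y < l * xr" using l y by simp
      then show "l * y < X" using xr(3) by simp
    qed
    have bys: "0 < \<epsilon> * (1 + log_rate * (T - s) + (ln X - ln y))" using bar[of y s] y ys s by auto
    have "l * (\<gamma> * y) \<le> l * (V (y, s - h) + r * K * h)"
      using V_bounds(1)[of y "s - h"] ys s h Ch l by (intro mult_left_mono) auto
    then have above: "\<gamma> * (l * y) < V (l * y, s)"
      using eq bys unfolding f_def prod.case by (simp add: mult.left_commute)
    \<comment> \<open>If V reached K at the dilated point, it would equal K on the whole slice, and
      \<open>drop_from_slice\<close> would make the other side at least K, with the penalty still to
      be added.\<close>
    have below: "V (l * y, s) < K"
    proof (rule ccontr)
      assume "\<not> V (l * y, s) < K"
      then have "V (l * y, s) = K" using V_bounds(2)[of "l * y" s] ly ys s by auto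
      then have "V (u, s) = K" if "0 < u" "u < X" for u
        using K_spreads[OF ly ys(2) s(2) _ that order_refl s(2)] by blast
      then have "K \<le> V (y, s - h) + r * K * h" using drop[of y s] ys s by auto
      then have "1 * K \<le> l * (V (y, s - h) + r * K * h)" using l K by (intro mult_mono) auto
      with \<open>V (l * y, s) = K\<close> eq bys show False unfolding f_def prod.case by linarith
    qed
    obtain \<rho> where \<rho>: "\<rho> > 0" "supersolution \<sigma> r q (cbox (y - \<rho>, s - \<rho>) (y + \<rho>, s + \<rho>)) (l * c - c)
        (\<lambda>z. l * V (fst z, snd z - h) - V (l * fst z, snd z))"
      using V_difference_supersolution[OF ys(1,3,4) h(1) s(2) l ly(2) above below] by blast
    let ?W = "\<lambda>z. l * V (fst z, snd z - h) - V (l * fst z, snd z)"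
    have "l * c - c \<le> - (\<epsilon> * log_rate + 0 * y) - 1/2 * \<sigma>\<^sup>2 * y\<^sup>2 * (- \<epsilon> / y\<^sup>2)
      - (r - q) * y * (\<epsilon> / y + 0 * (s - T)) + r * ?W (y, s)"
    proof (rule barrier_touch[OF \<rho>(2,1) _ ys(1) y s(2),
          where f = "\<lambda>y. - l * (r * K * h) - \<epsilon> * (1 + (ln X - ln y))" and f' = "\<lambda>y. \<epsilon> / y" and f'' = "\<lambda>y. - \<epsilon> / y\<^sup>2"])
      show "((\<lambda>y. - l * (r * K * h) - \<epsilon> * (1 + (ln X - ln y))) has_real_derivative \<epsilon> / y) (at y)" if "y > 0" for y
        using that by (auto intro!: derivative_eq_intros)
      show "((\<lambda>y. \<epsilon> / y) has_real_derivative - \<epsilon> / y\<^sup>2) (at y)" if "y > 0" for y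
        using that by (auto intro!: derivative_eq_intros simp: power2_eq_square)
      show "- l * (r * K * h) - \<epsilon> * (1 + (ln X - ln y')) + (\<epsilon> * log_rate + 0 * y') * (s' - T) \<le> ?W (y', s')"
        if "xl \<le> y'" "y' \<le> xr" "s \<le> s'" "s' \<le> T" for y' s'
        using ge[OF that] by (simp add: f_def algebra_simps)
      show "?W (y, s) = - l * (r * K * h) - \<epsilon> * (1 + (ln X - ln y)) + (\<epsilon> * log_rate + 0 * y) * (s - T)"
        using eq by (simp add: f_def algebra_simps)
    qed (use r in \<open>auto intro!: continuous_intros\<close>)
    also have "\<dots> = - \<epsilon> * (drift_bound + (r - q)) + r * ?W (y, s)"
      using ys(1) by (simp add: log_rate_def field_simps)
    finally have "l * c - c \<le> - \<epsilon> * (drift_bound + (r - q)) + r * ?W (y, s)" .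
    moreover have "0 \<le> \<epsilon> * (drift_bound + (r - q))" using drift(1) \<epsilon> by simp
    moreover have "?W (y, s) < 0"
    proof -
      have "0 \<le> l * (r * K * h)" using l Ch by simp
      then show ?thesis using eq bys by (simp add: f_def algebra_simps)
    qed
    then have "r * ?W (y, s) < 0" using r by (rule mult_pos_neg[rotated])
    moreover have "1 * c \<le> l * c" using l c by (intro mult_right_mono) auto
    ultimately show False by linarith
  qed (use x t xl xr in auto)
  moreover have "ln (X / x) = ln X - ln x" using x X by (simp add: ln_div)
  ultimately show "V (l * x, t) \<le> l * (V (x, t - h) + r * K * h) + \<epsilon> * ?M" by (simp add: f_def)
qed

lemma time_drop:
  assumes "0 < x" "x \<le> X" "0 \<le> h" "h < t" "t \<le> T"
  shows "V (x, t) \<le> V (x, t - h) + r * K * h"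
  using dilation_shift_comparison[of 1 h t x] assms by simp

text \<open>With dilation factor y/x and no time shift, V(y, t)/y \<le> V(x, t)/x = \<gamma>; the
  obstacle gives the converse.\<close>

lemma contact_right:
  assumes "0 < x" "x \<le> y" "y \<le> X" "0 < t" "t \<le> T" and "V (x, t) = \<gamma> * x"
  shows "V (y, t) = \<gamma> * y"
proof (rule antisym)
  have "V ((y / x) * x, t) \<le> (y / x) * (V (x, t - 0) + r * K * 0)"
    using assms by (intro dilation_shift_comparison) auto
  then show "V (y, t) \<le> \<gamma> * y" using assms by (simp add: mult.commute)
  show "\<gamma> * y \<le> V (y, t)" using V_bounds(1)[of y t] assms by simp
qed

end

section \<open>The neighbourhood of the hitting point\<close>

context bond_data
begin

text \<open>Below a time slice where \<open>V = K\<close> there is no contact within distance \<open>near\<close> of \<open>X\<close> for a time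
  \<open>delay\<close>. Up to \<open>delay/2\<close> after \<open>tstar\<close> and within distance \<open>width\<close> of \<open>X\<close>, \<open>V\<^sub>t \<le> time_slope (X - x)\<close>.\<close>

definition barrier_curv :: real where "barrier_curv = 8 * (r * K + 1) / (\<sigma>\<^sup>2 * X\<^sup>2)"

text \<open>The caps keep x \<ge> X/2, hold the drift term of the barrier to at most half of the
  diffusion available there, and keep its slope 2 \<open>barrier_curv\<close> \<open>near\<close>
  below \<gamma>.\<close>

definition near :: real where
  "near = min (X / 2) (min (\<sigma>\<^sup>2 * X / (16 * drift_bound)) (\<gamma> / (4 * barrier_curv)))"

text \<open>In this time a drop at the rate rK uses up half of the depth of the barrier at distance
  \<open>near\<close> from X.\<close>

definition delay :: real where "delay = barrier_curv * near\<^sup>2 / (2 * r * K)"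

text \<open>The second cap makes the time derivative 2/delay of the profile in
  \<open>improved_time_drop\<close> at most an eighth of \<sigma>^2 X^2/width^2.\<close>

definition width :: real where "width = min near (\<sigma> * X * sqrt delay / 4)"

text \<open>The slope at X of a parabolic profile that rises to the height rK over the distance
  \<open>width\<close>.\<close>

definition time_slope :: real where "time_slope = 2 * r * K / width"

definition alpha :: real where "alpha = (q * K - c) / (\<sigma>\<^sup>2 * X\<^sup>2)"

text \<open>The coefficient of a cubic correction. The three summands absorb the errors linear in d:
  the decrease of q\<gamma>x away from X, the time derivative, and the drift acting on alpha
  d^2.\<close>

definition beta :: real where
  "beta = 2 * (q * \<gamma> + time_slope + 2 * alpha * X * drift_bound) / (\<sigma>\<^sup>2 * X\<^sup>2)"

text \<open>The second cap keeps the drift and zero-order terms of the cubic and of the auxiliary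
  function \<open>e\<close> in \<open>quadratic_lower_bound\<close> dominated by the
  diffusion.\<close>

definition reach :: real where "reach = min width (\<sigma>\<^sup>2 * X / (8 * (3 * drift_bound + r)))"

lemma barrier_curv: "barrier_curv > 0" "\<sigma>\<^sup>2 * X\<^sup>2 * barrier_curv = 8 * (r * K + 1)"
  unfolding barrier_curv_def using r K \<sigma> X by (auto simp: add_pos_pos)

lemma near: "near > 0" "near \<le> X / 2" "16 * drift_bound * near \<le> \<sigma>\<^sup>2 * X" "4 * barrier_curv * near \<le> \<gamma>"
proof -
  have p: "0 < \<sigma>\<^sup>2 * X / (16 * drift_bound)" "0 < \<gamma> / (4 * barrier_curv)"
    using \<sigma> X drift \<gamma> barrier_curv by auto
  then show "near > 0" using X by (simp add: near_def)
  show "near \<le> X / 2" by (simp add: near_def)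
  have "near \<le> \<sigma>\<^sup>2 * X / (16 * drift_bound)" "near \<le> \<gamma> / (4 * barrier_curv)"
    by (simp_all add: near_def)
  then show "16 * drift_bound * near \<le> \<sigma>\<^sup>2 * X" "4 * barrier_curv * near \<le> \<gamma>"
    using drift(2) barrier_curv(1) by (simp_all add: pos_le_divide_eq mult.commute mult.left_commute)
qed

lemma delay: "delay > 0" "r * K * delay = barrier_curv * near\<^sup>2 / 2"
  using barrier_curv near r K by (auto simp: delay_def)

lemma width: "width > 0" "width \<le> near" "width \<le> X / 2" "16 * drift_bound * width \<le> \<sigma>\<^sup>2 * X"
  "16 * width\<^sup>2 \<le> \<sigma>\<^sup>2 * X\<^sup>2 * delay"
proof -
  have p: "0 < \<sigma> * X * sqrt delay / 4" using \<sigma> X delay by simp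
  then show w: "width > 0" using near by (simp add: width_def)
  show le: "width \<le> near" by (simp add: width_def)
  then show "width \<le> X / 2" using near by linarith
  have "16 * drift_bound * width \<le> 16 * drift_bound * near" using le drift by (intro mult_left_mono) auto
  then show "16 * drift_bound * width \<le> \<sigma>\<^sup>2 * X" using near by linarith
  have "width\<^sup>2 \<le> (\<sigma> * X * sqrt delay / 4)\<^sup>2" using w by (intro power_mono) (auto simp: width_def)
  then show "16 * width\<^sup>2 \<le> \<sigma>\<^sup>2 * X\<^sup>2 * delay"
    using delay by (simp add: power_mult_distrib power_divide)
qed

lemma time_slope: "time_slope > 0" "time_slope * width = 2 * r * K"
  using width r K by (auto simp: time_slope_def)

lemma alpha: "alpha > 0" "\<sigma>\<^sup>2 * X\<^sup>2 * alpha = q * K - c"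
  using c \<sigma> X by (auto simp: alpha_def)

lemma beta: "beta > 0" "\<sigma>\<^sup>2 * X\<^sup>2 * beta = 2 * (q * \<gamma> + time_slope + 2 * alpha * X * drift_bound)"
proof -
  have "0 < q * \<gamma> + time_slope + 2 * alpha * X * drift_bound"
    using q \<gamma> time_slope alpha X drift by (intro add_pos_pos mult_pos_pos) auto
  then show "beta > 0" using \<sigma> X by (simp add: beta_def)
  show "\<sigma>\<^sup>2 * X\<^sup>2 * beta = 2 * (q * \<gamma> + time_slope + 2 * alpha * X * drift_bound)"
    using \<sigma> X by (simp add: beta_def)
qed

lemma reach: "reach > 0" "reach \<le> width" "8 * (3 * drift_bound + r) * reach \<le> \<sigma>\<^sup>2 * X" "reach \<le> X / 2"
proof -
  have d: "0 < 8 * (3 * drift_bound + r)" using drift r by (simp add: add_pos_pos)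
  then have p: "0 < \<sigma>\<^sup>2 * X / (8 * (3 * drift_bound + r))" using \<sigma> X by simp
  then show "reach > 0" using width by (simp add: reach_def)
  show le: "reach \<le> width" by (simp add: reach_def)
  then show "reach \<le> X / 2" using width by linarith
  have "reach \<le> \<sigma>\<^sup>2 * X / (8 * (3 * drift_bound + r))" by (simp add: reach_def)
  then show "8 * (3 * drift_bound + r) * reach \<le> \<sigma>\<^sup>2 * X"
    using d by (simp only: pos_le_divide_eq mult.commute)
qed

end

section \<open>No contact shortly before a slice at the level K\<close>

context bond
begin

text \<open>The barrier K - M d(2 near - d), with d = X - x, equals K at d = 0 and lies, at d =
  near, below the value that \<open>drop_from_slice\<close> leaves during the time
  \<open>delay\<close>. Its convexity in x makes it a strict subsolution, and as its slope at X is
  less than \<gamma>, it stays above the obstacle.\<close>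

lemma no_contact_after_slice:
  assumes \<tau>: "0 < \<tau>" "\<tau> \<le> T" and slice: "\<And>x. 0 < x \<Longrightarrow> x < X \<Longrightarrow> V (x, \<tau>) = K"
    and x: "X - near < x" "x < X" and t: "0 < t" "\<tau> - delay < t" "t \<le> \<tau>"
  shows "\<gamma> * x < V (x, t)"
proof -
  define M where "M = barrier_curv"
  have M: "M > 0" using barrier_curv by (simp add: M_def)
  have "K - M * (X - x) * (2 * near - (X - x)) \<le> V (x, t)"
  proof (rule le_if_le_add_eps[where M = 1])
    fix \<epsilon> :: real assume \<epsilon>: "\<epsilon> > 0"
    define f where "f = (\<lambda>(y, s). V (y, s) - (K - M * (X - y) * (2 * near - (X - y)) - \<epsilon>))"
    have "0 < f (x, t)"
    proof (rule positive_unless_touching[of "X - near" t X \<tau> f])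
      show "continuous_on (cbox (X - near, t) (X, \<tau>)) f"
        unfolding f_def case_prod_unfold
      proof (intro continuous_intros cont_V_compose)
        fix z assume "z \<in> cbox (X - near, t) (X, \<tau>)"
        then show "0 < fst z \<and> fst z \<le> X \<and> 0 < snd z \<and> snd z \<le> T"
          using near X t \<tau> by (cases z) (auto simp: cbox_Pair_eq)
      qed
    next
      fix y assume y: "X - near \<le> y" "y \<le> X"
      then have "V (y, \<tau>) = K" using slice[of y] V_right[of \<tau>] near X \<tau> by (cases "y = X") auto
      moreover have "0 \<le> M * (X - y) * (2 * near - (X - y))" using M y near by simp
      ultimately show "f (y, \<tau>) > 0" using \<epsilon> by (simp add: f_def)
    next
      fix s assume s: "t \<le> s" "s \<le> \<tau>"
      show "f (X, s) > 0" using V_right[of s] s t \<tau> \<epsilon> by (simp add: f_def)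
      have "K - r * K * (\<tau> - s) \<le> V (X - near, s)"
        using drop_from_slice[OF \<tau> slice, of "X - near" s] near X s t by auto
      moreover have "r * K * (\<tau> - s) \<le> r * K * delay" using r K s t by (intro mult_left_mono) auto
      moreover have "M * near\<^sup>2 / 2 \<le> M * near\<^sup>2" using M by simp
      ultimately show "f (X - near, s) > 0"
        using delay(2) \<epsilon> unfolding f_def prod.case M_def by (simp add: power2_eq_square)
    next
      fix y s assume y: "X - near < y" "y < X" and s: "t \<le> s" "s < \<tau>" and eq: "f (y, s) = 0"
        and ge: "\<And>y' s'. X - near \<le> y' \<Longrightarrow> y' \<le> X \<Longrightarrow> s \<le> s' \<Longrightarrow> s' \<le> \<tau> \<Longrightarrow> 0 \<le> f (y', s')"
      have ys: "0 < y" "0 < s" "s < T" "X / 2 \<le> y" using y s near X t \<tau> by auto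
      obtain \<rho> where \<rho>: "\<rho> > 0" "supersolution \<sigma> r q (cbox (y - \<rho>, s - \<rho>) (y + \<rho>, s + \<rho>)) c V"
        using V_supersolution_at ys(1) y(2) ys(2,3) by blast
      have "c \<le> - (0 + 0 * y) - 1/2 * \<sigma>\<^sup>2 * y\<^sup>2 * (2 * M)
        - (r - q) * y * (2 * M * (near - (X - y)) + 0 * (s - \<tau>)) + r * V (y, s)"
      proof (rule barrier_touch[OF \<rho>(2,1) _ ys(1) y s(2),
            where f = "\<lambda>y. K - M * (X - y) * (2 * near - (X - y)) - \<epsilon>"
              and f' = "\<lambda>y. 2 * M * (near - (X - y))" and f'' = "\<lambda>y. 2 * M"])
        show "((\<lambda>y. K - M * (X - y) * (2 * near - (X - y)) - \<epsilon>) has_real_derivative 2 * M * (near - (X - y))) (at y)" for y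
          by (auto intro!: derivative_eq_intros simp: algebra_simps)
        show "((\<lambda>y. 2 * M * (near - (X - y))) has_real_derivative 2 * M) (at y)" for y
          by (auto intro!: derivative_eq_intros)
        show "K - M * (X - y') * (2 * near - (X - y')) - \<epsilon> + (0 + 0 * y') * (s' - \<tau>) \<le> V (y', s')"
          if "X - near \<le> y'" "y' \<le> X" "s \<le> s'" "s' \<le> \<tau>" for y' s'
          using ge[OF that] by (simp add: f_def)
        show "V (y, s) = K - M * (X - y) * (2 * near - (X - y)) - \<epsilon> + (0 + 0 * y) * (s - \<tau>)"
          using eq by (simp add: f_def)
      qed (use r in \<open>auto intro!: continuous_intros\<close>)
      then have "c \<le> - (\<sigma>\<^sup>2 * y\<^sup>2 * M) - (r - q) * y * (2 * M * (near - (X - y))) + r * V (y, s)"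
        by simp
      moreover have "\<sigma>\<^sup>2 * X\<^sup>2 * M / 4 \<le> \<sigma>\<^sup>2 * y\<^sup>2 * M"
      proof -
        have "(X / 2)\<^sup>2 \<le> y\<^sup>2" using ys X by (intro power_mono) auto
        then have "\<sigma>\<^sup>2 * (X / 2)\<^sup>2 * M \<le> \<sigma>\<^sup>2 * y\<^sup>2 * M" using M by (intro mult_right_mono mult_left_mono) auto
        then show ?thesis by (simp add: power_divide)
      qed
      moreover have "- ((r - q) * y * (2 * M * (near - (X - y)))) \<le> \<sigma>\<^sup>2 * X\<^sup>2 * M / 8"
      proof -
        have "\<bar>(r - q) * y * (2 * M * (near - (X - y)))\<bar> \<le> drift_bound * X * (2 * M * near)"
          unfolding abs_mult using drift ys y M near X by (intro mult_mono) auto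
        also have "\<dots> = (16 * drift_bound * near) * (X * M) / 8" by simp
        also have "\<dots> \<le> (\<sigma>\<^sup>2 * X) * (X * M) / 8"
          using near(3) X M by (intro divide_right_mono mult_right_mono) auto
        also have "\<dots> = \<sigma>\<^sup>2 * X\<^sup>2 * M / 8" by (simp add: power2_eq_square)
        finally show ?thesis by (rule order_trans[OF abs_ge_minus_self])
      qed
      moreover have "r * V (y, s) \<le> r * K" using V_bounds(2)[of y s] ys y r by (intro mult_left_mono) auto
      \<comment> \<open>Here z stands for \<sigma>^2 X^2 M. The diffusion contributes at least z/4
        and the drift takes back at most z/8; the value 8(rK + 1) of z leaves rK + 1 against rK, so
        that c would be negative.\<close>
      moreover have False
        if "c \<le> - u - v + w" "z / 4 \<le> u" "- v \<le> z / 8" "w \<le> k" "z = 8 * (k + 1)" for u v w z k :: real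
      proof -
        have "z \<le> 4 * u" "- 8 * v \<le> z" using that by auto
        then show False using that(1,4,5) c(1) by argo
      qed
      ultimately show False using barrier_curv(2) unfolding M_def by blast
    qed (use x t in auto)
    then show "K - M * (X - x) * (2 * near - (X - x)) \<le> V (x, t) + \<epsilon> * 1" by (simp add: f_def)
  qed simp
  moreover have "M * (X - x) * (2 * near - (X - x)) < \<gamma> * (X - x)"
  proof -
    have "M * (2 * near - (X - x)) \<le> M * (2 * near)" using M x by (intro mult_left_mono) auto
    also have "\<dots> < \<gamma>" using near(4) \<gamma> unfolding M_def by linarith
    finally have "M * (2 * near - (X - x)) * (X - x) < \<gamma> * (X - x)" using x by (intro mult_strict_right_mono) auto
    then show ?thesis by (simp add: mult_ac)
  qed
  moreover have "\<gamma> * (X - x) = K - \<gamma> * x" using X(2) by (simp add: right_diff_distrib)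
  ultimately show ?thesis by linarith
qed

end

section \<open>Time regularity around the hitting time\<close>

locale bond_hit = bond +
  fixes tstar :: real
  assumes tstar: "tstar < T" and hits: "hits_only_at K \<gamma> T V (K / \<gamma>, tstar)"
begin

abbreviation "\<Gamma> \<equiv> free_boundary K \<gamma> T V"

lemma free_boundaryD:
  assumes "(x, t) \<in> \<Gamma>"
  shows "0 < x" "x < X" "0 < t" "t < T" "V (x, t) = \<gamma> * x"
proof -
  have D: "(x, t) \<in> bond_domain K \<gamma> T" using assms by (simp add: free_boundary_def)
  then show b: "0 < x" "x < X" "0 < t" "t < T" by (auto simp: domain_iff)
  have eq: "{(x, t). (x, t) \<in> bond_domain K \<gamma> T \<and> V (x, t) > \<gamma> * x} = {z \<in> bond_domain K \<gamma> T. \<gamma> * fst z < V z}"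
    by auto
  have "(x, t) \<notin> {z \<in> bond_domain K \<gamma> T. \<gamma> * fst z < V z}"
    using assms unfolding free_boundary_def eq frontier_def
    by (simp add: interior_open[OF open_above_obstacle])
  then show "V (x, t) = \<gamma> * x" using D V_bounds(1)[of x t] b by simp
qed

lemma tstar_closure: "(X, tstar) \<in> closure \<Gamma>"
  using hits by (auto simp: hits_only_at_def X_def)

lemma hit_unique: "0 \<le> t \<Longrightarrow> t \<le> T \<Longrightarrow> (X, t) \<in> closure \<Gamma> \<Longrightarrow> t = tstar"
proof -
  assume "0 \<le> t" "t \<le> T" "(X, t) \<in> closure \<Gamma>"
  then have "(X, t) \<in> closure \<Gamma> \<inter> bond_fixed_boundary K \<gamma> T"
    by (simp add: bond_fixed_boundary_def X_def)
  then have "(X, t) \<in> {(K / \<gamma>, tstar)}" using hits unfolding hits_only_at_def by (rule subst[rotated])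
  then show ?thesis by simp
qed

text \<open>Points of \<Gamma> accumulate at the hitting point. Within \<open>delay\<close> before
  the slice they are excluded near X by \<open>no_contact_after_slice\<close>; after it V = K by the
  strong maximum principle.\<close>

lemma tstar_le_slice:
  assumes \<tau>: "0 < \<tau>" "\<tau> \<le> T" and slice: "\<And>x. 0 < x \<Longrightarrow> x < X \<Longrightarrow> V (x, \<tau>) = K"
  shows "tstar \<le> \<tau> - delay"
proof (rule ccontr)
  assume "\<not> tstar \<le> \<tau> - delay"
  define e where "e = min near (tstar - (\<tau> - delay))"
  have "e > 0" using \<open>\<not> tstar \<le> \<tau> - delay\<close> near by (simp add: e_def)
  then obtain z where z: "z \<in> \<Gamma>" "dist z (X, tstar) < e"
    using tstar_closure by (meson closure_approachable)
  obtain x t where zxt: "z = (x, t)" by (cases z)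
  note fb = free_boundaryD[OF z(1)[unfolded zxt]]
  have "dist x X \<le> dist z (X, tstar)" "dist t tstar \<le> dist z (X, tstar)"
    unfolding zxt using dist_fst_le[of "(x, t)" "(X, tstar)"] dist_snd_le[of "(x, t)" "(X, tstar)"] by auto
  then have d: "X - near < x" "\<tau> - delay < t"
    using z(2) unfolding e_def dist_real_def by linarith+
  show False
  proof (cases "t \<le> \<tau>")
    case True
    from no_contact_after_slice[OF \<tau> slice d(1) fb(2,3) d(2) True] fb(5) show False by simp
  next
    case False
    have "V (x, t) = K"
      using K_spreads[of x \<tau> x t] slice[OF fb(1,2)] fb False \<tau> by auto
    then have "\<gamma> * x = \<gamma> * X" using fb(5) X(2) by simp
    then show False using \<gamma> fb(2) by simp
  qed
qed

lemma tstar_delay: "tstar + delay \<le> T"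
  using tstar_le_slice[of T] T V_top by force

text \<open>One interior point with V = K would make its whole slice equal to K. This provides a
  time span after \<open>tstar\<close>, depending on the data alone, in which the equation holds
  wherever V leaves the obstacle.\<close>

lemma below_K:
  assumes "0 < x" "x < X" "0 < t" "t < T" "t < tstar + delay"
  shows "V (x, t) < K"
proof (rule ccontr)
  assume "\<not> V (x, t) < K"
  then have "V (x, t) = K" using V_bounds(2)[of x t] assms by simp
  then have "V (y, t) = K" if "0 < y" "y < X" for y
    using K_spreads[of x t y t] assms that by auto
  then have "tstar \<le> t - delay" using assms by (intro tstar_le_slice) auto
  then show False using assms by simp
qed

text \<open>V and its shift by h agree on x = X, where both equal K, and elsewhere V exceeds the
  shift by at most rKh. The profile \<Phi> interpolates: it is 0 at (X, t) and at least 1 on the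
  left side and at the end time t + delay/2. The comparison uses the equation and therefore stays
  before time tstar + delay, where V < K.\<close>

lemma improved_time_drop:
  assumes h: "0 < h" "h < t" and t: "t < tstar + delay / 2" and x: "X - width \<le> x" "x < X"
  shows "V (x, t) - time_slope * h * (X - x) \<le> V (x, t - h)"
proof -
  define H where "H = r * K * h"
  have H: "H > 0" using r K h by (simp add: H_def)
  define \<Phi> where "\<Phi> y s = (X - y) * (2 * width - (X - y)) / width\<^sup>2 + 2 / delay * (s - t)" for y s
  have "V (x, t) - H * \<Phi> x t \<le> V (x, t - h)"
  proof (rule le_if_le_add_eps[where M = 1])
    fix \<epsilon> :: real assume \<epsilon>: "\<epsilon> > 0"
    define t2 where "t2 = t + delay / 2"
    have t2: "t < t2" "t2 < tstar + delay" "t2 < T" using t delay tstar_delay by (auto simp: t2_def)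
    define f where "f = (\<lambda>(y, s). V (y, s - h) - V (y, s) + H * \<Phi> y s + \<epsilon>)"
    have \<Phi>0: "0 \<le> \<Phi> y s" if "X - width \<le> y" "y \<le> X" "t \<le> s" for y s
      unfolding \<Phi>_def using that width delay
      by (intro add_nonneg_nonneg divide_nonneg_nonneg mult_nonneg_nonneg) auto
    have drop: "V (y, s) \<le> V (y, s - h) + H" if "X - width \<le> y" "y \<le> X" "t \<le> s" "s \<le> t2" for y s
      unfolding H_def using that h t2 width X by (intro time_drop) auto
    have "0 < f (x, t)"
    proof (rule positive_unless_touching[of "X - width" t X t2 f])
      show "continuous_on (cbox (X - width, t) (X, t2)) f"
        unfolding f_def case_prod_unfold \<Phi>_def
      proof (intro continuous_intros cont_V_compose)
        fix z assume z: "z \<in> cbox (X - width, t) (X, t2)"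
        then show "0 < fst z \<and> fst z \<le> X \<and> 0 < snd z - h \<and> snd z - h \<le> T"
          using width X h t2 by (cases z) (auto simp: cbox_Pair_eq)
        show "0 < fst z \<and> fst z \<le> X \<and> 0 < snd z \<and> snd z \<le> T"
          using z width X h t2 by (cases z) (auto simp: cbox_Pair_eq)
      qed (use width delay in auto)
    next
      fix y assume y: "X - width \<le> y" "y \<le> X"
      have "0 \<le> (X - y) * (2 * width - (X - y)) / width\<^sup>2" using y width by simp
      moreover have "2 / delay * (t2 - t) = 1" using delay by (simp add: t2_def)
      ultimately have "1 \<le> \<Phi> y t2" unfolding \<Phi>_def by linarith
      then have "H * 1 \<le> H * \<Phi> y t2" using H by (intro mult_left_mono) auto
      then show "f (y, t2) > 0" using drop[OF y, of t2] t2 \<epsilon> by (simp add: f_def)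
    next
      fix s assume s: "t \<le> s" "s \<le> t2"
      have "0 \<le> H * \<Phi> X s" using \<Phi>0[of X s] s H width by simp
      then show "f (X, s) > 0" using V_right[of s] V_right[of "s - h"] s h t2 \<epsilon> by (simp add: f_def)
      have "(X - (X - width)) * (2 * width - (X - (X - width))) / width\<^sup>2 = 1"
        using width by (simp add: power2_eq_square)
      moreover have "0 \<le> 2 / delay * (s - t)" using delay s by simp
      ultimately have "1 \<le> \<Phi> (X - width) s" unfolding \<Phi>_def by linarith
      then have "H * 1 \<le> H * \<Phi> (X - width) s" using H by (intro mult_left_mono) auto
      then show "f (X - width, s) > 0" using drop[of "X - width" s] s width \<epsilon> by (simp add: f_def)
    next
      fix y s assume y: "X - width < y" "y < X" and s: "t \<le> s" "s < t2" and eq: "f (y, s) = 0"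
        and ge: "\<And>y' s'. X - width \<le> y' \<Longrightarrow> y' \<le> X \<Longrightarrow> s \<le> s' \<Longrightarrow> s' \<le> t2 \<Longrightarrow> 0 \<le> f (y', s')"
      have ys: "0 < y" "0 < s" "s < T" "X / 2 \<le> y" "h < s" using y s width X h t2 by auto
      have b: "0 < H * \<Phi> y s + \<epsilon>" using \<Phi>0[of y s] y s H \<epsilon> by (simp add: add_nonneg_pos)
      have above: "\<gamma> * y < V (y, s)"
        using V_bounds(1)[of y "s - h"] eq b y ys h unfolding f_def prod.case by simp
      have below: "V (y, s) < K" using below_K[of y s] ys y s t2 by simp
      obtain \<rho> where \<rho>: "\<rho> > 0" "supersolution \<sigma> r q (cbox (y - \<rho>, s - \<rho>) (y + \<rho>, s + \<rho>)) (1 * c - c)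
          (\<lambda>z. 1 * V (fst z, snd z - h) - V (1 * fst z, snd z))"
        using V_difference_supersolution[of y h s 1] ys y(2) h above below by auto
      let ?W = "\<lambda>z. 1 * V (fst z, snd z - h) - V (1 * fst z, snd z)"
      let ?h0 = "- H * (2 / delay)"
      have split: "- H * ((X - y') * (2 * width - (X - y')) / width\<^sup>2) - \<epsilon> + (?h0 + 0 * y') * (s' - t)
          = - (H * \<Phi> y' s') - \<epsilon>" for y' s'
        using width delay by (simp add: \<Phi>_def field_simps)
      have "1 * c - c \<le> - (?h0 + 0 * y) - 1/2 * \<sigma>\<^sup>2 * y\<^sup>2 * (2 * H / width\<^sup>2)
        - (r - q) * y * (2 * H * (width - (X - y)) / width\<^sup>2 + 0 * (s - t)) + r * ?W (y, s)"
      proof (rule barrier_touch[OF \<rho>(2,1) _ ys(1) y s(2),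
            where f = "\<lambda>y. - H * ((X - y) * (2 * width - (X - y)) / width\<^sup>2) - \<epsilon>"
              and f' = "\<lambda>y. 2 * H * (width - (X - y)) / width\<^sup>2" and f'' = "\<lambda>y. 2 * H / width\<^sup>2"])
        show "((\<lambda>y. - H * ((X - y) * (2 * width - (X - y)) / width\<^sup>2) - \<epsilon>) has_real_derivative
            2 * H * (width - (X - y)) / width\<^sup>2) (at y)" for y
          using width by (auto intro!: derivative_eq_intros simp: field_simps power_def numeral_eq_Suc)
        show "((\<lambda>y. 2 * H * (width - (X - y)) / width\<^sup>2) has_real_derivative 2 * H / width\<^sup>2) (at y)" for y
          by (intro DERIV_cdivide) (auto intro!: derivative_eq_intros)
        show "- H * ((X - y') * (2 * width - (X - y')) / width\<^sup>2) - \<epsilon> + (?h0 + 0 * y') * (s' - t) \<le> ?W (y', s')"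
          if "X - width \<le> y'" "y' \<le> X" "s \<le> s'" "s' \<le> t2" for y' s'
          using ge[OF that] unfolding split f_def prod.case by simp
        show "?W (y, s) = - H * ((X - y) * (2 * width - (X - y)) / width\<^sup>2) - \<epsilon> + (?h0 + 0 * y) * (s - t)"
          using eq unfolding split f_def prod.case by simp
      qed (use r in \<open>auto intro!: continuous_intros\<close>)
      moreover have "r * ?W (y, s) < 0"
      proof -
        have "?W (y, s) < 0" using eq b by (simp add: f_def)
        then show ?thesis using r by (rule mult_pos_neg[rotated])
      qed
      moreover have "\<sigma>\<^sup>2 * X\<^sup>2 / 4 * (H / width\<^sup>2) \<le> \<sigma>\<^sup>2 * y\<^sup>2 * (H / width\<^sup>2)"
      proof -
        have "(X / 2)\<^sup>2 \<le> y\<^sup>2" using ys X by (intro power_mono) auto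
        then have "\<sigma>\<^sup>2 * (X / 2)\<^sup>2 * (H / width\<^sup>2) \<le> \<sigma>\<^sup>2 * y\<^sup>2 * (H / width\<^sup>2)"
          using H by (intro mult_right_mono mult_left_mono) auto
        then show ?thesis by (simp add: power_divide)
      qed
      moreover have "- ((r - q) * y * (2 * H * (width - (X - y)) / width\<^sup>2)) \<le> \<sigma>\<^sup>2 * X\<^sup>2 / 8 * (H / width\<^sup>2)"
      proof -
        have "\<bar>(r - q) * y * (2 * H * (width - (X - y)) / width\<^sup>2)\<bar> \<le> drift_bound * X * (2 * H * width / width\<^sup>2)"
        proof -
          have "\<bar>width - (X - y)\<bar> \<le> width" using y width by (simp add: abs_le_iff)
          then have "2 * H * \<bar>width - (X - y)\<bar> / width\<^sup>2 \<le> 2 * H * width / width\<^sup>2"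
            using H by (intro divide_right_mono mult_left_mono) auto
          moreover have "\<bar>2 * H * (width - (X - y)) / width\<^sup>2\<bar> = 2 * H * \<bar>width - (X - y)\<bar> / width\<^sup>2"
            using H by (simp add: abs_mult abs_divide)
          ultimately show ?thesis
            unfolding abs_mult[of "(r - q) * y"] abs_mult[of "r - q"] using drift ys y X
            by (intro mult_mono) auto
        qed
        also have "\<dots> = (16 * drift_bound * width) * X / 8 * (H / width\<^sup>2)" by simp
        also have "\<dots> \<le> (\<sigma>\<^sup>2 * X) * X / 8 * (H / width\<^sup>2)"
          using width(4) X H by (intro mult_right_mono divide_right_mono) auto
        also have "\<dots> = \<sigma>\<^sup>2 * X\<^sup>2 / 8 * (H / width\<^sup>2)" by (simp add: power2_eq_square)
        finally show ?thesis by (rule order_trans[OF abs_ge_minus_self])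
      qed
      \<comment> \<open>Here the cap on \<open>width\<close> enters. The diffusion supplies a
        quarter of \<sigma>^2 X^2 H/width^2, drift and time derivative take at most an eighth each,
        and the strictly negative zero-order term decides.\<close>
      moreover have "H * (2 / delay) \<le> \<sigma>\<^sup>2 * X\<^sup>2 / 8 * (H / width\<^sup>2)"
      proof -
        have "2 / delay \<le> \<sigma>\<^sup>2 * X\<^sup>2 / 8 / width\<^sup>2"
          using width(1,5) delay(1) by (simp add: field_simps)
        then have "H * (2 / delay) \<le> H * (\<sigma>\<^sup>2 * X\<^sup>2 / 8 / width\<^sup>2)" using H by (intro mult_left_mono) auto
        also have "\<dots> = \<sigma>\<^sup>2 * X\<^sup>2 / 8 * (H / width\<^sup>2)" by (simp add: field_simps)
        finally show ?thesis .
      qed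
      ultimately show False by simp
    qed (use x t2 in auto)
    then show "V (x, t) - H * \<Phi> x t \<le> V (x, t - h) + \<epsilon> * 1" by (simp add: f_def)
  qed simp
  moreover have "H * \<Phi> x t \<le> time_slope * h * (X - x)"
  proof -
    have "(X - x) * (2 * width - (X - x)) \<le> (X - x) * (2 * width)" using x by (intro mult_left_mono) auto
    then have "\<Phi> x t \<le> (X - x) * (2 * width) / width\<^sup>2"
      unfolding \<Phi>_def using width by (simp add: divide_right_mono)
    also have "\<dots> = 2 * (X - x) / width" using width by (simp add: power2_eq_square)
    finally have "H * \<Phi> x t \<le> H * (2 * (X - x) / width)" using H by (intro mult_left_mono) auto
    also have "\<dots> = time_slope * h * (X - x)" by (simp add: H_def time_slope_def)
    finally show ?thesis .
  qed
  ultimately show ?thesis by linarith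
qed

text \<open>A contact point at a time after \<open>tstar\<close> would produce free boundary points on every vertical
  line to its right, and these accumulate at a second point of \<open>{K/\<gamma>} \<times> [0, T]\<close>.\<close>

lemma no_contact_after_tstar:
  assumes x: "0 < x" "x < X" and t: "0 < t" "tstar < t" "t < T"
  shows "\<gamma> * x < V (x, t)"
proof (rule ccontr)
  assume "\<not> \<gamma> * x < V (x, t)"
  then have contact: "V (x, t) = \<gamma> * x" using V_bounds(1)[of x t] x t by simp
  have ex: "\<exists>s\<in>{t..T}. (y, s) \<in> \<Gamma>" if y: "x \<le> y" "y < X" for y
  proof -
    define S where "S = {s \<in> {t..T}. V (y, s) - \<gamma> * y = 0}"
    have cont: "continuous_on {t..T} (\<lambda>s. V (y, s) - \<gamma> * y)"
      using x y t by (intro continuous_intros cont_V_compose) auto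
    then have "closed S" unfolding S_def by (intro continuous_closed_preimage_constant) auto
    moreover have "bounded S" by (rule bounded_subset[of "{t..T}"]) (auto simp: S_def)
    ultimately have "compact S" by (simp add: compact_eq_bounded_closed)
    moreover have "t \<in> S" using contact_right[of x y t] contact x y t by (auto simp: S_def)
    \<comment> \<open>The last contact time on the vertical line. It lies before T because V(y, T) =
      K > \<gamma>y, and right after it V leaves the obstacle, so it yields a free boundary
      point.\<close>
    ultimately obtain s where s: "s \<in> S" "\<forall>u\<in>S. u \<le> s" using compact_attains_sup[of S] by blast
    have yK: "\<gamma> * y < K" using y \<gamma> X by (metis mult_strict_left_mono)
    then have sT: "t \<le> s" "s < T" "V (y, s) = \<gamma> * y"
      using s(1) V_top[of y] x y by (auto simp: S_def order_less_le)
    have ys: "(y, s) \<in> bond_domain K \<gamma> T" using x y t sT by (simp add: domain_iff)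
    let ?P = "{(x, t). (x, t) \<in> bond_domain K \<gamma> T \<and> V (x, t) > \<gamma> * x}"
    have "(y, s) \<in> closure ?P"
      unfolding closure_approachable
    proof (intro allI impI)
      fix e :: real assume "e > 0"
      define u where "u = s + min (e / 2) ((T - s) / 2)"
      have u: "s < u" "u < T" "u < s + e" using \<open>e > 0\<close> sT by (auto simp: u_def min_def field_simps)
      then have "u \<notin> S" using s(2) by force
      then have "V (y, u) \<noteq> \<gamma> * y" using u sT by (auto simp: S_def)
      then have "(y, u) \<in> ?P" using V_bounds(1)[of y u] x y t sT u by (auto simp: domain_iff)
      moreover have "dist (y, u) (y, s) < e" using u by (simp add: dist_prod_def dist_real_def)
      ultimately show "\<exists>z\<in>?P. dist z (y, s) < e" by blast
    qed
    moreover have "(y, s) \<notin> interior ?P" using interior_subset[of ?P] sT(3) by auto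
    ultimately have "(y, s) \<in> \<Gamma>" using ys by (simp add: free_boundary_def frontier_def)
    then show ?thesis using sT by auto
  qed
  define y where "y n = X - (X - x) / real (Suc n)" for n
  have y: "x \<le> y n" "y n < X" for n
  proof -
    have "(X - x) / real (Suc n) \<le> X - x" using x by (simp add: divide_le_eq mult_left_mono)
    then show "x \<le> y n" by (simp add: y_def)
    show "y n < X" using x by (simp add: y_def)
  qed
  have yX: "y \<longlonglongrightarrow> X"
  proof -
    have "(\<lambda>n. X - (X - x) / real (Suc n)) \<longlonglongrightarrow> X - 0"
      by (intro tendsto_diff tendsto_const) (rule LIMSEQ_Suc[OF lim_const_over_n])
    then show ?thesis by (simp add: y_def[abs_def])
  qed
  obtain s where s: "\<And>n. s n \<in> {t..T}" "\<And>n. (y n, s n) \<in> \<Gamma>" using ex[OF y] by metis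
  obtain l k where l: "l \<in> {t..T}" "strict_mono k" "(s \<circ> k) \<longlonglongrightarrow> l"
    using compact_Icc[of t T] s(1) unfolding compact_def by metis
  have "(\<lambda>n. (y (k n), s (k n))) \<longlonglongrightarrow> (X, l)"
    using LIMSEQ_subseq_LIMSEQ[OF yX l(2)] l(3) by (intro tendsto_Pair) (auto simp: o_def)
  then have "(X, l) \<in> closure \<Gamma>"
    using s(2) unfolding closure_sequential by (intro exI[of _ "\<lambda>n. (y (k n), s (k n))"]) auto
  then have "l = tstar" using hit_unique[of l] l(1) t by auto
  then show False using l(1) t by simp
qed

text \<open>\<Gamma> is nonempty and consists of contact points at positive times, none of which
  lies after \<open>tstar\<close>.\<close>

lemma tstar_pos: "0 < tstar"
proof (rule ccontr)
  assume "\<not> 0 < tstar"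
  obtain z where z: "z \<in> \<Gamma>" using tstar_closure by (metis closure_empty empty_iff equals0I)
  obtain x t where zxt: "z = (x, t)" by (cases z)
  note fb = free_boundaryD[OF z[unfolded zxt]]
  show False using no_contact_after_tstar[OF fb(1,2,3) _ fb(4)] fb \<open>\<not> 0 < tstar\<close> by simp
qed

end

section \<open>Quadratic growth and tangency\<close>

context bond_hit
begin

text \<open>V is tested at a maximum over x of \<open>G\<close> at the fixed time s, and
  \<open>improved_time_drop\<close> extends the upper bound on V to later times at the linear rate
  time_slope d. This replaces an integration of u_xx in x, of which no pointwise values are
  needed.\<close>

lemma quadratic_lower_bound:
  assumes s: "tstar < s" "s < tstar + delay / 2" and x: "X - reach < x" "x < X"
  shows "\<gamma> * x + alpha * (X - x)\<^sup>2 - beta * (X - x)^3 \<le> V (x, s)"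
proof (rule ccontr)
  assume neg: "\<not> ?thesis"
  define S where "S = \<sigma>\<^sup>2 * X\<^sup>2"
  define m where "m = 8 * (drift_bound * X + r * X) / S"
  have S: "S > 0" using \<sigma> X by (simp add: S_def)
  have m: "m > 0" "S * m = 8 * (drift_bound * X + r * X)"
    unfolding m_def using S drift X r by (auto simp: add_pos_pos)
  have s': "0 < s" "s < T" "s < tstar + delay" using s tstar_pos tstar_delay delay by auto
  have x0: "0 < x" "X / 2 \<le> x" using x reach X by linarith+
  define p where "p d = alpha * d\<^sup>2 - beta * d^3" for d
  \<comment> \<open>An auxiliary function that vanishes at d = 0 with positive slope. Its quadratic
    term is sized so that \<open>E\<close> \<ge> 0, that is, adding kap e does no harm in the
    inequality at the contact point.\<close>
  define e where "e d = d + m * d\<^sup>2" for d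
  have e: "e d > 0" if "d > 0" for d using that m by (simp add: e_def add_pos_pos)
  \<comment> \<open>This value makes \<open>G\<close> vanish at x as well as at X, so a positive
    maximum is interior.\<close>
  define kap where "kap = (\<gamma> * x + p (X - x) - V (x, s)) / e (X - x)"
  have "0 < \<gamma> * x + p (X - x) - V (x, s)" using neg by (simp add: p_def)
  then have kap: "kap > 0" "kap * e (X - x) = \<gamma> * x + p (X - x) - V (x, s)"
    unfolding kap_def using e[of "X - x"] x by auto
  define G where "G y = V (y, s) - \<gamma> * y - p (X - y) + kap * e (X - y)" for y
  have G_ends: "G x = 0" "G X = 0"
    using kap(2) V_right[of s] s' X by (simp_all add: G_def p_def e_def)
  have "continuous_on {x..X} G"
    unfolding G_def p_def e_def using x0 s' by (intro continuous_intros cont_V_compose) auto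
  then obtain y where y: "y \<in> {x..X}" "\<forall>u\<in>{x..X}. G u \<le> G y"
    using continuous_attains_sup[of "{x..X}" G] x by auto
  define M where "M = G y"
  show False
  proof (cases "M > 0")
    case False
    text \<open>Then \<open>V - \<gamma>x\<close> would be negative near \<open>X\<close>, where \<open>p\<close> is negligible against \<open>e\<close>.\<close>
    define d where "d = min (X - x) (kap / (2 * alpha))"
    have d: "d > 0" "d \<le> X - x" "alpha * d < kap"
    proof -
      show "d > 0" "d \<le> X - x" using x kap alpha by (auto simp: d_def)
      have "d \<le> kap / (2 * alpha)" by (simp add: d_def)
      then have "alpha * d \<le> kap / 2" using alpha by (simp add: field_simps)
      then show "alpha * d < kap" using kap by linarith
    qed
    have "G (X - d) \<le> 0" using y(2)[rule_format, of "X - d"] d False unfolding M_def by simp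
    moreover have "\<gamma> * (X - d) \<le> V (X - d, s)" using V_bounds(1)[of "X - d" s] d x0 s' by auto
    ultimately have "kap * e d \<le> p d" by (simp add: G_def)
    moreover have "alpha * d * d < kap * d" using d by (intro mult_strict_right_mono) auto
    moreover have "0 \<le> beta * d^3" "0 \<le> kap * (m * d\<^sup>2)" using beta d kap m by auto
    ultimately show False by (simp add: p_def e_def algebra_simps power2_eq_square)
  next
    case True
    then have yx: "x < y" "y < X" using y(1) G_ends unfolding M_def by (auto simp: order_less_le)
    have ys: "0 < y" "X / 2 \<le> y" using yx x0 by auto
    define d where "d = X - y"
    have d: "0 < d" "d < reach" "d \<le> X" using yx x ys by (auto simp: d_def)
    have above: "\<gamma> * y < V (y, s)" using no_contact_after_tstar[of y s] ys yx s s' by simp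
    have below: "V (y, s) < K" using below_K[of y s] ys yx s' by simp
    obtain \<rho> where \<rho>: "\<rho> > 0"
      "supersolution \<sigma> r q (cbox (y - \<rho>, s - \<rho>) (y + \<rho>, s + \<rho>)) (- c) (\<lambda>z. - V z)"
      using V_solves[OF ys(1) yx(2) s'(1,2) above below] by blast
    define t2 where "t2 = (s + (tstar + delay / 2)) / 2"
    have t2: "s < t2" "t2 < tstar + delay / 2" using s by (auto simp: t2_def)
    define f where "f u = - (\<gamma> * u) - p (X - u) + kap * e (X - u) - M" for u
    define f' where "f' u = - \<gamma> + (2 * alpha * (X - u) - 3 * beta * (X - u)\<^sup>2) - kap * (1 + 2 * m * (X - u))" for u
    define f'' where "f'' u = - (2 * alpha - 6 * beta * (X - u)) + kap * (2 * m)" for u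
    \<comment> \<open>With slope \<open>time_slope\<close> in x the rate becomes -time_slope (X -
      u), the one allowed by \<open>improved_time_drop\<close>.\<close>
    let ?h0 = "- (time_slope * X)"
    have Vf: "- V (y, s) = f y" using M_def by (simp add: f_def G_def)
    have "- c \<le> - (?h0 + time_slope * y) - 1/2 * \<sigma>\<^sup>2 * y\<^sup>2 * f'' y
      - (r - q) * y * (f' y + time_slope * (s - s)) + r * (- V (y, s))"
    proof (rule barrier_touch[OF \<rho>(2,1) _ ys(1) yx t2(1), where f = f and f' = f' and f'' = f''])
      show "(f has_real_derivative f' u) (at u)" for u
        unfolding f_def[abs_def] f'_def p_def e_def
        by (auto intro!: derivative_eq_intros simp: algebra_simps)
      show "(f' has_real_derivative f'' u) (at u)" for u
        unfolding f'_def[abs_def] f''_def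
        by (auto intro!: derivative_eq_intros simp: algebra_simps)
      show "continuous_on {0<..} f''" unfolding f''_def by (intro continuous_intros)
      show "f u + (?h0 + time_slope * u) * (v - s) \<le> - V (u, v)"
        if u: "x \<le> u" "u \<le> X" and v: "s \<le> v" "v \<le> t2" for u v
      proof -
        have "V (u, v) - time_slope * (v - s) * (X - u) \<le> V (u, s)"
        proof (cases "v = s \<or> u = X")
          case True
          then show ?thesis using V_right[of v] V_right[of s] s' v t2 tstar_delay delay by auto
        next
          case False
          then show ?thesis
            using improved_time_drop[of "v - s" v u] u v s' t2 x reach by auto
        qed
        moreover have "G u \<le> M" using y(2) u by (simp add: M_def)
        ultimately show ?thesis by (simp add: f_def G_def algebra_simps)
      qed
      show "- V (y, s) = f y + (?h0 + time_slope * y) * (s - s)" using Vf by simp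
    qed (use r in auto)
    then have main: "- c \<le> time_slope * d - \<sigma>\<^sup>2 * y\<^sup>2 * f'' y / 2 - (r - q) * y * f' y + r * f y"
      unfolding Vf d_def by (simp add: algebra_simps)
    define Y where "Y = \<sigma>\<^sup>2 * y\<^sup>2"
    have Y: "S / 4 \<le> Y" "Y \<le> S"
    proof -
      have "(X / 2)\<^sup>2 \<le> y\<^sup>2" using ys X by (intro power_mono) auto
      then have "\<sigma>\<^sup>2 * (X / 2)\<^sup>2 \<le> \<sigma>\<^sup>2 * y\<^sup>2" by (intro mult_left_mono) auto
      then show "S / 4 \<le> Y" by (simp add: power_divide S_def Y_def)
      show "Y \<le> S" unfolding S_def Y_def using ys yx by (intro mult_left_mono power_mono) auto
    qed
    define R where "R = (r - q) * y"
    have R: "\<bar>R\<bar> \<le> drift_bound * X" unfolding R_def abs_mult using drift ys yx by (intro mult_mono) auto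
    define E where "E = Y * m - R * (1 + 2 * m * d) - r * e d"
    have expand: "time_slope * d - \<sigma>\<^sup>2 * y\<^sup>2 * f'' y / 2 - (r - q) * y * f' y + r * f y
      = time_slope * d - q * \<gamma> * y + Y * alpha - 3 * (Y * beta * d) - R * (2 * alpha * d - 3 * beta * d\<^sup>2)
        - r * p d - r * M - kap * E"
      unfolding E_def R_def Y_def f_def f'_def f''_def d_def[symmetric] by (simp add: field_simps)
    have dd: "3 * drift_bound * X * d + r * d\<^sup>2 \<le> S / 8"
    proof -
      have "d\<^sup>2 \<le> X * d" unfolding power2_eq_square using d by (intro mult_right_mono) auto
      then have "r * d\<^sup>2 \<le> r * (X * d)" using r by (intro mult_left_mono) auto
      moreover have "(3 * drift_bound + r) * (X * d) \<le> (3 * drift_bound + r) * (X * reach)"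
        using d drift r X by (intro mult_left_mono) auto
      moreover have "8 * (3 * drift_bound + r) * reach * X \<le> \<sigma>\<^sup>2 * X * X"
        using reach(3) X by (intro mult_right_mono) auto
      ultimately show ?thesis by (simp add: S_def power2_eq_square algebra_simps)
    qed
    have E: "0 \<le> E"
    proof -
      have "S * m / 4 \<le> Y * m" using mult_right_mono[OF Y(1), of m] m(1) by simp
      moreover have "R * (1 + 2 * m * d) \<le> drift_bound * X * (1 + 2 * m * d)"
        using R m d by (intro mult_right_mono) auto
      moreover have "r * d \<le> r * X" using d r by (intro mult_left_mono) auto
      moreover have "m * (2 * drift_bound * X * d + r * d\<^sup>2) \<le> m * (S / 8)"
      proof (rule mult_left_mono)
        have "0 \<le> drift_bound * X * d" using drift X d by simp
        then show "2 * drift_bound * X * d + r * d\<^sup>2 \<le> S / 8" using dd by linarith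
      qed (use m in auto)
      ultimately show ?thesis using m(2) unfolding E_def e_def by (simp add: algebra_simps)
    qed
    have b1: "Y * alpha \<le> q * K - c"
      using mult_right_mono[OF Y(2), of alpha] alpha by (simp add: S_def)
    have b2: "S * (beta * d) / 4 \<le> Y * beta * d"
      using mult_right_mono[OF Y(1), of "beta * d"] beta d by (simp add: mult.assoc)
    have b3: "- (R * (2 * alpha * d - 3 * beta * d\<^sup>2)) \<le> drift_bound * X * (2 * alpha * d + 3 * beta * d\<^sup>2)"
    proof -
      have "\<bar>2 * alpha * d - 3 * beta * d\<^sup>2\<bar> \<le> 2 * alpha * d + 3 * beta * d\<^sup>2"
        using alpha beta d by (simp add: abs_le_iff)
      then have "\<bar>R * (2 * alpha * d - 3 * beta * d\<^sup>2)\<bar> \<le> drift_bound * X * (2 * alpha * d + 3 * beta * d\<^sup>2)"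
        unfolding abs_mult using R drift X by (intro mult_mono) auto
      then show ?thesis by (rule order_trans[OF abs_ge_minus_self])
    qed
    have b4: "- (r * p d) \<le> r * beta * d^3"
      using alpha r by (simp add: p_def algebra_simps)
    have b5: "(beta * d) * (3 * drift_bound * X * d + r * d\<^sup>2) \<le> (beta * d) * (S / 8)"
      using dd beta d by (intro mult_left_mono) auto
    have b6: "S * beta * d = 2 * (q * \<gamma> + time_slope + 2 * alpha * X * drift_bound) * d"
      using beta(2) unfolding S_def by simp
    have b7: "0 \<le> kap * E" "0 < r * M" "0 \<le> S * beta * d" using kap E r True S beta d by auto
    have b8: "q * \<gamma> * y = q * K - q * \<gamma> * d" using X(2) unfolding d_def by (simp add: algebra_simps)
    have "drift_bound * X * (2 * alpha * d + 3 * beta * d\<^sup>2) + r * beta * d^3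
        = 2 * alpha * X * drift_bound * d + (beta * d) * (3 * drift_bound * X * d + r * d\<^sup>2)"
      by (simp add: algebra_simps power2_eq_square power3_eq_cube)
    moreover have "(beta * d) * (S / 8) = S * beta * d / 8" "S * (beta * d) / 4 = S * beta * d / 4" by simp_all
    moreover have "2 * (q * \<gamma> + time_slope + 2 * alpha * X * drift_bound) * d
        = 2 * (q * \<gamma> * d) + 2 * (time_slope * d) + 2 * (2 * alpha * X * drift_bound * d)"
      by (simp add: algebra_simps)
    \<comment> \<open>The terms of order zero cancel by the choice of \<open>alpha\<close>. In units
      of S beta d the linear errors cost 1/2 by the choice of \<open>beta\<close>, the drift and
      zero-order parts of the cubic cost 1/8, and the diffusion returns 3/4; the positive term rM
      makes the contradiction strict.\<close>
    ultimately show False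
      using main b1 b2 b3 b4 b5 b6 b7 b8 unfolding expand by argo
  qed
qed

lemma free_boundary_linear:
  assumes fb: "(x, t) \<in> \<Gamma>" and x: "X - x < reach" "X - x \<le> alpha / (2 * beta)"
  shows "t - tstar \<le> - (alpha / (2 * time_slope) * (X - x))"
proof -
  note b = free_boundaryD[OF fb]
  define d where "d = X - x"
  have d: "0 < d" using b by (simp add: d_def)
  have t: "t \<le> tstar" using no_contact_after_tstar[OF b(1,2,3) _ b(4)] b(5) by force
  \<comment> \<open>The quadratic bound is known for times after \<open>tstar\<close> only;
    continuity from the right carries it to \<open>tstar\<close> itself.\<close>
  have lower: "\<gamma> * x + alpha * d\<^sup>2 - beta * d^3 \<le> V (x, tstar)"
  proof -
    define t2 where "t2 = tstar + delay / 2"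
    have t2: "tstar < t2" "t2 < T" using delay tstar_delay by (auto simp: t2_def)
    have "continuous_on {tstar..t2} (\<lambda>s. V (x, s))"
      using b tstar_pos t2 by (intro cont_V_compose continuous_intros) auto
    then have "((\<lambda>s. V (x, s)) \<longlongrightarrow> V (x, tstar)) (at tstar within {tstar..t2})"
      unfolding continuous_on_def using t2 by simp
    then have "((\<lambda>s. V (x, s)) \<longlongrightarrow> V (x, tstar)) (at_right tstar)"
      using at_within_Icc_at_right[OF t2(1)] by simp
    moreover have "eventually (\<lambda>s. \<gamma> * x + alpha * d\<^sup>2 - beta * d^3 \<le> V (x, s)) (at_right tstar)"
      unfolding eventually_at_right[OF t2(1)]
      using t2(1) quadratic_lower_bound b x unfolding d_def t2_def
      by (intro exI[of _ "tstar + delay / 2"]) auto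
    ultimately show ?thesis by (intro tendsto_lowerbound) auto
  qed
  \<comment> \<open>The restriction d \<le> alpha/(2 beta) leaves at least half of the quadratic
    term.\<close>
  have bd: "beta * d \<le> alpha / 2" using x(2) beta unfolding d_def by (simp add: field_simps)
  have "beta * d * d\<^sup>2 \<le> alpha / 2 * d\<^sup>2" using bd by (intro mult_right_mono) auto
  then have p: "alpha / 2 * d\<^sup>2 \<le> alpha * d\<^sup>2 - beta * d^3"
    by (simp add: power3_eq_cube power2_eq_square field_simps)
  have pos: "0 < alpha / 2 * d\<^sup>2" using alpha d by simp
  have "t < tstar"
  proof (rule ccontr)
    assume "\<not> t < tstar"
    then have "t = tstar" using t by simp
    then have "V (x, tstar) = \<gamma> * x" using b(5) by simp
    then show False using lower p pos by linarith
  qed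
  then have "V (x, tstar) - time_slope * (tstar - t) * d \<le> V (x, t)"
    using improved_time_drop[of "tstar - t" tstar x] b x reach delay tstar by (simp add: d_def)
  then have "alpha / 2 * d\<^sup>2 \<le> time_slope * (tstar - t) * d" using lower p b(5) by linarith
  then have "(alpha / 2 * d) * d \<le> (time_slope * (tstar - t)) * d" by (simp add: power2_eq_square)
  then have "alpha / 2 * d \<le> time_slope * (tstar - t)" by (rule mult_right_le_imp_le[OF _ d])
  then have "(alpha / 2 * d) / time_slope \<le> tstar - t"
    using time_slope(1) by (simp only: pos_divide_le_eq mult.commute)
  then show ?thesis unfolding d_def by simp
qed

end

theorem theorem2p2:
  fixes K \<gamma> T \<sigma> r q c :: real
  assumes "K > 0" and "\<gamma> > 0" and "T > 0" and "\<sigma> > 0" and "r > 0" and "q > 0" and "c \<ge> 0"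
    and "c < r * K" and "c < q * K"
  shows "\<exists>\<omega> r0. modulus_of_continuity \<omega> \<and> r0 > 0 \<and>
    (\<forall>V tstar.
       bond_solution K \<gamma> T \<sigma> r q c V \<and> regular_at_zero T V \<and>
       conversion_region K \<gamma> T V \<noteq> {} \<and>
       tstar < T \<and> hits_only_at K \<gamma> T V (K/\<gamma>, tstar) \<longrightarrow>
       free_boundary K \<gamma> T V \<inter> parabolic_cylinder r0 (K/\<gamma>, tstar)
         \<subseteq> {(x, t). t - tstar \<le> - (\<bar>x - K/\<gamma>\<bar>\<^sup>2 / \<omega> \<bar>x - K/\<gamma>\<bar>)})"
proof -
  interpret bond_data K \<gamma> T \<sigma> r q c using assms by unfold_locales
  \<comment> \<open>The reciprocal of the slope in \<open>free_boundary_linear\<close>: with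
    \<omega>(d) = kd the quotient d^2/\<omega>(d) is exactly that linear bound.\<close>
  define k where "k = 2 * time_slope / alpha"
  have k: "k > 0" using time_slope alpha by (simp add: k_def)
  define r0 where "r0 = min reach (alpha / (2 * beta))"
  have r0: "r0 > 0" using reach alpha beta by (simp add: r0_def)
  have "((\<lambda>s. k * s) \<longlongrightarrow> k * 0) (at_right 0)" by (intro tendsto_intros)
  then have "modulus_of_continuity (\<lambda>s. k * s)"
    using k by (auto simp: modulus_of_continuity_def intro!: mono_onI)
  moreover have "free_boundary K \<gamma> T V \<inter> parabolic_cylinder r0 (K/\<gamma>, tstar)
         \<subseteq> {(x, t). t - tstar \<le> - (\<bar>x - K/\<gamma>\<bar>\<^sup>2 / (k * \<bar>x - K/\<gamma>\<bar>))}"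
    if sol: "bond_solution K \<gamma> T \<sigma> r q c V" and hit: "tstar < T" "hits_only_at K \<gamma> T V (K/\<gamma>, tstar)" for V tstar
  proof (intro subsetI)
    fix z assume z: "z \<in> free_boundary K \<gamma> T V \<inter> parabolic_cylinder r0 (K/\<gamma>, tstar)"
    interpret bond_hit K \<gamma> T \<sigma> r q c V tstar using sol hit by unfold_locales
    obtain x t where zxt: "z = (x, t)" by (cases z)
    have fb: "(x, t) \<in> free_boundary K \<gamma> T V" using z zxt by simp
    have d: "\<bar>x - K/\<gamma>\<bar> = X - x" "0 < X - x"
      using free_boundaryD(2)[OF fb] by (auto simp: X_def)
    have "X - x < r0" using z unfolding zxt parabolic_cylinder_def by (simp add: d)
    then have "t - tstar \<le> - (alpha / (2 * time_slope) * (X - x))"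
      by (intro free_boundary_linear[OF fb]) (auto simp: r0_def)
    also have "alpha / (2 * time_slope) * (X - x) = (X - x)\<^sup>2 / (k * (X - x))"
      using d(2) time_slope(1) alpha(1) by (simp add: k_def power2_eq_square field_simps)
    finally show "z \<in> {(x, t). t - tstar \<le> - (\<bar>x - K/\<gamma>\<bar>\<^sup>2 / (k * \<bar>x - K/\<gamma>\<bar>))}"
      unfolding zxt mem_Collect_eq prod.case d(1) .
  qed
  ultimately show ?thesis using r0 by (intro exI[of _ "\<lambda>s. k * s"] exI[of _ r0]) blast
qed

end
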